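(* For any $m=m(n)\ge 3$, $k=k(n)\in[4,\frac{n}{2\ln n}]$ and $\varepsilon=\varepsilon(n)\in(\frac4k,1-\frac1k)$, there are unsatisfiable $4m$-CNF formulas $F_N$ with $N$ variables and formula size $O(16^m\cdot N)$, where $2k^2n^{\lfloor\varepsilon k\rfloor}m\le N\le 40k^2(2n)^{\lfloor\varepsilon k\rfloor}m$, which are refutable in resolution in width $m(k+3)$, but for which every treelike resolution refutation of width at most $(m-1)(1+\varepsilon)k$ has size at least $2^{\Omega(n^k)}$.
   Context: A clause is a disjunction of literals over distinct variables; its width is its number of literals; a $w$-CNF is a set of clauses of width at most $w$; formula size is the sum of clause widths. A resolution refutation is a sequence of clauses ending in the empty clause, each in the formula or derived from earlier $C\lor x$, $D\lor\neg x$ as $C\lor D$; width is the maximum clause width and size the number of clauses. It is treelike if the derivation DAG (edges from premises to derived clauses) is a tree. *)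

theory Defs
  imports Complex_Main
begin

datatype 'v lit = Pos 'v | Neg 'v

primrec var_of :: "'v lit \<Rightarrow> 'v" where
  "var_of (Pos x) = x"
| "var_of (Neg x) = x"

type_synonym 'v clause = "'v lit set"
type_synonym 'v formula = "'v clause set"

definition is_clause :: "'v clause \<Rightarrow> bool" where
  "is_clause C \<longleftrightarrow> finite C \<and> inj_on var_of C"

definition vars_clause :: "'v clause \<Rightarrow> 'v set" where
  "vars_clause C = var_of ` C"

abbreviation clause_width :: "'v clause \<Rightarrow> nat" where
  "clause_width C \<equiv> card C"

definition is_CNF :: "nat \<Rightarrow> 'v formula \<Rightarrow> bool" where
  "is_CNF w F \<longleftrightarrow> finite F \<and> (\<forall>C\<in>F. is_clause C \<and> clause_width C \<le> w)"

definition formula_vars :: "'v formula \<Rightarrow> 'v set" where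
  "formula_vars F = (\<Union>C\<in>F. vars_clause C)"

definition formula_size :: "'v formula \<Rightarrow> nat" where
  "formula_size F = (\<Sum>C\<in>F. clause_width C)"

primrec lit_true :: "('v \<Rightarrow> bool) \<Rightarrow> 'v lit \<Rightarrow> bool" where
  "lit_true \<alpha> (Pos x) = \<alpha> x"
| "lit_true \<alpha> (Neg x) = (\<not> \<alpha> x)"

definition satisfies :: "('v \<Rightarrow> bool) \<Rightarrow> 'v formula \<Rightarrow> bool" where
  "satisfies \<alpha> F \<longleftrightarrow> (\<forall>C\<in>F. \<exists>l\<in>C. lit_true \<alpha> l)"

definition unsatisfiable :: "'v formula \<Rightarrow> bool" where
  "unsatisfiable F \<longleftrightarrow> (\<nexists>\<alpha>. satisfies \<alpha> F)"

text \<open>The side conditions on \<open>x\<close> say that \<open>C \<or> x\<close> and \<open>D \<or> \<not>x\<close> mention \<open>x\<close> only once.\<close>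

definition resolvent :: "'v clause \<Rightarrow> 'v clause \<Rightarrow> 'v clause \<Rightarrow> bool" where
  "resolvent A B R \<longleftrightarrow>
     (\<exists>x C D. x \<notin> vars_clause C \<and> x \<notin> vars_clause D \<and>
        A = insert (Pos x) C \<and> B = insert (Neg x) D \<and> R = C \<union> D)"

text \<open>A sequence of clauses may be justified in several ways, and the derivation DAG depends on
  the choice. Each line therefore records its justification; \<open>Res i j\<close> refers to earlier
  positions of the sequence. The same clause may occur at several positions.\<close>

datatype justification = Ax | Res nat nat

type_synonym 'v derivation = "('v clause \<times> justification) list"

definition is_refutation :: "'v formula \<Rightarrow> 'v derivation \<Rightarrow> bool" where
  "is_refutation F \<pi> \<longleftrightarrow>
     \<pi> \<noteq> [] \<and> fst (last \<pi>) = {} \<and>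
     (\<forall>i < length \<pi>. is_clause (fst (\<pi> ! i)) \<and>
        (case snd (\<pi> ! i) of
           Ax \<Rightarrow> fst (\<pi> ! i) \<in> F
         | Res a b \<Rightarrow> a < i \<and> b < i \<and>
             resolvent (fst (\<pi> ! a)) (fst (\<pi> ! b)) (fst (\<pi> ! i))))"

definition width :: "'v derivation \<Rightarrow> nat" where
  "width \<pi> = Max ((\<lambda>l. clause_width (fst l)) ` set \<pi>)"

definition size_of :: "'v derivation \<Rightarrow> nat" where
  "size_of \<pi> = length \<pi>"

definition dag_edges :: "'v derivation \<Rightarrow> (nat \<times> nat) set" where
  "dag_edges \<pi> =
     {(p, i). i < length \<pi> \<and> (\<exists>a b. snd (\<pi> ! i) = Res a b \<and> (p = a \<or> p = b))}"

definition is_walk :: "(nat \<times> nat) set \<Rightarrow> nat \<Rightarrow> nat list \<Rightarrow> nat \<Rightarrow> bool" where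
  "is_walk E u p v \<longleftrightarrow>
     p \<noteq> [] \<and> hd p = u \<and> last p = v \<and> successively (\<lambda>x y. (x, y) \<in> E) p"

text \<open>The DAG is a tree, rooted at a line to which every line has exactly one directed path; this
  root is necessarily the last line.\<close>

definition treelike :: "'v derivation \<Rightarrow> bool" where
  "treelike \<pi> \<longleftrightarrow>
     (\<exists>r < length \<pi>. \<forall>i < length \<pi>. \<exists>!p. is_walk (dag_edges \<pi>) i p r)"

end

theory Submission
  imports Defs "HOL-Library.Z2" "HOL-Library.Countable" "HOL-Number_Theory.Cong"
    "HOL-Real_Asymp.Real_Asymp" "HOL-Analysis.Harmonic_Numbers"
begin

text \<open>
  The base system consists of parity constraints on a cubic graph, a long helix of \<open>K = k + 1\<close> rows,
  with a single odd charge. A cut swept along the helix never needs more than \<open>k + 3\<close> edges at a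
  time, which gives the narrow refutation. The helix has more than \<open>n ^ k\<close> columns; to keep the number
  of variables near \<open>k\<^sup>2 n ^ e\<close>, the variables of row \<open>i\<close> are identified periodically, modulo a product of
  \<open>e = \<lfloor>\<epsilon> k\<rfloor>\<close> out of \<open>K\<close> pairwise coprime numbers \<open>q j\<close> between \<open>n\<close> and \<open>2 n\<close>, each of which is used
  by \<open>e\<close> cyclically consecutive rows.

  The compression does not help a prover that remembers at most \<open>k + e\<close> variables. Such a set
  containing a cut meets every row, so fewer than \<open>e\<close> rows contain two of its variables, and each \<open>q j\<close>
  is used by a row with a single variable. By the Chinese remainder theorem the cut is thus located,
  up to one step, in a helix with more than \<open>n ^ k\<close> columns. Adding two parity constraints therefore moves the
  located cut by at most one step, and a contradiction needs depth \<open>n ^ k\<close>.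

  Replacing each variable by the parity of \<open>m\<close> bits turns depth into the size of trees: a variable counts
  as remembered once \<open>m - 1\<close> of its bits are, and its last bit can then still be answered
  either way, so every newly remembered variable doubles the tree.
\<close>

text \<open>The lower bound rests on commitments. A sum of constraints with a small boundary
  contains neither end of the helix, one end, or both. To reach one, a cut near the left end and a
  cut near the right end would have to lie in one small set, which the uniqueness of positions
  forbids. Positions are known only modulo the product of all \<open>q j\<close>; both ends would
  coincide on a helix with that many blocks of \<open>Q\<close> columns, so half as many are used.
  Identification lets coefficients of distant columns cancel. Positions are readable nonetheless
  because a small set misses some column class modulo \<open>Q\<close>, and along it the sums of
  coefficients over a residue class modulo \<open>q j\<close> agree in all rows using
  \<open>q j\<close>. The moduli are \<open>k + 1\<close> primes in \<open>[n, 2 n]\<close>. The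
  usual proof of Bertrand's postulate gives only about ln 4 / 3 < 1/2 times n / ln n of them; a
  quotient of two binomial coefficients raises the constant to at least 32/63 > 1/2.\<close>

declare add_bit_eq_xor [simp del] mult_bit_eq_and [simp del]

section \<open>Arithmetic in the field with two elements\<close>

lemma bit_add_self [simp]: "(a::bit) + a = 0"
  by (cases a) auto

lemma bit_add_self_left [simp]: "(a::bit) + (a + b) = b"
  by (simp add: add.assoc[symmetric])

lemma bit_add_eq_0_iff: "(a::bit) + b = 0 \<longleftrightarrow> a = b"
  by (metis bit_add_self bit_add_self_left add.right_neutral)

lemma sum_symdiff:
  fixes f :: "'a \<Rightarrow> bit"
  assumes "finite A" "finite B"
  shows "(\<Sum>a\<in>(A - B) \<union> (B - A). f a) = (\<Sum>a\<in>A. f a) + (\<Sum>a\<in>B. f a)"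
proof -
  have "(\<Sum>a\<in>A. f a) = (\<Sum>a\<in>A \<inter> B. f a) + (\<Sum>a\<in>A - B. f a)"
    using assms by (metis sum.Int_Diff)
  moreover have "(\<Sum>a\<in>B. f a) = (\<Sum>a\<in>A \<inter> B. f a) + (\<Sum>a\<in>B - A. f a)"
    using assms by (metis sum.Int_Diff inf_commute)
  moreover have "(\<Sum>a\<in>(A - B) \<union> (B - A). f a) = (\<Sum>a\<in>A - B. f a) + (\<Sum>a\<in>B - A. f a)"
    by (rule sum.union_disjoint) (use assms in auto)
  ultimately show ?thesis by (simp add: ac_simps)
qed

section \<open>Parity constraints and tree-shaped derivations\<close>

text \<open>The one clause over exactly \<open>A\<close> that \<alpha> falsifies. Clauses are read
  throughout as the partial assignments falsifying them.\<close>

definition fclause :: "'v set \<Rightarrow> ('v \<Rightarrow> bool) \<Rightarrow> 'v clause" where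
  "fclause A \<alpha> = (\<lambda>v. if \<alpha> v then Neg v else Pos v) ` A"

definition parity :: "('v \<Rightarrow> bool) \<Rightarrow> 'v set \<Rightarrow> bit" where "parity \<alpha> A = (\<Sum>v\<in>A. if \<alpha> v then 1 else 0)"

text \<open>The canonical CNF of "all bits of the groups in \<open>S\<close> sum to
  \<open>b\<close>": one clause for each violating assignment.\<close>

definition xlift :: "('a \<Rightarrow> 'v set) \<Rightarrow> 'a set \<Rightarrow> bit \<Rightarrow> 'v formula" where
  "xlift grp S b = {fclause (\<Union>a\<in>S. grp a) \<alpha> | \<alpha>. parity \<alpha> (\<Union>a\<in>S. grp a) \<noteq> b}"

lemma vars_fclause [simp]: "vars_clause (fclause A \<alpha>) = A"
proof -
  have "var_of (if \<alpha> v then Neg v else Pos v) = v" for v by simp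
  thus ?thesis by (simp only: vars_clause_def fclause_def image_image image_ident)
qed

lemma Neg_fclause: "Neg v \<in> fclause A \<alpha> \<longleftrightarrow> v \<in> A \<and> \<alpha> v"
  by (auto simp: fclause_def image_iff)

lemma vars_insert [simp]: "vars_clause (insert l C) = insert (var_of l) (vars_clause C)"
  and vars_Un [simp]: "vars_clause (C \<union> D) = vars_clause C \<union> vars_clause D"
  by (auto simp: vars_clause_def)

lemma card_vars: "is_clause C \<Longrightarrow> card (vars_clause C) = card C"
  by (simp add: is_clause_def vars_clause_def card_image)

lemma clause_sign:
  assumes "is_clause C" "v \<in> vars_clause C" shows "Neg v \<in> C \<longleftrightarrow> Pos v \<notin> C"
proof -
  obtain l where "l \<in> C" "var_of l = v" using assms(2) by (auto simp: vars_clause_def)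
  moreover have "\<not> (Neg v \<in> C \<and> Pos v \<in> C)"
    using assms(1) unfolding is_clause_def inj_on_def by (metis lit.distinct(1) var_of.simps)
  ultimately show ?thesis by (cases l) auto
qed

definition sat_on :: "('a set \<times> bit) set \<Rightarrow> 'a set \<Rightarrow> ('a \<Rightarrow> bit) \<Rightarrow> bool" where
  "sat_on L X \<rho> \<longleftrightarrow> (\<forall>S b. (S, b) \<in> L \<longrightarrow> S \<subseteq> X \<longrightarrow> (\<Sum>a\<in>S. \<rho> a) = b)"

lemma sat_on_mono: "sat_on L X \<rho> \<Longrightarrow> L' \<subseteq> L \<Longrightarrow> X' \<subseteq> X \<Longrightarrow> sat_on L' X' \<rho>"
  unfolding sat_on_def by blast

text \<open>One constraint through \<open>a\<close> dictates the new value. Any other constraint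
  through \<open>a\<close> agrees with it, because \<open>a\<close> cancels in the sum of the two,
  and this sum belongs to \<open>L\<close> and already holds on \<open>X\<close>.\<close>

lemma sat_on_extend:
  assumes s: "sat_on L X \<rho>" and X: "finite X" "a \<notin> X" "card (insert a X) \<le> W" and L': "L' \<subseteq> L"
    and cl: "\<And>A a B b. (A, a) \<in> L' \<Longrightarrow> (B, b) \<in> L' \<Longrightarrow> card (A \<union> B) \<le> W \<Longrightarrow> ((A - B) \<union> (B - A), a + b) \<in> L"
  shows "\<exists>v. sat_on L' (insert a X) (\<rho>(a := v))"
proof (cases "\<exists>S0 b0. (S0, b0) \<in> L' \<and> a \<in> S0 \<and> S0 \<subseteq> insert a X")
  case False
  have "sat_on L' (insert a X) \<rho>" unfolding sat_on_def
  proof (intro allI impI)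
    fix S b assume "(S, b) \<in> L'" "S \<subseteq> insert a X"
    moreover from this have "S \<subseteq> X" using False by blast
    ultimately show "(\<Sum>a\<in>S. \<rho> a) = b" using s L' by (auto simp: sat_on_def)
  qed
  thus ?thesis by (metis fun_upd_triv)
next
  case True
  then obtain S0 b0 where S0: "(S0, b0) \<in> L'" "a \<in> S0" "S0 \<subseteq> insert a X" by blast
  define v where "v = b0 + (\<Sum>u\<in>S0 - {a}. \<rho> u)"
  let ?r = "\<rho>(a := v)"
  have fin: "finite S" if "S \<subseteq> insert a X" for S using that X(1) finite_subset by auto
  have s0: "(\<Sum>u\<in>S0. ?r u) = b0"
  proof -
    have "(\<Sum>u\<in>S0. ?r u) = v + (\<Sum>u\<in>S0 - {a}. ?r u)" using sum.remove[OF fin[OF S0(3)] S0(2), of ?r] by simp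
    also have "(\<Sum>u\<in>S0 - {a}. ?r u) = (\<Sum>u\<in>S0 - {a}. \<rho> u)" by (rule sum.cong) auto
    finally show ?thesis by (simp add: v_def ac_simps)
  qed
  have "sat_on L' (insert a X) ?r" unfolding sat_on_def
  proof (intro allI impI)
    fix S b assume S: "(S, b) \<in> L'" "S \<subseteq> insert a X"
    show "(\<Sum>u\<in>S. ?r u) = b"
    proof (cases "a \<in> S")
      case False
      hence "S \<subseteq> X" using S by blast
      hence "(\<Sum>u\<in>S. \<rho> u) = b" using s S L' by (auto simp: sat_on_def)
      moreover have "(\<Sum>u\<in>S. ?r u) = (\<Sum>u\<in>S. \<rho> u)" using False by (intro sum.cong) auto
      ultimately show ?thesis by simp
    next
      case True
      let ?D = "(S - S0) \<union> (S0 - S)"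
      have "card (S \<union> S0) \<le> W" using card_mono[of "insert a X" "S \<union> S0"] X S S0 by simp
      hence "(?D, b + b0) \<in> L" by (rule cl[OF S(1) S0(1)])
      moreover have "?D \<subseteq> X" using S S0 True by blast
      ultimately have "(\<Sum>u\<in>?D. \<rho> u) = b + b0" using s by (auto simp: sat_on_def)
      moreover have "(\<Sum>u\<in>?D. ?r u) = (\<Sum>u\<in>?D. \<rho> u)" using True S0 by (intro sum.cong) auto
      ultimately have "(\<Sum>u\<in>S. ?r u) + b0 = b + b0" using sum_symdiff[of S S0 ?r] fin S S0 s0 by auto
      thus ?thesis by simp
    qed
  qed
  thus ?thesis by blast
qed

section \<open>Walks and subtrees in a treelike derivation\<close>

lemma is_walk_snoc:
  assumes "is_walk E u p v" "(v, w) \<in> E" shows "is_walk E u (p @ [w]) w"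
  using assms by (auto simp: is_walk_def successively_append_iff)

lemma is_walk_app:
  assumes "is_walk E u p v" "is_walk E v (v # r) w" shows "is_walk E u (p @ r) w"
proof (cases r)
  case Nil thus ?thesis using assms by (auto simp: is_walk_def)
next
  case (Cons x ys) thus ?thesis using assms by (auto simp: is_walk_def successively_append_iff)
qed

lemma is_walk_Cons: "is_walk E u p v \<Longrightarrow> \<exists>r. p = u # r"
  by (cases p) (auto simp: is_walk_def)

definition below :: "'v derivation \<Rightarrow> nat \<Rightarrow> nat set" where
  "below \<pi> i = {j. j < length \<pi> \<and> (\<exists>p. is_walk (dag_edges \<pi>) j p i)}"

lemma below_self: "i < length \<pi> \<Longrightarrow> i \<in> below \<pi> i"
  by (auto simp: below_def is_walk_def intro!: exI[of _ "[i]"])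

lemma below_step:
  assumes "i < length \<pi>" "snd (\<pi> ! i) = Res a b"
  shows "below \<pi> a \<subseteq> below \<pi> i" "below \<pi> b \<subseteq> below \<pi> i"
proof -
  have "(a, i) \<in> dag_edges \<pi>" "(b, i) \<in> dag_edges \<pi>" using assms by (auto simp: dag_edges_def)
  thus "below \<pi> a \<subseteq> below \<pi> i" "below \<pi> b \<subseteq> below \<pi> i"
    by (auto simp: below_def intro: is_walk_snoc)
qed

text \<open>A line below both premises would reach \<open>i\<close>, and from there the root, by two
  walks that differ just before \<open>i\<close>.\<close>

lemma below_disjoint:
  assumes t: "treelike \<pi>" and i: "i < length \<pi>" "snd (\<pi> ! i) = Res a b" and ab: "a \<noteq> b"
  shows "below \<pi> a \<inter> below \<pi> b = {}"
proof (rule ccontr)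
  assume "below \<pi> a \<inter> below \<pi> b \<noteq> {}"
  then obtain j p1 p2 where j: "j < length \<pi>" "is_walk (dag_edges \<pi>) j p1 a" "is_walk (dag_edges \<pi>) j p2 b"
    by (auto simp: below_def)
  obtain r where r: "\<forall>i < length \<pi>. \<exists>!p. is_walk (dag_edges \<pi>) i p r" using t by (auto simp: treelike_def)
  obtain p where p: "is_walk (dag_edges \<pi>) i p r" using r i by blast
  then obtain q where q: "p = i # q" using is_walk_Cons by blast
  have e: "(a, i) \<in> dag_edges \<pi>" "(b, i) \<in> dag_edges \<pi>" using i by (auto simp: dag_edges_def)
  have "is_walk (dag_edges \<pi>) j ((p1 @ [i]) @ q) r" "is_walk (dag_edges \<pi>) j ((p2 @ [i]) @ q) r"
    using is_walk_app[OF is_walk_snoc[OF j(2) e(1)]] is_walk_app[OF is_walk_snoc[OF j(3) e(2)]] p q by auto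
  hence "(p1 @ [i]) @ q = (p2 @ [i]) @ q" using r j by blast
  hence "p1 = p2" by simp
  thus False using j ab by (auto simp: is_walk_def)
qed

lemma below_card_add:
  assumes t: "treelike \<pi>" and i: "i < length \<pi>" "snd (\<pi> ! i) = Res a b" and ab: "a \<noteq> b"
  shows "card (below \<pi> a) + card (below \<pi> b) \<le> card (below \<pi> i)"
proof -
  have fin: "finite (below \<pi> i)" for i by (simp add: below_def)
  have "card (below \<pi> a) + card (below \<pi> b) = card (below \<pi> a \<union> below \<pi> b)"
    using card_Un_disjoint[OF fin fin below_disjoint[OF assms]] by simp
  also have "\<dots> \<le> card (below \<pi> i)" using below_step[OF i] by (intro card_mono[OF fin]) auto
  finally show ?thesis .
qed

section \<open>Lifting width-bounded depth to tree size\<close>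

locale parity_lifting =
  fixes grp :: "'a \<Rightarrow> 'v set" and m :: nat
  assumes grp: "finite (grp a)" "card (grp a) = m" and m: "2 \<le> m"
    and disj: "a \<noteq> b \<Longrightarrow> grp a \<inter> grp b = {}"
begin

definition known :: "'v clause \<Rightarrow> 'a set" where
  "known C = {a. m - 1 \<le> card (vars_clause C \<inter> grp a)}"

text \<open>The value of \<open>v\<close> in the assignment that falsifies \<open>C\<close>.\<close>

definition forced_bit :: "'v clause \<Rightarrow> 'v \<Rightarrow> bit" where "forced_bit C v = (if Neg v \<in> C then 1 else 0)"

text \<open>The invariant carried from the last line towards the axioms. The bits of a group bind
  the value of its variable only once all of them occur in the clause.\<close>

definition state :: "('a set \<times> bit) set \<Rightarrow> 'v clause \<Rightarrow> ('a \<Rightarrow> bit) \<Rightarrow> bool" where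
  "state L C \<rho> \<longleftrightarrow> sat_on L (known C) \<rho> \<and> (\<forall>a. grp a \<subseteq> vars_clause C \<longrightarrow> \<rho> a = (\<Sum>v\<in>grp a. forced_bit C v))"

text \<open>Each known variable takes up \<open>m - 1\<close> bits of the clause, and groups are
  disjoint.\<close>

lemma known_bound:
  assumes C: "is_clause C" "card C < (m - 1) * (W + 1)"
  shows "finite (known C) \<and> card (known C) \<le> W"
proof -
  have fin: "finite (vars_clause C)" using C by (simp add: is_clause_def vars_clause_def)
  have le: "card A \<le> W" if A: "finite A" "A \<subseteq> known C" for A
  proof -
    have "card A * (m - 1) \<le> (\<Sum>a\<in>A. card (vars_clause C \<inter> grp a))"
      using sum_bounded_below[of A "m - 1" "\<lambda>a. card (vars_clause C \<inter> grp a)"] A by (auto simp: known_def)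
    also have "\<dots> = card (\<Union>a\<in>A. vars_clause C \<inter> grp a)"
      by (rule card_UN_disjoint[symmetric]) (use A fin disj in auto)
    also have "\<dots> \<le> card (vars_clause C)" by (rule card_mono[OF fin]) auto
    also have "\<dots> < (m - 1) * (W + 1)" using C card_vars[of C] by simp
    finally have "(m - 1) * card A < (m - 1) * (W + 1)" by (simp only: mult.commute)
    hence "card A < W + 1" by (rule mult_left_less_imp_less) simp
    thus ?thesis by simp
  qed
  have "finite (known C)"
  proof (rule ccontr)
    assume "infinite (known C)"
    then obtain A where "finite A" "card A = W + 1" "A \<subseteq> known C" using infinite_arbitrarily_large by metis
    thus False using le[of A] by simp
  qed
  thus ?thesis using le by blast
qed

text \<open>A step from a conclusion \<open>C\<close> to a premise \<open>A\<close>. Read upwards,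
  \<open>x\<close> is the bit being queried, and everything else in \<open>A\<close> is remembered
  from \<open>C\<close>.\<close>

definition child :: "'v clause \<Rightarrow> 'v clause \<Rightarrow> 'v \<Rightarrow> bool" where
  "child C A x \<longleftrightarrow> is_clause C \<and> vars_clause A \<subseteq> insert x (vars_clause C) \<and> x \<notin> vars_clause C
     \<and> (\<forall>v\<in>vars_clause A - {x}. (Neg v \<in> A) = (Neg v \<in> C))"

lemma known_child: assumes "child C A x" "a \<in> known A" "x \<notin> grp a" shows "a \<in> known C"
proof -
  have "vars_clause A \<inter> grp a \<subseteq> vars_clause C \<inter> grp a" using assms by (auto simp: child_def)
  hence "card (vars_clause A \<inter> grp a) \<le> card (vars_clause C \<inter> grp a)" using grp by (intro card_mono) auto
  thus ?thesis using assms(2) by (simp add: known_def)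
qed

lemma full_known: "grp a \<subseteq> vars_clause A \<Longrightarrow> a \<in> known A"
  using grp(2)[of a] unfolding known_def by (simp add: Int_absorb1)

lemma full_child:
  assumes "child C A x" "grp a \<subseteq> vars_clause A" "x \<notin> grp a"
  shows "grp a \<subseteq> vars_clause C" "(\<Sum>v\<in>grp a. forced_bit A v) = (\<Sum>v\<in>grp a. forced_bit C v)"
proof -
  show "grp a \<subseteq> vars_clause C" using assms by (auto simp: child_def)
  show "(\<Sum>v\<in>grp a. forced_bit A v) = (\<Sum>v\<in>grp a. forced_bit C v)"
    by (rule sum.cong[OF refl]) (use assms in \<open>auto simp: child_def forced_bit_def\<close>)
qed

text \<open>If no variable becomes known, the known set does not grow, so \<rho> survives at the
  same level.\<close>

lemma state_keep:
  assumes c: "child C A x" and s: "state L C \<rho>"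
    and k: "\<And>a. x \<in> grp a \<Longrightarrow> a \<in> known A \<Longrightarrow> a \<in> known C \<and> (grp a \<subseteq> vars_clause A \<longrightarrow> \<rho> a = (\<Sum>v\<in>grp a. forced_bit A v))"
  shows "state L A \<rho>"
proof -
  have "known A \<subseteq> known C" using known_child[OF c] k by blast
  moreover have "\<rho> a = (\<Sum>v\<in>grp a. forced_bit A v)" if "grp a \<subseteq> vars_clause A" for a
  proof (cases "x \<in> grp a")
    case True thus ?thesis using k full_known[OF that] that by blast
  next
    case False thus ?thesis using full_child[OF c that] s by (simp add: state_def)
  qed
  moreover have "sat_on L (known C) \<rho>" using s by (simp add: state_def)
  ultimately show ?thesis using sat_on_mono[of L "known C" \<rho> L "known A"] by (simp add: state_def)
qed

text \<open>The newly known variable gets its value from \<open>sat_on_extend\<close>, at the price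
  of passing from \<open>L\<close> to \<open>L'\<close>. Its group is still incomplete in
  \<open>A\<close>, since otherwise \<open>m - 1\<close> of its bits would already be in
  \<open>C\<close>; so no bits bind the new value.\<close>

lemma state_new:
  assumes c: "child C A x" and s: "state L C \<rho>" and x: "x \<in> grp a" "a \<notin> known C" "a \<in> known A"
    and b: "finite (known A)" "card (known A) \<le> W" and L': "L' \<subseteq> L"
    and cl: "\<And>A a B b. (A, a) \<in> L' \<Longrightarrow> (B, b) \<in> L' \<Longrightarrow> card (A \<union> B) \<le> W \<Longrightarrow> ((A - B) \<union> (B - A), a + b) \<in> L"
  shows "\<exists>\<rho>'. state L' A \<rho>'"
proof -
  let ?X = "known A - {a}"
  have ins: "insert a ?X = known A" using x by blast
  have "?X \<subseteq> known C"
  proof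
    fix a' assume a': "a' \<in> ?X"
    hence "x \<notin> grp a'" using disj[of a a'] x by blast
    thus "a' \<in> known C" using known_child[OF c] a' by blast
  qed
  hence "sat_on L ?X \<rho>" using s sat_on_mono[of L "known C" \<rho> L ?X] by (simp add: state_def)
  then obtain v where v: "sat_on L' (known A) (\<rho>(a := v))"
  proof -
    have "\<exists>v. sat_on L' (insert a ?X) (\<rho>(a := v))"
      by (rule sat_on_extend[OF _ _ _ _ L' cl]) (use b ins \<open>sat_on L ?X \<rho>\<close> in simp_all)
    thus thesis using that ins by auto
  qed
  have nf: "\<not> grp a \<subseteq> vars_clause A"
  proof
    assume "grp a \<subseteq> vars_clause A"
    hence "grp a - {x} \<subseteq> vars_clause C \<inter> grp a" using c by (auto simp: child_def)
    hence "card (grp a - {x}) \<le> card (vars_clause C \<inter> grp a)" using grp by (intro card_mono) auto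
    thus False using x grp(1,2)[of a] by (simp add: known_def)
  qed
  have "(\<rho>(a := v)) a' = (\<Sum>v\<in>grp a'. forced_bit A v)" if f: "grp a' \<subseteq> vars_clause A" for a'
  proof -
    have ne: "a' \<noteq> a" using f nf by blast
    hence "x \<notin> grp a'" using disj[of a a'] x by blast
    thus ?thesis using full_child[OF c f] s ne by (simp add: state_def)
  qed
  thus ?thesis using v by (auto simp: state_def)
qed

lemma state_mono: "state L C \<rho> \<Longrightarrow> L' \<subseteq> L \<Longrightarrow> state L' C \<rho>"
  using sat_on_mono[of L "known C" \<rho> L' "known C"] by (simp add: state_def)

text \<open>All groups of \<open>S\<close> are complete in such a clause, so \<rho> copies their
  parities. These sum to a value other than \<open>b\<close>, while \<open>sat_on\<close> asks for
  \<open>b\<close>.\<close>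

lemma state_axiom:
  assumes s: "state L C \<rho>" and C: "C \<in> xlift grp S b" and S: "finite S" "(S, b) \<in> L"
  shows False
proof -
  let ?U = "\<Union>a\<in>S. grp a"
  obtain \<alpha> where \<alpha>: "C = fclause ?U \<alpha>" "parity \<alpha> ?U \<noteq> b" using C by (auto simp: xlift_def)
  have full: "grp a \<subseteq> vars_clause C" if "a \<in> S" for a using that \<alpha>(1) by auto
  have "S \<subseteq> known C" using full full_known by blast
  hence "(\<Sum>a\<in>S. \<rho> a) = b" using s S(2) unfolding state_def sat_on_def by blast
  moreover have "(\<Sum>a\<in>S. \<rho> a) = (\<Sum>a\<in>S. \<Sum>v\<in>grp a. forced_bit C v)"
    by (rule sum.cong[OF refl]) (use s full in \<open>simp add: state_def\<close>)
  also have "\<dots> = (\<Sum>v\<in>?U. forced_bit C v)"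
    by (rule sum.UNION_disjoint[symmetric]) (use S grp disj in auto)
  also have "\<dots> = parity \<alpha> ?U" unfolding parity_def
    by (rule sum.cong[OF refl]) (auto simp: forced_bit_def \<alpha>(1) Neg_fclause)
  ultimately show False using \<alpha>(2) by simp
qed

lemma resolvent_children:
  assumes r: "resolvent A B C" and cl: "is_clause C"
  shows "\<exists>x. child C A x \<and> child C B x \<and> forced_bit A x = 0 \<and> forced_bit B x = 1"
proof -
  obtain x C1 D1 where x: "x \<notin> vars_clause C1" "x \<notin> vars_clause D1"
    "A = insert (Pos x) C1" "B = insert (Neg x) D1" "C = C1 \<union> D1"
    using r by (auto simp: resolvent_def)
  have sg: "(Neg v \<in> A') = (Neg v \<in> C)" if "A' \<subseteq> C" "v \<in> vars_clause A'" for A' v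
  proof -
    have "is_clause A'" using that(1) cl by (auto simp: is_clause_def intro: finite_subset inj_on_subset)
    moreover have "v \<in> vars_clause C" using that by (auto simp: vars_clause_def)
    ultimately show ?thesis using clause_sign[of A' v] clause_sign[of C v] cl that by blast
  qed
  have "Neg x \<notin> C1" using x(1) by (force simp: vars_clause_def)
  hence "forced_bit A x = 0" "forced_bit B x = 1" using x by (auto simp: forced_bit_def)
  moreover have "child C A x" "child C B x"
    using x cl sg[of C1] sg[of D1] by (auto simp: child_def)
  ultimately show ?thesis by blast
qed

text \<open>A query to a known variable is answered by \<rho> and leads to one premise at the same
  level. Any other query leaves both premises with a state one level further, and their subtrees are
  disjoint, so the count doubles. No state exists at an axiom, so this goes on through all
  \<open>n\<close> levels.\<close>

theorem treelike_size:
  fixes L :: "nat \<Rightarrow> ('a set \<times> bit) set"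
  assumes F: "F = (\<Union>(S, b)\<in>Eqs. xlift grp S b)" and fin: "\<And>S b. (S, b) \<in> Eqs \<Longrightarrow> finite S"
    and L: "Eqs \<subseteq> L n" "\<And>d. L (Suc d) \<subseteq> L d" "\<And>b. ({}, b) \<in> L 0 \<Longrightarrow> b = 0"
    and cl: "\<And>d A a B b. d < n \<Longrightarrow> (A, a) \<in> L (Suc d) \<Longrightarrow> (B, b) \<in> L (Suc d) \<Longrightarrow> card (A \<union> B) \<le> W
       \<Longrightarrow> ((A - B) \<union> (B - A), a + b) \<in> L d"
    and ref: "is_refutation F \<pi>" and tl: "treelike \<pi>"
    and w: "\<And>i. i < length \<pi> \<Longrightarrow> card (fst (\<pi> ! i)) < (m - 1) * (W + 1)"
  shows "2 ^ n \<le> length \<pi>"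
proof -
  have Ln: "L n \<subseteq> L d" if "d \<le> n" for d
    using that by (induction rule: inc_induct) (use L(2) in blast)+
  have line: "is_clause (fst (\<pi> ! i))" if "i < length \<pi>" for i using ref that by (simp add: is_refutation_def)
  have kb: "finite (known (fst (\<pi> ! i))) \<and> card (known (fst (\<pi> ! i))) \<le> W" if "i < length \<pi>" for i
    by (rule known_bound[OF line[OF that] w[OF that]])
  have finb: "finite (below \<pi> i)" for i by (simp add: below_def)
  have main: "2 ^ (n - d) \<le> card (below \<pi> i)" if "i < length \<pi>" "d \<le> n" "state (L d) (fst (\<pi> ! i)) \<rho>" for i d \<rho>
    using that
  proof (induction i arbitrary: d \<rho> rule: less_induct)
    case (less i)
    let ?C = "fst (\<pi> ! i)"
    have one: "1 \<le> card (below \<pi> i)" using below_self[OF less.prems(1)] finb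
      by (metis One_nat_def Suc_leI card_gt_0_iff empty_iff)
    show ?case
    proof (cases "snd (\<pi> ! i)")
      case Ax
      hence "?C \<in> F" using ref less.prems(1) by (force simp: is_refutation_def)
      then obtain S b where "(S, b) \<in> Eqs" "?C \<in> xlift grp S b" using F by auto
      thus ?thesis using state_axiom[OF less.prems(3)] fin L(1) Ln[OF less.prems(2)] by blast
    next
      case (Res a b)
      have ab: "a < i" "b < i" "resolvent (fst (\<pi> ! a)) (fst (\<pi> ! b)) ?C"
        using ref less.prems(1) Res by (auto simp: is_refutation_def split: justification.splits)
      let ?A = "fst (\<pi> ! a)" and ?B = "fst (\<pi> ! b)"
      obtain x where x: "child ?C ?A x" "child ?C ?B x" "forced_bit ?A x = 0" "forced_bit ?B x = 1"
        using resolvent_children[OF ab(3) line[OF less.prems(1)]] by blast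
      have ne: "a \<noteq> b" using x(3,4) by auto
      have len: "a < length \<pi>" "b < length \<pi>" using ab less.prems(1) by auto
      show ?thesis
      proof (cases "\<exists>g. x \<in> grp g \<and> g \<in> known ?C")
        case True
        then obtain g where g: "x \<in> grp g" "g \<in> known ?C" by blast
        have uniq: "g' = g" if "x \<in> grp g'" for g' using disj[of g g'] g that by blast
        \<comment> \<open>The other bits of the group, read off \<open>C\<close>. The bit of
          \<open>x\<close> is 0 at premise \<open>a\<close> and 1 at premise \<open>b\<close>, so
          exactly one of them makes the total equal to \<rho> at \<open>g\<close>.\<close>
        let ?t = "\<Sum>v\<in>grp g - {x}. forced_bit ?C v"
        have tot: "(\<Sum>v\<in>grp g. forced_bit Z v) = forced_bit Z x + ?t" if "child ?C Z x" "grp g \<subseteq> vars_clause Z" for Z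
        proof -
          have "(\<Sum>v\<in>grp g. forced_bit Z v) = forced_bit Z x + (\<Sum>v\<in>grp g - {x}. forced_bit Z v)" using sum.remove[OF grp(1) g(1)] by simp
          moreover have "(\<Sum>v\<in>grp g - {x}. forced_bit Z v) = ?t"
            by (rule sum.cong[OF refl]) (use that in \<open>auto simp: child_def forced_bit_def\<close>)
          ultimately show ?thesis by simp
        qed
        have "\<exists>z\<in>{a, b}. state (L d) (fst (\<pi> ! z)) \<rho>"
        proof (cases "\<rho> g = ?t")
          case True
          have "state (L d) ?A \<rho>" by (rule state_keep[OF x(1) less.prems(3)]) (use uniq g True tot[OF x(1)] x(3) in auto)
          thus ?thesis by simp
        next
          case False
          hence "\<rho> g = 1 + ?t" by (cases "\<rho> g"; cases ?t) auto
          hence "state (L d) ?B \<rho>"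
            by (intro state_keep[OF x(2) less.prems(3)]) (use uniq g tot[OF x(2)] x(4) in auto)
          thus ?thesis by simp
        qed
        then obtain z where z: "z \<in> {a, b}" "state (L d) (fst (\<pi> ! z)) \<rho>" by blast
        have "2 ^ (n - d) \<le> card (below \<pi> z)" using less.IH[of z d \<rho>] z ab len less.prems(2) by auto
        also have "\<dots> \<le> card (below \<pi> i)" using below_step[OF less.prems(1) Res] z by (intro card_mono[OF finb]) auto
        finally show ?thesis .
      next
        case False
        show ?thesis
        proof (cases "d = n")
          case True thus ?thesis using one by simp
        next
          case dn: False
          have dl: "d < n" "Suc d \<le> n" using dn less.prems(2) by auto
          have ch: "2 ^ (n - Suc d) \<le> card (below \<pi> z)" if z: "child ?C (fst (\<pi> ! z)) x" "z < i" for z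
          proof -
            have zl: "z < length \<pi>" using z less.prems(1) by simp
            have "\<exists>\<rho>'. state (L (Suc d)) (fst (\<pi> ! z)) \<rho>'"
            proof (cases "\<exists>g. x \<in> grp g \<and> g \<in> known (fst (\<pi> ! z))")
              case True
              then obtain g where g: "x \<in> grp g" "g \<in> known (fst (\<pi> ! z))" by blast
              show ?thesis
                by (rule state_new[OF z(1) less.prems(3) g(1) _ g(2) _ _ L(2) cl[OF dl(1)]]) (use False g kb[OF zl] in auto)
            next
              case F2: False
              have "state (L d) (fst (\<pi> ! z)) \<rho>" by (rule state_keep[OF z(1) less.prems(3)]) (use F2 in auto)
              thus ?thesis using state_mono L(2) by blast
            qed
            thus ?thesis using less.IH[OF z(2) zl dl(2)] by blast
          qed
          have "(2::nat) ^ (n - d) = 2 ^ (n - Suc d) + 2 ^ (n - Suc d)"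
            using dl by (simp add: Suc_diff_Suc[symmetric] mult_2[symmetric])
          also have "\<dots> \<le> card (below \<pi> a) + card (below \<pi> b)" using ch[OF x(1) ab(1)] ch[OF x(2) ab(2)] by simp
          also have "\<dots> \<le> card (below \<pi> i)" by (rule below_card_add[OF tl less.prems(1) Res ne])
          finally show ?thesis .
        qed
      qed
    qed
  qed
  let ?l = "length \<pi> - 1"
  have ne: "\<pi> \<noteq> []" "fst (last \<pi>) = {}" using ref by (auto simp: is_refutation_def)
  have l: "?l < length \<pi>" "fst (\<pi> ! ?l) = {}" using ne by (auto simp: last_conv_nth)
  have e: "known {} = {}" "\<not> grp a \<subseteq> vars_clause {}" for a
  proof -
    show "known {} = {}" using m by (auto simp: known_def vars_clause_def)
    have "grp a \<noteq> {}" using grp(2)[of a] m by auto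
    thus "\<not> grp a \<subseteq> vars_clause {}" by (auto simp: vars_clause_def)
  qed
  have "state (L 0) {} (\<lambda>_. 0)" unfolding state_def sat_on_def e(1) using L(3) e(2) by auto
  hence "2 ^ n \<le> card (below \<pi> ?l)" using main[of ?l 0 "\<lambda>_. 0"] l by simp
  also have "\<dots> \<le> card {..<length \<pi>}" by (rule card_mono) (auto simp: below_def)
  finally show ?thesis by simp
qed

end

section \<open>Bounded-width derivations as a query game\<close>

text \<open>Width does not depend on the layout of a derivation, so positions and justifications
  enter only in \<open>derivable_derivation\<close>.\<close>

inductive derivable :: "'v formula \<Rightarrow> nat \<Rightarrow> 'v clause \<Rightarrow> bool" for F w where
  derivable_ax: "C \<in> F \<Longrightarrow> is_clause C \<Longrightarrow> card C \<le> w \<Longrightarrow> derivable F w C"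
| derivable_res: "derivable F w A \<Longrightarrow> derivable F w B \<Longrightarrow> resolvent A B C \<Longrightarrow> is_clause C \<Longrightarrow> card C \<le> w \<Longrightarrow> derivable F w C"

lemma derivable_sound: "derivable F w C \<Longrightarrow> satisfies \<alpha> F \<Longrightarrow> \<exists>l\<in>C. lit_true \<alpha> l"
proof (induction rule: derivable.induct)
  case (derivable_ax C) thus ?case by (auto simp: satisfies_def)
next
  case (derivable_res A B C)
  obtain x C1 D1 where "A = insert (Pos x) C1" "B = insert (Neg x) D1" "C = C1 \<union> D1"
    using derivable_res.hyps(3) by (auto simp: resolvent_def)
  thus ?case using derivable_res.IH derivable_res.prems by (cases "\<alpha> x") auto
qed

lemma derivable_unsat: "derivable F w {} \<Longrightarrow> unsatisfiable F"
  using derivable_sound by (auto simp: unsatisfiable_def)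

fun shift_just :: "nat \<Rightarrow> justification \<Rightarrow> justification" where
  "shift_just n Ax = Ax" | "shift_just n (Res a b) = Res (a + n) (b + n)"

definition valid_lines :: "'v formula \<Rightarrow> 'v derivation \<Rightarrow> bool" where
  "valid_lines F \<pi> \<longleftrightarrow> (\<forall>i < length \<pi>. is_clause (fst (\<pi> ! i)) \<and>
        (case snd (\<pi> ! i) of
           Ax \<Rightarrow> fst (\<pi> ! i) \<in> F
         | Res a b \<Rightarrow> a < i \<and> b < i \<and>
             resolvent (fst (\<pi> ! a)) (fst (\<pi> ! b)) (fst (\<pi> ! i))))"

lemma valid_append:
  assumes "valid_lines F p" "valid_lines F r"
  shows "valid_lines F (p @ map (map_prod id (shift_just (length p))) r)"
proof -
  let ?s = "map (map_prod id (shift_just (length p))) r"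
  have nth: "i - length p < length r" "(p @ ?s) ! i = map_prod id (shift_just (length p)) (r ! (i - length p))"
    if "i < length p + length r" "\<not> i < length p" for i
    using that by (auto simp: nth_append)
  have lft: "(p @ ?s) ! i = p ! i" if "i < length p" for i using that by (simp add: nth_append)
  have rgt: "(p @ ?s) ! (a + length p) = map_prod id (shift_just (length p)) (r ! a)" if "a < length r" for a
    using that by (simp add: nth_append)
  show ?thesis unfolding valid_lines_def
  proof (intro allI impI)
    fix i assume i: "i < length (p @ ?s)"
    let ?P = "\<lambda>\<pi> i. is_clause (fst (\<pi> ! i)) \<and>
        (case snd (\<pi> ! i) of Ax \<Rightarrow> fst (\<pi> ! i) \<in> F
         | Res a b \<Rightarrow> a < i \<and> b < i \<and> resolvent (fst (\<pi> ! a)) (fst (\<pi> ! b)) (fst (\<pi> ! i)))"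
    show "?P (p @ ?s) i"
    proof (cases "i < length p")
      case True
      hence "?P p i" using assms(1) by (simp add: valid_lines_def)
      thus ?thesis using True lft by (auto split: justification.splits)
    next
      case False
      define j where "j = i - length p"
      have j: "j < length r" "i = j + length p" using i False by (auto simp: j_def)
      have "?P r j" using assms(2) j by (simp add: valid_lines_def)
      thus ?thesis using rgt j(1) unfolding j(2) by (cases "snd (r ! j)") auto
    qed
  qed
qed

lemma valid_snoc:
  assumes s: "valid_lines F s" and ab: "a < length s" "b < length s"
    and r: "resolvent (fst (s ! a)) (fst (s ! b)) C" "is_clause C"
  shows "valid_lines F (s @ [(C, Res a b)])"
  unfolding valid_lines_def
proof (intro allI impI)
  fix i assume i: "i < length (s @ [(C, Res a b)])"
  let ?P = "\<lambda>\<pi> i. is_clause (fst (\<pi> ! i)) \<and>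
      (case snd (\<pi> ! i) of Ax \<Rightarrow> fst (\<pi> ! i) \<in> F
       | Res a b \<Rightarrow> a < i \<and> b < i \<and> resolvent (fst (\<pi> ! a)) (fst (\<pi> ! b)) (fst (\<pi> ! i)))"
  have nth: "(s @ [(C, Res a b)]) ! i = s ! i" if "i < length s" for i using that by (simp add: nth_append)
  show "?P (s @ [(C, Res a b)]) i"
  proof (cases "i < length s")
    case True
    hence "?P s i" using s by (simp add: valid_lines_def)
    thus ?thesis using True nth by (cases "snd (s ! i)") auto
  next
    case False
    hence "i = length s" using i by simp
    thus ?thesis using nth[OF ab(1)] nth[OF ab(2)] ab r by simp
  qed
qed

lemma derivable_derivation:
  "derivable F w C \<Longrightarrow> \<exists>\<pi>. \<pi> \<noteq> [] \<and> fst (last \<pi>) = C \<and> valid_lines F \<pi> \<and> (\<forall>l\<in>set \<pi>. card (fst l) \<le> w)"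
proof (induction rule: derivable.induct)
  case (derivable_ax C)
  thus ?case by (intro exI[of _ "[(C, Ax)]"]) (simp add: valid_lines_def)
next
  case (derivable_res A B C)
  then obtain p r where p: "p \<noteq> []" "fst (last p) = A" "valid_lines F p" "\<forall>l\<in>set p. card (fst l) \<le> w"
    and r: "r \<noteq> []" "fst (last r) = B" "valid_lines F r" "\<forall>l\<in>set r. card (fst l) \<le> w" by blast
  let ?s = "p @ map (map_prod id (shift_just (length p))) r"
  let ?a = "length p - 1" and ?b = "length p + length r - 1"
  have vs: "valid_lines F ?s" by (rule valid_append[OF p(3) r(3)])
  have a: "?s ! ?a = last p" using p(1) by (simp add: nth_append last_conv_nth)
  have "?s ! (length p + (length r - 1)) = map_prod id (shift_just (length p)) (r ! (length r - 1))"
    using r(1) by (simp add: nth_append)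
  hence b: "fst (?s ! ?b) = B" using r(1,2) by (simp add: last_conv_nth Suc_le_eq)
  have pos: "0 < length p" "0 < length r" using p(1) r(1) by auto
  have "length ?s = length p + length r" by simp
  hence len: "?a < length ?s" "?b < length ?s" using pos by linarith+
  have "valid_lines F (?s @ [(C, Res ?a ?b)])"
    by (rule valid_snoc[OF vs len _ derivable_res.hyps(4)]) (use a b p(2) derivable_res.hyps(3) in simp)
  thus ?case using p(4) r(4) derivable_res.hyps(5) by (intro exI[of _ "?s @ [(C, Res ?a ?b)]"]) auto
qed

theorem derivable_refutation: assumes "derivable F w {}" shows "\<exists>\<pi>. is_refutation F \<pi> \<and> width \<pi> \<le> w"
proof -
  obtain \<pi> where p: "\<pi> \<noteq> []" "fst (last \<pi>) = {}" "valid_lines F \<pi>" "\<forall>l\<in>set \<pi>. card (fst l) \<le> w"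
    using derivable_derivation[OF assms] by blast
  have "is_refutation F \<pi>" using p by (simp add: is_refutation_def valid_lines_def)
  moreover have "width \<pi> \<le> w" using p by (simp add: width_def)
  ultimately show ?thesis by blast
qed

text \<open>Remembering \<alpha> on \<open>A\<close> is enough to falsify a clause derivable in
  width \<open>w\<close>. For \<open>A = {}\<close> this clause is the empty one.\<close>

definition loses :: "'v formula \<Rightarrow> nat \<Rightarrow> 'v set \<Rightarrow> ('v \<Rightarrow> bool) \<Rightarrow> bool" where
  "loses F w A \<alpha> \<longleftrightarrow> (\<exists>C. derivable F w C \<and> C \<subseteq> fclause A \<alpha>)"

lemma fclause_mono: "A \<subseteq> B \<Longrightarrow> fclause A \<alpha> \<subseteq> fclause B \<alpha>"
  by (auto simp: fclause_def)

lemma fclause_cong: "(\<And>v. v \<in> A \<Longrightarrow> \<alpha> v = \<beta> v) \<Longrightarrow> fclause A \<alpha> = fclause A \<beta>"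
  by (auto simp: fclause_def image_iff)

lemma loses_mono: "loses F w A \<alpha> \<Longrightarrow> A \<subseteq> B \<Longrightarrow> loses F w B \<alpha>"
  unfolding loses_def using fclause_mono by blast

lemma is_clause_fclause: "finite A \<Longrightarrow> is_clause (fclause A \<alpha>)"
proof -
  assume "finite A"
  moreover have "inj_on var_of (fclause A \<alpha>)"
    by (rule inj_onI) (auto simp: fclause_def split: if_splits)
  ultimately show ?thesis by (simp add: is_clause_def fclause_def)
qed

lemma card_fclause: "finite A \<Longrightarrow> card (fclause A \<alpha>) = card A"
  using card_vars[OF is_clause_fclause, of A \<alpha>] by simp

text \<open>If both answers lose to clauses that mention \<open>x\<close>, their resolvent is over
  \<open>A\<close>; otherwise one of the two clauses already is.\<close>

lemma loses_query:
  assumes A: "finite A" "x \<notin> A" "card A \<le> w"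
    and l: "loses F w (insert x A) (\<alpha>(x := False))" "loses F w (insert x A) (\<alpha>(x := True))"
  shows "loses F w A \<alpha>"
proof -
  have f: "fclause (insert x A) (\<alpha>(x := False)) = insert (Pos x) (fclause A \<alpha>)"
    "fclause (insert x A) (\<alpha>(x := True)) = insert (Neg x) (fclause A \<alpha>)"
    using A(2) fclause_cong[of A "\<alpha>(x := b)" \<alpha> for b] by (auto simp: fclause_def)
  obtain C0 C1 where C0: "derivable F w C0" "C0 \<subseteq> insert (Pos x) (fclause A \<alpha>)"
    and C1: "derivable F w C1" "C1 \<subseteq> insert (Neg x) (fclause A \<alpha>)" using l f by (auto simp: loses_def)
  show ?thesis
  proof (cases "Pos x \<in> C0 \<and> Neg x \<in> C1")
    case False thus ?thesis using C0 C1 unfolding loses_def by blast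
  next
    case True
    let ?C = "C0 - {Pos x}" and ?D = "C1 - {Neg x}"
    have sub: "?C \<subseteq> fclause A \<alpha>" "?D \<subseteq> fclause A \<alpha>" using C0 C1 by auto
    have x: "x \<notin> vars_clause ?C" "x \<notin> vars_clause ?D"
      using sub A(2) vars_fclause[of A \<alpha>] unfolding vars_clause_def by blast+
    have fin: "finite (fclause A \<alpha>)" using A(1) by (simp add: fclause_def)
    have cl: "is_clause (?C \<union> ?D)"
      using is_clause_fclause[OF A(1), of \<alpha>] sub unfolding is_clause_def
      by (meson Un_least finite_subset inj_on_subset)
    have "card (?C \<union> ?D) \<le> w" using card_mono[OF fin, of "?C \<union> ?D"] sub card_fclause[OF A(1), of \<alpha>] A(3) by simp
    moreover have "resolvent C0 C1 (?C \<union> ?D)"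
      unfolding resolvent_def using x True by (intro exI[of _ x] exI[of _ ?C] exI[of _ ?D]) auto
    ultimately have "derivable F w (?C \<union> ?D)" using derivable_res[OF C0(1) C1(1) _ cl] by blast
    thus ?thesis unfolding loses_def using sub by blast
  qed
qed

lemma loses_query_set:
  assumes "finite G" "finite A" "card (A \<union> G) \<le> w" "\<And>\<beta>. (\<And>v. v \<in> A \<Longrightarrow> \<beta> v = \<alpha> v) \<Longrightarrow> loses F w (A \<union> G) \<beta>"
  shows "loses F w A \<alpha>"
  using assms
proof (induction G arbitrary: A \<alpha> rule: finite_induct)
  case empty thus ?case by simp
next
  case (insert x G)
  show ?case
  proof (cases "x \<in> A")
    case True
    hence e: "A \<union> insert x G = A \<union> G" by auto
    show ?thesis by (rule insert.IH) (use insert.prems e in auto)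
  next
    case False
    have e: "insert x A \<union> G = A \<union> insert x G" by auto
    have c: "card A \<le> w" using card_mono[of "A \<union> insert x G" A] insert.prems(1,2) insert.hyps(1) by force
    have "loses F w (insert x A) (\<alpha>(x := b))" for b
    proof (rule insert.IH)
      fix \<beta> assume b: "\<And>v. v \<in> insert x A \<Longrightarrow> \<beta> v = (\<alpha>(x := b)) v"
      have "\<beta> v = \<alpha> v" if "v \<in> A" for v using b[of v] that False by auto
      thus "loses F w (insert x A \<union> G) \<beta>" unfolding e by (rule insert.prems(3))
    qed (use insert.prems e in auto)
    thus ?thesis using loses_query[OF insert.prems(1) False c] by blast
  qed
qed

definition bits :: "('a \<Rightarrow> 'v set) \<Rightarrow> 'a set \<Rightarrow> 'v set" where "bits grp S = (\<Union>a\<in>S. grp a)"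

text \<open>All bits of \<open>S\<close> are queried while those of \<open>X\<close> are remembered.
  Either a clause of the constraint on \<open>S\<close> is falsified, or the parity on
  \<open>Z\<close> is determined; then everything outside \<open>Z\<close> is forgotten.\<close>

lemma loses_step:
  assumes grp: "\<And>a. finite (grp a)" "\<And>a. card (grp a) = m" "\<And>a b. a \<noteq> b \<Longrightarrow> grp a \<inter> grp b = {}"
    and S: "xlift grp S b \<subseteq> F" "finite S" and X: "finite X" "card (X \<union> S) * m \<le> w"
    and Z: "Z = (X - S) \<union> (S - X)" and next_: "\<And>\<beta>. parity \<beta> (bits grp Z) = p + b \<Longrightarrow> loses F w (bits grp Z) \<beta>"
    and p: "parity \<alpha> (bits grp X) = p"
  shows "loses F w (bits grp X) \<alpha>"
proof (rule loses_query_set)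
  have fb: "finite (bits grp S)" if "finite S" for S using that grp(1) by (simp add: bits_def)
  show "finite (bits grp S)" "finite (bits grp X)" using fb S X by auto
  have U: "bits grp X \<union> bits grp S = bits grp (X \<union> S)" by (auto simp: bits_def)
  have "card (bits grp (X \<union> S)) \<le> (\<Sum>a\<in>X \<union> S. card (grp a))"
    unfolding bits_def using S X by (intro card_UN_le) auto
  also have "\<dots> \<le> w" using X(2) grp(2) by simp
  finally show "card (bits grp X \<union> bits grp S) \<le> w" unfolding U .
  fix \<beta> assume \<beta>: "\<And>v. v \<in> bits grp X \<Longrightarrow> \<beta> v = \<alpha> v"
  show "loses F w (bits grp X \<union> bits grp S) \<beta>"
  proof (cases "parity \<beta> (bits grp S) = b")
    case False
    have "fclause (bits grp S) \<beta> \<in> F" using False S(1) by (auto simp: xlift_def bits_def)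
    moreover have "card (bits grp S) \<le> w"
      using card_mono[OF _, of "bits grp X \<union> bits grp S" "bits grp S"] fb S X \<open>card (bits grp X \<union> bits grp S) \<le> w\<close> by auto
    ultimately have "derivable F w (fclause (bits grp S) \<beta>)"
      using derivable_ax[of _ F w] is_clause_fclause card_fclause fb S(2) by metis
    thus ?thesis unfolding loses_def using fclause_mono[of "bits grp S" "bits grp X \<union> bits grp S" \<beta>] by blast
  next
    case True
    have d: "bits grp Z = (bits grp X - bits grp S) \<union> (bits grp S - bits grp X)"
    proof (rule set_eqI)
      fix v
      have *: "v \<in> bits grp Y \<longleftrightarrow> a \<in> Y" if "v \<in> grp a" for a Y
      proof -
        have "a' = a" if "v \<in> grp a'" for a' using grp(3)[of a a'] that \<open>v \<in> grp a\<close> by blast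
        thus ?thesis using that unfolding bits_def by blast
      qed
      show "v \<in> bits grp Z \<longleftrightarrow> v \<in> (bits grp X - bits grp S) \<union> (bits grp S - bits grp X)"
      proof (cases "\<exists>a. v \<in> grp a")
        case True
        then obtain a where "v \<in> grp a" by blast
        from *[OF this] show ?thesis unfolding Z by simp
      next
        case False thus ?thesis by (simp add: bits_def)
      qed
    qed
    have "parity \<beta> (bits grp X) = p" unfolding p[symmetric] parity_def by (rule sum.cong) (use \<beta> in auto)
    hence "parity \<beta> (bits grp Z) = p + b"
      unfolding d using True sum_symdiff[OF fb[OF X(1)] fb[OF S(2)], of "\<lambda>v. if \<beta> v then 1 else 0"] by (simp add: parity_def)
    hence "loses F w (bits grp Z) \<beta>" by (rule next_)
    thus ?thesis by (rule loses_mono) (auto simp: d)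
  qed
qed

section \<open>The compressed helix\<close>

lemma sum_filter_image:
  assumes "finite E" "finite A" "v ` E \<subseteq> A"
  shows "(\<Sum>e\<in>E. f e) = (\<Sum>a\<in>A. \<Sum>e\<in>{e\<in>E. v e = a}. f e)"
  using assms by (simp add: sum.group)

lemma zdiv_less_iff: "0 < k \<Longrightarrow> (t::int) div k < n \<longleftrightarrow> t < n * k"
proof
  assume k: "0 < k" and "t div k < n"
  hence "(t div k + 1) * k \<le> n * k" by (intro mult_right_mono) auto
  moreover have "t < (t div k + 1) * k"
    using k by (metis add.commute div_mult_mod_eq distrib_right mult_1 add_less_cancel_left pos_mod_bound)
  ultimately show "t < n * k" by simp
next
  assume k: "0 < k" and t: "t < n * k"
  show "t div k < n"
  proof (rule ccontr)
    assume "\<not> t div k < n"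
    hence "n * k \<le> t div k * k" using k by (intro mult_right_mono) auto
    also have "\<dots> \<le> t" using k by (metis div_mult_mod_eq le_add_same_cancel1 pos_mod_sign)
    finally show False using t by simp
  qed
qed

text \<open>Node \<open>t\<close> of the helix lies in row \<open>t mod K\<close> and column \<open>t div K\<close>. It is split into an in-site
  and an out-site, so that the graph is cubic: \<open>uvar t\<close> joins the two, \<open>hvar t\<close> leads to the in-site of
  \<open>t\<close> from the out-site of \<open>t - K\<close> and \<open>vvar t\<close> from that of \<open>t - 1\<close>. The columns \<open>0\<close> to \<open>Q * T - 1\<close>
  are compressed; the \<open>D\<close> columns added on each side keep their own variables. Vertical edges join two
  rows and so only respect the moduli common to both, hence \<open>S\<close>.\<close>

locale helix =
  fixes K e Q D T :: int and q :: "int \<Rightarrow> int"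
  assumes K: "2 \<le> K" and e: "1 \<le> e" "e < K" and Q: "2 \<le> Q" and D: "1 \<le> D" and T: "1 \<le> T"
    and q_ge: "\<And>j. 3 \<le> q j"
    and T_ge: "\<And>i. (\<Prod>j\<in>{j\<in>{0..<K}. (j - i) mod K < e}. q j) \<le> T"
begin

definition row_uses :: "int \<Rightarrow> int \<Rightarrow> bool" where "row_uses i j \<longleftrightarrow> (j - i) mod K < e"
definition R :: "int \<Rightarrow> int" where "R i = (\<Prod>j\<in>{j\<in>{0..<K}. row_uses i j}. q j)"
definition S :: "int \<Rightarrow> int" where "S i = (\<Prod>j\<in>{j\<in>{0..<K}. row_uses i j \<and> row_uses ((i - 1) mod K) j}. q j)"

text \<open>The normal form of a position under the identification. Only the number of its block of
  \<open>Q\<close> columns is reduced, modulo \<open>f\<close> of its row; row and column class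
  modulo \<open>Q\<close> survive.\<close>

definition rep :: "(int \<Rightarrow> int) \<Rightarrow> int \<Rightarrow> int" where
  "rep f t = (if 0 \<le> t \<and> t < Q * T * K then t mod (K * (Q * f (t mod K))) else t)"

definition lo :: int where "lo = - D * K"
definition hi :: int where "hi = (Q * T + D) * K"

definition hvar :: "int \<Rightarrow> nat \<times> int" where "hvar t = (0, rep R t)"
definition uvar :: "int \<Rightarrow> nat \<times> int" where "uvar t = (1, rep R t)"
definition vvar :: "int \<Rightarrow> nat \<times> int" where "vvar t = (2, rep S t)"

text \<open>Row \<open>i\<close> of the column with offset \<open>c\<close> in the block
  \<open>z\<close> of \<open>Q\<close> columns.\<close>

definition mid_site :: "int \<Rightarrow> int \<Rightarrow> int \<Rightarrow> int" where "mid_site z c i = (c + Q * z) * K + i"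

lemma R_pos: "1 \<le> R i" and S_pos: "1 \<le> S i"
proof -
  have "0 < R i" unfolding R_def by (rule prod_pos) (use q_ge in \<open>force intro: less_le_trans[of 0 3]\<close>)
  moreover have "0 < S i" unfolding S_def by (rule prod_pos) (use q_ge in \<open>force intro: less_le_trans[of 0 3]\<close>)
  ultimately show "1 \<le> R i" "1 \<le> S i" by simp_all
qed

lemma fin_j: "finite {j. 0 \<le> j \<and> j < K \<and> P j}" for P :: "int \<Rightarrow> bool"
  by (rule finite_subset[of _ "{0..<K}"]) auto

lemma R_le: "R i \<le> T"
  using T_ge[of i] by (simp add: R_def row_uses_def)

lemma q_dvd_R: "j \<in> {0..<K} \<Longrightarrow> row_uses i j \<Longrightarrow> q j dvd R i"
  unfolding R_def by (rule dvd_prodI) (auto intro: fin_j)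

lemma q_dvd_S: "j \<in> {0..<K} \<Longrightarrow> row_uses i j \<Longrightarrow> row_uses ((i - 1) mod K) j \<Longrightarrow> q j dvd S i"
  unfolding S_def by (rule dvd_prodI) (auto intro: fin_j)

lemma S_dvd_R: "S i dvd R i"
  unfolding S_def R_def by (rule prod_dvd_prod_subset) (auto intro: fin_j)

lemma S_dvd_R': "S i dvd R ((i - 1) mod K)"
  unfolding S_def R_def by (rule prod_dvd_prod_subset) (auto intro: fin_j)

lemma mid_site_mod: "0 \<le> i \<Longrightarrow> i < K \<Longrightarrow> mid_site z c i mod K = i"
  using K by (simp add: mid_site_def)

lemma mid_site_div: "0 \<le> i \<Longrightarrow> i < K \<Longrightarrow> mid_site z c i div K = c + Q * z"
  using K by (simp add: mid_site_def)

lemma mid_site_inj: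
  assumes "mid_site z c i = mid_site z' c' i'" "0 \<le> c" "c < Q" "0 \<le> c'" "c' < Q" "0 \<le> i" "i < K" "0 \<le> i'" "i' < K"
  shows "z = z' \<and> c = c' \<and> i = i'"
proof -
  have i: "i = i'" using mid_site_mod assms by metis
  have x: "c + Q * z = c' + Q * z'" using mid_site_div assms by metis
  have "c = c'" using arg_cong[OF x, of "\<lambda>x. x mod Q"] assms by simp
  with x Q i show ?thesis by simp
qed

lemma mid_site_ex: "\<exists>z c i. t = mid_site z c i \<and> 0 \<le> c \<and> c < Q \<and> 0 \<le> i \<and> i < K"
proof -
  have "t = mid_site (t div K div Q) (t div K mod Q) (t mod K)" by (simp add: mid_site_def)
  thus ?thesis using K Q by (metis pos_mod_bound pos_mod_sign zero_less_numeral order_less_le_trans)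
qed

lemma mid_site_mid_iff:
  assumes "0 \<le> c" "c < Q" "0 \<le> i" "i < K"
  shows "0 \<le> mid_site z c i \<and> mid_site z c i < Q * T * K \<longleftrightarrow> 0 \<le> z \<and> z < T"
proof -
  have a: "0 \<le> mid_site z c i \<longleftrightarrow> 0 \<le> mid_site z c i div K" using K by (simp add: pos_imp_zdiv_nonneg_iff)
  have b: "mid_site z c i < Q * T * K \<longleftrightarrow> mid_site z c i div K < Q * T"
    using K by (simp add: zdiv_less_iff)
  have a': "0 \<le> c + Q * z \<longleftrightarrow> 0 \<le> (c + Q * z) div Q" using Q pos_imp_zdiv_nonneg_iff[of Q "c + Q * z"] by linarith
  have b': "c + Q * z < Q * T \<longleftrightarrow> (c + Q * z) div Q < T"
    using Q zdiv_less_iff[of Q "c + Q * z" T] by (simp add: mult.commute)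
  have d: "(c + Q * z) div Q = z" using assms Q by simp
  show ?thesis using a b a' b' d mid_site_div[OF assms(3,4)] by metis
qed

lemma rep_pt:
  assumes "0 \<le> c" "c < Q" "0 \<le> i" "i < K" "0 \<le> z" "z < T" "1 \<le> f i"
  shows "rep f (mid_site z c i) = mid_site (z mod f i) c i"
proof -
  have mid: "0 \<le> mid_site z c i \<and> mid_site z c i < Q * T * K" using mid_site_mid_iff assms by simp
  have lt: "0 \<le> mid_site (z mod f i) c i" 
    using assms K Q by (simp add: mid_site_def)
  have "mid_site (z mod f i) c i < K * (Q * f i)"
  proof -
    have "c + Q * (z mod f i) < Q * f i"
    proof -
      have "z mod f i + 1 \<le> f i" using assms by (simp add: add1_zle_eq)
      hence "Q * (z mod f i + 1) \<le> Q * f i" using Q by (intro mult_left_mono) auto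
      thus ?thesis using assms by (simp add: algebra_simps)
    qed
    hence "(c + Q * (z mod f i) + 1) * K \<le> Q * f i * K" using K by (intro mult_right_mono) auto
    thus ?thesis using assms by (simp add: mid_site_def algebra_simps)
  qed
  moreover have "mid_site z c i = mid_site (z mod f i) c i + (z div f i) * (K * (Q * f i))"
  proof -
    have "z = z mod f i + z div f i * f i" by simp
    thus ?thesis unfolding mid_site_def by (metis (no_types, opaque_lifting) add.assoc add.commute distrib_left distrib_right mult.assoc mult.commute)
  qed
  ultimately have "mid_site z c i mod (K * (Q * f i)) = mid_site (z mod f i) c i"
    using lt by simp
  thus ?thesis using mid mid_site_mod assms by (simp add: rep_def)
qed

lemma rep_out: "\<not> (0 \<le> t \<and> t < Q * T * K) \<Longrightarrow> rep f t = t"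
  by (auto simp: rep_def)

lemma class_eq:
  assumes "0 \<le> c" "c < Q" "0 \<le> i" "i < K" "0 \<le> z" "z < f i" "1 \<le> f i" "f i \<le> T" "\<And>i. 1 \<le> f i"
    and A: "{0..<Q * T * K} \<subseteq> A"
  shows "{t\<in>A. rep f t = mid_site z c i} = (\<lambda>z. mid_site z c i) ` {w\<in>{0..<T}. w mod f i = z}"
proof (intro equalityI subsetI)
  fix t assume t: "t \<in> {t\<in>A. rep f t = mid_site z c i}"
  have m: "0 \<le> mid_site z c i \<and> mid_site z c i < Q * T * K" using mid_site_mid_iff assms by simp
  hence mid: "0 \<le> t \<and> t < Q * T * K" using t rep_out[of t f] by auto
  obtain z' c' i' where p: "t = mid_site z' c' i'" "0 \<le> c'" "c' < Q" "0 \<le> i'" "i' < K" using mid_site_ex by blast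
  have z': "0 \<le> z' \<and> z' < T" using mid mid_site_mid_iff p by blast
  have "rep f t = mid_site (z' mod f i') c' i'" using rep_pt p z' assms(9) by simp
  hence "z' mod f i' = z \<and> c' = c \<and> i' = i" using t mid_site_inj[of "z' mod f i'" c' i' z c i] p assms(1-4) by auto
  thus "t \<in> (\<lambda>z. mid_site z c i) ` {w\<in>{0..<T}. w mod f i = z}" using p z' by auto
next
  fix t assume "t \<in> (\<lambda>z. mid_site z c i) ` {w\<in>{0..<T}. w mod f i = z}"
  then obtain w where w: "t = mid_site w c i" "0 \<le> w" "w < T" "w mod f i = z" by auto
  have "t \<in> {0..<Q * T * K}" using mid_site_mid_iff[of c i w] assms w by auto
  thus "t \<in> {t\<in>A. rep f t = mid_site z c i}" using rep_pt[of c i w f] assms w A by auto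
qed

lemma rep_mod: "rep f t mod K = t mod K"
  by (simp add: rep_def mod_mod_cancel)

lemma rep_nonneg_iff: assumes "\<And>i. 1 \<le> f i" shows "0 \<le> rep f t \<longleftrightarrow> 0 \<le> t"
proof -
  have "0 < K * (Q * f (t mod K))" using K Q assms[of "t mod K"] by simp
  thus ?thesis by (auto simp: rep_def)
qed

lemma rep_less_iff: assumes "\<And>i. 1 \<le> f i" shows "rep f t < Q * T * K \<longleftrightarrow> t < Q * T * K"
proof -
  have p: "0 < K * (Q * f (t mod K))" using K Q assms[of "t mod K"] by simp
  have "t mod (K * (Q * f (t mod K))) \<le> t" if "0 \<le> t" using that p by (simp add: zmod_le_nonneg_dividend)
  thus ?thesis by (auto simp: rep_def)
qed

end

section \<open>Boundaries of site sets\<close>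

lemma telescope_bit:
  fixes g :: "int \<Rightarrow> bit"
  assumes "a \<le> b"
  shows "(\<Sum>x\<in>{a..<b}. g x + g (x + 1)) = g a + g b"
  using assms
proof (induction b rule: int_ge_induct)
  case base
  then show ?case by simp
next
  case (step b)
  have "{a..<b + 1} = insert b {a..<b}" using step by auto
  then show ?case using step by (simp add: ac_simps)
qed

context helix begin

text \<open>A combination of the constraints is given by its coefficients, \<open>y False t\<close> at the in-site and
  \<open>y True t\<close> at the out-site of \<open>t\<close>; its \<open>boundary\<close> is the set of variables left in the sum.\<close>

definition dH :: "(bool \<Rightarrow> int \<Rightarrow> bit) \<Rightarrow> int \<Rightarrow> bit" where "dH y t = y True (t - K) + y False t"
definition dU :: "(bool \<Rightarrow> int \<Rightarrow> bit) \<Rightarrow> int \<Rightarrow> bit" where "dU y t = y False t + y True t"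
definition dV :: "(bool \<Rightarrow> int \<Rightarrow> bit) \<Rightarrow> int \<Rightarrow> bit" where "dV y t = y True (t - 1) + y False t"

text \<open>Copies of an identified variable cancel in pairs, so its coefficient is the sum over all
  copies.\<close>

definition cfs :: "int set \<Rightarrow> (int \<Rightarrow> int) \<Rightarrow> (int \<Rightarrow> bit) \<Rightarrow> int \<Rightarrow> bit" where
  "cfs A f p r = (\<Sum>t\<in>{t\<in>A. rep f t = r}. p t)"

definition bcoeff :: "(bool \<Rightarrow> int \<Rightarrow> bit) \<Rightarrow> nat \<times> int \<Rightarrow> bit" where
  "bcoeff y a = (if fst a = 0 then cfs {lo + K..<hi} R (dH y) (snd a)
     else if fst a = 1 then cfs {lo..<hi} R (dU y) (snd a)
     else if fst a = 2 then cfs {lo + 1..<hi} S (dV y) (snd a) else 0)"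

definition boundary :: "(bool \<Rightarrow> int \<Rightarrow> bit) \<Rightarrow> (nat \<times> int) set" where "boundary y = {a. bcoeff y a = 1}"

text \<open>Column classes modulo \<open>Q\<close> are never identified with each other, so a small set \<open>X\<close> misses one of
  them, and the coefficients can be evaluated along that class.\<close>

definition free :: "int \<Rightarrow> (nat \<times> int) set \<Rightarrow> bool" where
  "free c X \<longleftrightarrow> (\<forall>a\<in>X. 0 \<le> snd a \<and> snd a < Q * T * K \<longrightarrow> snd a div K mod Q \<noteq> c)"

lemma lo_le: "lo + K \<le> 0" "lo + 1 \<le> 0" "lo \<le> 0" and hi_ge: "Q * T * K \<le> hi" "Q * T * K + K \<le> hi"
proof -
  have "K \<le> D * K" using mult_right_mono[OF D, of K] K by linarith
  moreover have "hi = Q * T * K + D * K" "lo = - (D * K)" by (simp_all add: lo_def hi_def algebra_simps)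
  ultimately show "lo + K \<le> 0" "lo + 1 \<le> 0" "lo \<le> 0" "Q * T * K \<le> hi" "Q * T * K + K \<le> hi"
    using K by linarith+
qed

lemma cfs_out:
  fixes f :: "int \<Rightarrow> int" assumes "\<not> (0 \<le> r \<and> r < Q * T * K)" "r \<in> A" "\<And>i. 1 \<le> f i"
  shows "cfs A f p r = p r"
proof -
  have "t = r" if "rep f t = r" for t
    using that assms(1) rep_out[of t f] rep_nonneg_iff[of f t] rep_less_iff[of f t] assms(3) by auto
  hence "{t\<in>A. rep f t = r} = {r}" using assms rep_out[of r f] by auto
  thus ?thesis by (simp add: cfs_def)
qed

lemma cfs_mid:
  assumes "0 \<le> c" "c < Q" "0 \<le> i" "i < K" "0 \<le> z" "z < f i" "f i \<le> T" "\<And>i. 1 \<le> f i"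
    and A: "{0..<Q * T * K} \<subseteq> A"
  shows "cfs A f p (mid_site z c i) = (\<Sum>w\<in>{w\<in>{0..<T}. w mod f i = z}. p (mid_site w c i))"
proof -
  have "inj_on (\<lambda>w. mid_site w c i) B" for B using Q K by (auto simp: inj_on_def mid_site_def)
  thus ?thesis unfolding cfs_def using class_eq[of c i z f A] assms by (simp add: sum.reindex)
qed

text \<open>A class modulo \<open>m\<close> is a union of classes modulo the multiple
  \<open>n\<close>. This leads from the full period of a row to a single \<open>q j\<close>.\<close>

lemma refine_sum:
  fixes p :: "int \<Rightarrow> bit"
  assumes "0 < n" "m dvd n"
  shows "(\<Sum>w\<in>{w\<in>{0..<T}. w mod m = h}. p w)
       = (\<Sum>z\<in>{0..<n}. if z mod m = h then \<Sum>w\<in>{w\<in>{0..<T}. w mod n = z}. p w else 0)"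
proof -
  have "(\<Sum>w\<in>{w\<in>{0..<T}. w mod m = h}. p w)
      = (\<Sum>z\<in>{0..<n}. \<Sum>w\<in>{w\<in>{w\<in>{0..<T}. w mod m = h}. w mod n = z}. p w)"
    by (rule sum_filter_image) (use assms in \<open>auto intro: finite_subset[of _ "{0..<T}"]\<close>)
  also have "\<dots> = (\<Sum>z\<in>{0..<n}. if z mod m = h then \<Sum>w\<in>{w\<in>{0..<T}. w mod n = z}. p w else 0)"
  proof (rule sum.cong[OF refl])
    fix z assume "z \<in> {0..<n}"
    have "w mod n = z \<Longrightarrow> w mod m = z mod m" for w using assms(2) by (metis mod_mod_cancel)
    hence "{w\<in>{w\<in>{0..<T}. w mod m = h}. w mod n = z} = (if z mod m = h then {w\<in>{0..<T}. w mod n = z} else {})"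
      by (auto simp del: mod_mod_trivial)
    thus "(\<Sum>w\<in>{w\<in>{w\<in>{0..<T}. w mod m = h}. w mod n = z}. p w) = (if z mod m = h then \<Sum>w\<in>{w\<in>{0..<T}. w mod n = z}. p w else 0)"
      by simp
  qed
  finally show ?thesis .
qed

lemma S_le: "S i \<le> T"
proof -
  have "S i \<le> R i" by (rule zdvd_imp_le[OF S_dvd_R]) (use R_pos[of i] in simp)
  thus ?thesis using R_le[of i] by simp
qed

lemma free_cf:
  assumes "boundary y \<subseteq> X" "free c X" "0 \<le> c" "c < Q" "0 \<le> i" "i < K" "0 \<le> z" "z < T"
  shows "bcoeff y (b, mid_site z c i) = 0"
proof -
  have "0 \<le> mid_site z c i \<and> mid_site z c i < Q * T * K" using mid_site_mid_iff[of c i z] assms by blast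
  moreover have "mid_site z c i div K mod Q = c" using mid_site_div[of i z c] assms by simp
  ultimately have "(b, mid_site z c i) \<notin> X" using assms(2) unfolding free_def by (metis snd_conv)
  thus ?thesis using assms(1) by (auto simp: boundary_def)
qed

text \<open>In a free column class every variable has coefficient 0, that is, \<open>p\<close> sums
  to 0 over each class modulo \<open>f i\<close>; \<open>refine_sum\<close> passes to coarser
  classes.\<close>

lemma class_sum:
  assumes b: "boundary y \<subseteq> X" "free c X" "0 \<le> c" "c < Q" "0 \<le> i" "i < K" and m: "m dvd f i" "0 < m"
    and f: "\<And>i. 1 \<le> f i" "\<And>i. f i \<le> T" and A: "{0..<Q * T * K} \<subseteq> A"
    and bcoeff: "\<And>r. bcoeff y (k, r) = cfs A f p r"
  shows "(\<Sum>w\<in>{w\<in>{0..<T}. w mod m = h}. p (mid_site w c i)) = 0"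
proof -
  have "0 < f i" using f(1)[of i] by simp
  have "(\<Sum>w\<in>{w\<in>{0..<T}. w mod f i = z}. p (mid_site w c i)) = 0" if "z \<in> {0..<f i}" for z
  proof -
    have z: "0 \<le> z" "z < f i" "z < T" using that f(2)[of i] by auto
    have "bcoeff y (k, mid_site z c i) = 0" by (rule free_cf[OF b]) fact+
    moreover have "cfs A f p (mid_site z c i) = (\<Sum>w\<in>{w\<in>{0..<T}. w mod f i = z}. p (mid_site w c i))"
      by (rule cfs_mid) (rule b f A | fact)+
    ultimately show ?thesis by (simp only: bcoeff)
  qed
  thus ?thesis by (subst refine_sum[OF \<open>0 < f i\<close> m(1)]) (auto intro!: sum.neutral)
qed

lemma mid_sub: "{0..<Q * T * K} \<subseteq> {lo + K..<hi}" "{0..<Q * T * K} \<subseteq> {lo..<hi}" "{0..<Q * T * K} \<subseteq> {lo + 1..<hi}"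
  using lo_le hi_ge by (intro subsetI; simp; linarith)+

text \<open>The quantity that rows using \<open>q j\<close> share: individual coefficients are
  invisible after identification, but these sums are not.\<close>

definition G :: "(bool \<Rightarrow> int \<Rightarrow> bit) \<Rightarrow> int \<Rightarrow> int \<Rightarrow> int \<Rightarrow> int \<Rightarrow> bit" where
  "G y c i j h = (\<Sum>w\<in>{w\<in>{0..<T}. w mod q j = h}. y False (mid_site w c i))"

lemma q_pos: "0 < q j" using q_ge[of j] by simp

text \<open>The vertical edges into row \<open>i\<close> equate its in-sites with the preceding
  out-sites, in sum. From there \<open>dU\<close> leads to the in-sites of row \<open>i - 1\<close>.
  All these edges have periods divisible by \<open>q j\<close>.\<close>

lemma G_adj:
  assumes b: "boundary y \<subseteq> X" "free c X" "0 \<le> c" "c < Q" "0 \<le> i" "i < K" "j \<in> {0..<K}"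
    and P: "row_uses i j" "row_uses ((i - 1) mod K) j"
  shows "G y c i j h = G y c ((i - 1) mod K) j h"
proof -
  let ?W = "{w\<in>{0..<T}. w mod q j = h}"
  let ?i = "(i - 1) mod K"
  have i': "0 \<le> ?i" "?i < K" using K by auto
  have v: "(\<Sum>w\<in>?W. dV y (mid_site w c i)) = 0"
    by (rule class_sum[where f = S and A = "{lo + 1..<hi}" and k = 2, OF b(1-6) q_dvd_S[OF b(7) P] q_pos S_pos S_le mid_sub(3)]) (simp add: bcoeff_def)
  hence a: "(\<Sum>w\<in>?W. y True (mid_site w c i - 1)) = G y c i j h"
    by (simp add: dV_def sum.distrib bit_add_eq_0_iff G_def)
  have u: "(\<Sum>w\<in>?W. dU y (mid_site w c ?i)) = 0"
    by (rule class_sum[where f = R and A = "{lo..<hi}" and k = 1, OF b(1-4) i' q_dvd_R[OF b(7) P(2)] q_pos R_pos R_le mid_sub(2)]) (simp add: bcoeff_def)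
  have h: "(\<Sum>w\<in>?W. dH y (mid_site w c ?i)) = 0"
    by (rule class_sum[where f = R and A = "{lo + K..<hi}" and k = 0, OF b(1-4) i' q_dvd_R[OF b(7) P(2)] q_pos R_pos R_le mid_sub(1)]) (simp add: bcoeff_def)
  show ?thesis
  \<comment> \<open>At the seam of the helix row 0 is preceded by row \<open>K - 1\<close> of the
    previous column. A horizontal edge then leads back to the column class \<open>c\<close>.\<close>
  proof (cases "i = 0")
    case True
    hence "?i = K - 1" using K by (simp add: zmod_minus1)
    hence "mid_site w c ?i - K = mid_site w c i - 1" for w using True by (simp add: mid_site_def)
    with h a show ?thesis by (simp add: dH_def sum.distrib bit_add_eq_0_iff G_def)
  next
    case False
    hence "?i = i - 1" using b by simp
    hence "mid_site w c ?i = mid_site w c i - 1" for w by (simp add: mid_site_def)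
    with u a show ?thesis by (simp add: dU_def sum.distrib bit_add_eq_0_iff G_def)
  qed
qed

text \<open>The rows using \<open>j\<close> are \<open>j\<close>, \<open>j - 1\<close>, ...,
  \<open>j - e + 1\<close> cyclically, so stepping from \<open>i\<close> up to \<open>j\<close>
  stays among them.\<close>

lemma G_same:
  assumes b: "boundary y \<subseteq> X" "free c X" "0 \<le> c" "c < Q" "0 \<le> i" "i < K" "j \<in> {0..<K}" "row_uses i j"
  shows "G y c i j h = G y c j j h"
  using b(5,6,8)
proof (induction "nat ((j - i) mod K)" arbitrary: i)
  case 0
  hence "(j - i) mod K = 0" using K by (metis nat_0_iff nle_le pos_mod_sign zero_less_numeral order_less_le_trans)
  hence "j mod K = i mod K" using mod_eq_dvd_iff[of j K i] by (simp add: dvd_eq_mod_eq_0)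
  hence "i = j" using 0 b by simp
  thus ?case by simp
next
  case (Suc l i)
  let ?i = "(i + 1) mod K"
  have ne: "(j - i) mod K = int l + 1" using Suc(2) by linarith
  have "(j - ?i) mod K = (j - i - 1) mod K" by (simp add: mod_simps algebra_simps)
  also have "\<dots> = ((j - i) mod K - 1) mod K" by (simp add: mod_simps)
  also have "\<dots> = int l" using ne K pos_mod_bound[of K "j - i"] by (simp add: mod_pos_pos_trivial)
  finally have l: "(j - ?i) mod K = int l" .
  have p: "row_uses ?i j" using l ne Suc.prems by (simp add: row_uses_def)
  have r: "0 \<le> ?i" "?i < K" using K by auto
  have i: "(?i - 1) mod K = i" using Suc.prems by (simp add: mod_simps)
  have "G y c ?i j h = G y c j j h" by (rule Suc.hyps(1)) (use l p r in auto)
  thus ?case using G_adj[OF b(1-4) r b(7) p, of h] i Suc.prems by simp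
qed

section \<open>Row sums over the stretches between columns of a free class\<close>

text \<open>The number of the stretch containing the column of \<open>r\<close>, where stretch
  \<open>z\<close> starts at column \<open>c + Q * z\<close>. The open stretches at the two ends are
  numbered -1 and \<open>T - 1\<close>.\<close>

definition stretch :: "int \<Rightarrow> int \<Rightarrow> int" where
  "stretch c r = (let x = r div K in if x < 0 then -1 else if Q * T \<le> x then T - 1 else (x - c) div Q)"

text \<open>For \<open>0 < c < Q\<close> the same function as \<open>stretch\<close>, taking a
  column and with the thresholds at columns of class \<open>c\<close>, as telescoping needs
  them.\<close>

definition col_stretch :: "int \<Rightarrow> int \<Rightarrow> int" where
  "col_stretch c x = (if x < c then -1 else if c + Q * (T - 1) \<le> x then T - 1 else (x - c) div Q)"

lemma col_stretch_mid:
  assumes "0 < c" "c < Q" "0 \<le> c'" "c' < Q" "0 \<le> w" "w < T" "v = 0 \<or> v = 1"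
  shows "col_stretch c (c' + Q * w - v) = w - (if c' - v < c then 1 else 0)"
proof -
  let ?x = "c' + Q * w - v"
  let ?d = "if c' - v < c then 1 else (0::int)"
  have div: "(?x - c) div Q = w - ?d"
  proof (cases "c' - v < c")
    case True
    have "?x - c = (Q + c' - v - c) + Q * (w - 1)" by (simp add: algebra_simps)
    moreover have "((Q + c' - v - c) + Q * (w - 1)) div Q = (w - 1) + (Q + c' - v - c) div Q"
      using assms by (intro div_mult_self2) auto
    moreover have "(Q + c' - v - c) div Q = 0" using True assms by (intro div_pos_pos_trivial) auto
    ultimately show ?thesis using True by presburger
  next
    case False
    have "?x - c = (c' - v - c) + Q * w" by (simp add: algebra_simps)
    moreover have "((c' - v - c) + Q * w) div Q = w + (c' - v - c) div Q"
      using assms by (intro div_mult_self2) auto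
    moreover have "(c' - v - c) div Q = 0" using False assms by (intro div_pos_pos_trivial) auto
    ultimately show ?thesis using False by presburger
  qed
  have lt: "?x < c \<longleftrightarrow> w - ?d < 0" using zdiv_less_iff[of Q "?x - c" 0] unfolding div using Q by linarith
  have ge: "c + Q * (T - 1) \<le> ?x \<longleftrightarrow> T - 1 \<le> w - ?d"
    using zdiv_less_iff[of Q "?x - c" "T - 1"] unfolding div mult.commute[of "T - 1"] using Q by linarith
  have w: "w - ?d < 0 \<Longrightarrow> w - ?d = - 1" "w - ?d \<le> T - 1" using assms by (auto split: if_splits)
  define u where "u = w - ?d"
  define x where "x = ?x"
  have "x < c \<longleftrightarrow> u < 0" "c + Q * (T - 1) \<le> x \<longleftrightarrow> T - 1 \<le> u" "(x - c) div Q = u" "u < 0 \<Longrightarrow> u = -1" "u \<le> T - 1"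
    using lt ge div w by (simp_all only: u_def x_def)
  hence "col_stretch c x = u" by (auto simp: col_stretch_def)
  thus ?thesis by (simp only: u_def x_def)
qed

text \<open>Copies of a variable differ by multiples of \<open>R i\<close> blocks, hence of
  \<open>m\<close>, so the stretch modulo \<open>m\<close> can be read off the variable. With
  \<open>v = 1\<close> horizontal edges are counted in the stretch of the column they leave; this
  differs from the stretch of the variable only in class \<open>c\<close>, where \<open>z\<close>
  makes the coefficient 0.\<close>

lemma row_regroup:
  assumes c: "0 < c" "c < Q" and i: "0 \<le> i" "i < K" and v: "v = 0 \<or> v = 1"
    and d: "d < 0" "Q * T \<le> f" and m: "m dvd R i" "0 < m"
    and A: "{0..<Q * T * K} \<subseteq> A" "\<And>x. x \<in> {d + v..<f + v} \<Longrightarrow> x * K + i \<in> A"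
    and z: "\<And>z. 0 \<le> z \<Longrightarrow> z < R i \<Longrightarrow> cfs A R p (mid_site z c i) = 0"
  shows "(\<Sum>x\<in>{d + v..<f + v}. if col_stretch c (x - v) mod m = h then p (x * K + i) else 0)
       = (\<Sum>r\<in>(\<lambda>x. rep R (x * K + i)) ` {d + v..<f + v}. if stretch c r mod m = h then cfs A R p r else 0)"
    (is "?L = ?R")
proof -
  let ?X = "{d + v..<f + v}" and ?k = "\<lambda>x. rep R (x * K + i)"
  have dK: "(x * K + i) div K = x" for x using i K by auto
  have midx: "0 \<le> x * K + i \<and> x * K + i < Q * T * K \<longleftrightarrow> 0 \<le> x \<and> x < Q * T" for x
    using zdiv_less_iff[of K "x * K + i" "Q * T"] pos_imp_zdiv_nonneg_iff[of K "x * K + i"] K dK[of x] by auto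
  have "?L = (\<Sum>r\<in>?k ` ?X. \<Sum>x\<in>{x\<in>?X. ?k x = r}. if col_stretch c (x - v) mod m = h then p (x * K + i) else 0)"
    by (rule sum_filter_image) auto
  also have "\<dots> = ?R"
  proof (rule sum.cong[OF refl])
    fix r assume "r \<in> ?k ` ?X"
    then obtain x0 where x0: "x0 \<in> ?X" "r = ?k x0" by blast
    show "(\<Sum>x\<in>{x\<in>?X. ?k x = r}. if col_stretch c (x - v) mod m = h then p (x * K + i) else 0)
        = (if stretch c r mod m = h then cfs A R p r else 0)"
    proof (cases "0 \<le> x0 \<and> x0 < Q * T")
      case False
      hence out: "\<not> (0 \<le> x0 * K + i \<and> x0 * K + i < Q * T * K)" using midx by simp
      hence r: "r = x0 * K + i" using x0(2) rep_out by simp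
      have "x = x0" if "?k x = r" for x
      proof -
        have "\<not> (0 \<le> x * K + i \<and> x * K + i < Q * T * K)"
          using that out r rep_nonneg_iff[of R "x * K + i"] rep_less_iff[of R "x * K + i"] R_pos by simp
        hence "x * K + i = x0 * K + i" using rep_out that r by simp
        thus ?thesis using K by simp
      qed
      hence S: "{x\<in>?X. ?k x = r} = {x0}" using x0 by auto
      have cfs: "cfs A R p r = p r" using cfs_out[OF out A(2) R_pos] x0 r by simp
      have "col_stretch c (x0 - v) = stretch c r"
      proof (cases "x0 < 0")
        case True thus ?thesis using c v r dK by (auto simp: col_stretch_def stretch_def)
      next
        case False': False
        have "Q * (T - 1) + Q = Q * T" "0 \<le> Q * (T - 1)" using Q T by (auto simp: algebra_simps)
        hence "c + Q * (T - 1) \<le> x0 - v" "\<not> x0 - v < c" using False False' c v by linarith+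
        thus ?thesis using False False' r dK by (simp add: col_stretch_def stretch_def)
      qed
      thus ?thesis using S cfs r by simp
    next
      case True
      define c' where "c' = x0 mod Q"
      define w0 where "w0 = x0 div Q"
      have x0e: "x0 * K + i = mid_site w0 c' i" by (simp add: mid_site_def c'_def w0_def)
      have c': "0 \<le> c'" "c' < Q" using Q by (auto simp: c'_def)
      have w0: "0 \<le> w0" "w0 < T" using mid_site_mid_iff[OF c' i, of w0] midx[of x0] True x0e by auto
      define ze where "ze = w0 mod R i"
      have r: "r = mid_site ze c' i" using x0(2) x0e rep_pt[OF c' i w0 R_pos] by (simp add: ze_def)
      have ze: "0 \<le> ze" "ze < R i" using R_pos[of i] by (auto simp: ze_def)
      let ?W = "{w\<in>{0..<T}. w mod R i = ze}"
      have cl: "{t\<in>UNIV. rep R t = mid_site ze c' i} = (\<lambda>w. mid_site w c' i) ` ?W"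
        by (rule class_eq) (use c' i ze R_pos R_le in auto)
      have S: "{x\<in>?X. ?k x = r} = (\<lambda>w. c' + Q * w) ` ?W"
      proof (intro equalityI subsetI)
        fix x assume "x \<in> {x\<in>?X. ?k x = r}"
        hence "x * K + i \<in> (\<lambda>w. mid_site w c' i) ` ?W" using cl r by auto
        then obtain w where "w \<in> ?W" "x * K + i = mid_site w c' i" by blast
        moreover from this(2) have "x = c' + Q * w" using dK[of x] mid_site_div[OF i, of w c'] by simp
        ultimately show "x \<in> (\<lambda>w. c' + Q * w) ` ?W" by blast
      next
        fix x assume "x \<in> (\<lambda>w. c' + Q * w) ` ?W"
        then obtain w where w: "w \<in> ?W" "x = c' + Q * w" by blast
        have xe: "x * K + i = mid_site w c' i" using w(2) by (simp add: mid_site_def)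
        hence "rep R (x * K + i) = r" using cl w(1) r by auto
        moreover have "0 \<le> x \<and> x < Q * T" using midx[of x] xe mid_site_mid_iff[OF c' i, of w] w(1) by simp
        hence "x \<in> ?X" using d v by auto
        ultimately show "x \<in> {x\<in>?X. ?k x = r}" by simp
      qed
      let ?s = "if c' - v < c then 1 else (0::int)"
      have "(\<Sum>x\<in>{x\<in>?X. ?k x = r}. if col_stretch c (x - v) mod m = h then p (x * K + i) else 0)
          = (\<Sum>w\<in>?W. if col_stretch c (c' + Q * w - v) mod m = h then p (mid_site w c' i) else 0)"
        unfolding S mid_site_def using Q by (subst sum.reindex) (auto simp: inj_on_def)
      also have "\<dots> = (\<Sum>w\<in>?W. if (ze - ?s) mod m = h then p (mid_site w c' i) else 0)"
      proof (rule sum.cong[OF refl])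
        fix w assume w: "w \<in> ?W"
        have "col_stretch c (c' + Q * w - v) = w - ?s" using col_stretch_mid[OF c c', of w v] w v by simp
        moreover have "w mod m = ze mod m" using w m(1) by (metis (mono_tags, lifting) mem_Collect_eq mod_mod_cancel)
        hence "(w - ?s) mod m = (ze - ?s) mod m" by (metis mod_diff_left_eq)
        ultimately show "(if col_stretch c (c' + Q * w - v) mod m = h then p (mid_site w c' i) else 0)
          = (if (ze - ?s) mod m = h then p (mid_site w c' i) else 0)" by simp
      qed
      also have "\<dots> = (if (ze - ?s) mod m = h then cfs A R p r else 0)"
        using cfs_mid[where f = R and p = p, OF c' i ze R_le R_pos A(1)] by (simp add: r)
      also have "\<dots> = (if stretch c r mod m = h then cfs A R p r else 0)"
      proof (cases "c' = c")
        case True thus ?thesis using z[OF ze] r by simp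
      next
        case False
        have rd: "r div K = c' + Q * ze" using r mid_site_div[OF i] by simp
        have "ze < T" using ze R_le[of i] by simp
        hence "0 \<le> r div K \<and> r div K < Q * T" unfolding rd
          using midx[of "c' + Q * ze"] mid_site_mid_iff[OF c' i, of ze] ze(1) by (simp add: mid_site_def)
        moreover have "(r div K - c) div Q = ze - ?s"
        proof (cases "c' < c")
          case True
          have "r div K - c = (Q + c' - c) + Q * (ze - 1)" by (simp add: rd algebra_simps)
          moreover have "((Q + c' - c) + Q * (ze - 1)) div Q = (ze - 1) + (Q + c' - c) div Q"
            using c by (intro div_mult_self2) auto
          moreover have "(Q + c' - c) div Q = 0" using True c c' by (intro div_pos_pos_trivial) auto
          ultimately have "(r div K - c) div Q = ze - 1" by presburger
          thus ?thesis using True v by auto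
        next
          case F: False
          have "r div K - c = (c' - c) + Q * ze" by (simp add: rd algebra_simps)
          moreover have "((c' - c) + Q * ze) div Q = ze + (c' - c) div Q"
            using c by (intro div_mult_self2) auto
          moreover have "(c' - c) div Q = 0" using F c c' by (intro div_pos_pos_trivial) auto
          ultimately have "(r div K - c) div Q = ze" by presburger
          thus ?thesis using False F v by auto
        qed
        ultimately have "stretch c r = ze - ?s" by (auto simp: stretch_def Let_def)
        thus ?thesis by simp
      qed
      finally show ?thesis .
    qed
  qed
  finally show ?thesis .
qed

definition Uvars :: "int \<Rightarrow> int \<Rightarrow> int \<Rightarrow> int set" where "Uvars d f i = (\<lambda>x. rep R (x * K + i)) ` {d..<f}"
definition Hvars :: "int \<Rightarrow> int \<Rightarrow> int \<Rightarrow> int set" where "Hvars d f i = (\<lambda>x. rep R (x * K + i)) ` {d + 1..<f + 1}"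

definition rowsum :: "(bool \<Rightarrow> int \<Rightarrow> bit) \<Rightarrow> int \<Rightarrow> int \<Rightarrow> int \<Rightarrow> (int \<Rightarrow> bool) \<Rightarrow> bit" where
  "rowsum y d f i P = (\<Sum>r\<in>Uvars d f i. if P r then bcoeff y (1, r) else 0) + (\<Sum>r\<in>Hvars d f i. if P r then bcoeff y (0, r) else 0)"

lemma stretch_step:
  "dU y (x * K + i) + dH y ((x + 1) * K + i) = y False (x * K + i) + y False ((x + 1) * K + i)"
  by (simp add: dU_def dH_def algebra_simps)

lemma in_range:
  assumes "- D \<le> x" "x < Q * T + D" "0 \<le> i" "i < K"
  shows "lo \<le> x * K + i" "x * K + i < hi"
proof -
  have "- D * K \<le> x * K" using assms K by (intro mult_right_mono) auto
  thus "lo \<le> x * K + i" using assms by (simp add: lo_def)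
  have "(x + 1) * K \<le> (Q * T + D) * K" using assms K by (intro mult_right_mono) auto
  thus "x * K + i < hi" using assms by (simp add: hi_def algebra_simps)
qed

lemma bcoeff_U: "bcoeff y (1, r) = cfs {lo..<hi} R (dU y) r"
  and bcoeff_H: "bcoeff y (0, r) = cfs {lo + K..<hi} R (dH y) r"
  and bcoeff_V: "bcoeff y (2, r) = cfs {lo + 1..<hi} S (dV y) r"
  by (simp_all add: bcoeff_def)

text \<open>The \<open>uvar\<close> of column \<open>x\<close> and the \<open>hvar\<close> into
  column \<open>x + 1\<close> share the out-site of \<open>x\<close>, whose coefficient cancels;
  what is left is a difference of consecutive in-sites.\<close>

lemma rowsum_eq:
  assumes b: "boundary y \<subseteq> X" "free c X" "0 < c" "c < Q" and i: "0 \<le> i" "i < K"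
    and d: "- D \<le> d" "d < 0" "Q * T \<le> f" "f < Q * T + D" and m: "m dvd R i" "0 < m"
  shows "rowsum y d f i (\<lambda>r. stretch c r mod m = h)
    = (\<Sum>x\<in>{d..<f}. if col_stretch c x mod m = h then y False (x * K + i) + y False ((x + 1) * K + i) else 0)"
proof -
  have R0: "0 < R i" using R_pos[of i] by simp
  have cz: "bcoeff y (k, mid_site z c i) = 0" if "0 \<le> z" "z < R i" for k z
    using free_cf[OF b(1,2), of i z k] b i that R_le[of i] by simp
  have "(\<Sum>r\<in>Uvars d f i. if stretch c r mod m = h then bcoeff y (1, r) else 0)
    = (\<Sum>r\<in>(\<lambda>x. rep R (x * K + i)) ` {d + 0..<f + 0}. if stretch c r mod m = h then cfs {lo..<hi} R (dU y) r else 0)"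
    by (simp only: Uvars_def bcoeff_U add_0_right)
  also have "\<dots> = (\<Sum>x\<in>{d + 0..<f + 0}. if col_stretch c (x - 0) mod m = h then dU y (x * K + i) else 0)"
  proof (rule row_regroup[symmetric])
    show "cfs {lo..<hi} R (dU y) (mid_site z c i) = 0" if "0 \<le> z" "z < R i" for z
      using cz[OF that, of 1] by (simp add: bcoeff_def)
    show "x * K + i \<in> {lo..<hi}" if "x \<in> {d + 0..<f + 0}" for x
      using in_range[of x i] that d i by auto
  qed (use b i d m mid_sub in auto)
  also have "\<dots> = (\<Sum>x\<in>{d..<f}. if col_stretch c x mod m = h then dU y (x * K + i) else 0)" by simp
  finally have U: "(\<Sum>r\<in>Uvars d f i. if stretch c r mod m = h then bcoeff y (1, r) else 0) = \<dots>" .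
  have "(\<Sum>r\<in>Hvars d f i. if stretch c r mod m = h then bcoeff y (0, r) else 0)
    = (\<Sum>r\<in>(\<lambda>x. rep R (x * K + i)) ` {d + 1..<f + 1}. if stretch c r mod m = h then cfs {lo + K..<hi} R (dH y) r else 0)"
    by (simp only: Hvars_def bcoeff_H)
  also have "\<dots> = (\<Sum>x\<in>{d + 1..<f + 1}. if col_stretch c (x - 1) mod m = h then dH y (x * K + i) else 0)"
  proof (rule row_regroup[symmetric])
    show "cfs {lo + K..<hi} R (dH y) (mid_site z c i) = 0" if "0 \<le> z" "z < R i" for z
      using cz[OF that, of 0] by (simp add: bcoeff_def)
    show "x * K + i \<in> {lo + K..<hi}" if "x \<in> {d + 1..<f + 1}" for x
      using in_range[of x i] in_range[of "x - 1" i] that d i by (auto simp: algebra_simps)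
  qed (use b i d m mid_sub in auto)
  also have "\<dots> = (\<Sum>x\<in>{d..<f}. if col_stretch c x mod m = h then dH y ((x + 1) * K + i) else 0)"
    by (rule sum.reindex_bij_witness[of _ "\<lambda>x. x + 1" "\<lambda>x. x - 1"]) auto
  finally have H: "(\<Sum>r\<in>Hvars d f i. if stretch c r mod m = h then bcoeff y (0, r) else 0) = \<dots>" .
  show ?thesis unfolding rowsum_def U H sum.distrib[symmetric]
    by (rule sum.cong[OF refl]) (simp add: stretch_step)
qed

lemma col_stretch_iff:
  assumes "0 < c" "c < Q" "d < 0" "Q * T \<le> f" "-1 \<le> z" "z < T" "d \<le> x" "x < f"
  defines "lf \<equiv> \<lambda>z. if z < 0 then d else if T \<le> z then f else c + Q * z"
  shows "col_stretch c x = z \<longleftrightarrow> lf z \<le> x \<and> x < lf (z + 1)"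
proof -
  have dv: "n \<le> (x - c) div Q \<longleftrightarrow> c + Q * n \<le> x" for n
    using zdiv_less_iff[of Q "x - c" n] Q unfolding mult.commute[of n] by linarith
  have mono: "Q * n \<le> Q * n'" if "n \<le> n'" for n n' using that Q by (intro mult_left_mono) auto
  have d0: "x < c \<longleftrightarrow> (x - c) div Q < 0" using dv[of 0] by auto
  have dT: "c + Q * (T - 1) \<le> x \<longleftrightarrow> T - 1 \<le> (x - c) div Q" using dv by simp
  consider "z < 0" | "0 \<le> z" "z + 1 < T" | "0 \<le> z" "z + 1 = T" using assms by linarith
  thus ?thesis
  proof cases
    case 1
    hence "z = -1" using assms by simp
    thus ?thesis using assms T d0 dT by (auto simp: col_stretch_def lf_def)
  next
    case 2
    have "col_stretch c x = z \<longleftrightarrow> (x - c) div Q = z" using 2 d0 dT by (auto simp: col_stretch_def)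
    also have "\<dots> \<longleftrightarrow> z \<le> (x - c) div Q \<and> \<not> z + 1 \<le> (x - c) div Q" by auto
    finally show ?thesis using dv 2 by (auto simp: lf_def)
  next
    case 3
    hence z: "z = T - 1" by simp
    have "col_stretch c x = z \<longleftrightarrow> T - 1 \<le> (x - c) div Q" using 3 d0 dT z by (auto simp: col_stretch_def)
    thus ?thesis using dT 3 z assms by (auto simp: lf_def)
  qed
qed

text \<open>Each stretch telescopes to its two end columns. The column of class \<open>c\<close> in
  block \<open>w\<close> begins stretch \<open>w\<close> and ends stretch \<open>w - 1\<close>,
  hence the residues \<open>h\<close> and \<open>h + 1\<close>.\<close>

lemma stretch_sum:
  fixes g :: "int \<Rightarrow> bit"
  assumes c: "0 < c" "c < Q" and d: "d < 0" "Q * T \<le> f" and h: "0 \<le> h" "h < m"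
  shows "(\<Sum>x\<in>{d..<f}. if col_stretch c x mod m = h then g x + g (x + 1) else 0)
    = (if (-1) mod m = h then g d else 0) + (if (T - 1) mod m = h then g f else 0)
      + (\<Sum>w\<in>{w\<in>{0..<T}. w mod m = h}. g (c + Q * w)) + (\<Sum>w\<in>{w\<in>{0..<T}. w mod m = (h + 1) mod m}. g (c + Q * w))"
proof -
  \<comment> \<open>\<open>lf z\<close> is where stretch \<open>z\<close> begins; \<open>d\<close>
    and \<open>f\<close> close the two open stretches.\<close>
  define lf where "lf z = (if z < 0 then d else if T \<le> z then f else c + Q * z)" for z
  have QT: "0 \<le> Q * T" "Q * (T - 1) = Q * T - Q" using Q T by (auto simp: algebra_simps)
  have Qz: "Q * z \<le> Q * (T - 1)" if "z < T" for z using that Q by (intro mult_left_mono) auto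
  have Qz0: "0 \<le> Q * z" if "0 \<le> z" for z using that Q by simp
  have lfb: "d \<le> lf z \<and> lf z \<le> f" for z
    using c d Qz[of z] Qz0[of z] QT unfolding lf_def
    by (cases "z < 0"; cases "T \<le> z"; simp only: if_True if_False; linarith)
  have mono: "lf z \<le> lf (z + 1)" for z
  proof (cases "z < 0 \<or> T \<le> z + 1")
    case True
    thus ?thesis using lfb[of z] lfb[of "z + 1"] by (auto simp: lf_def)
  next
    case False
    thus ?thesis using Q by (auto simp: lf_def algebra_simps)
  qed
  have "(\<Sum>x\<in>{d..<f}. if col_stretch c x mod m = h then g x + g (x + 1) else 0)
    = (\<Sum>z\<in>{-1..<T}. \<Sum>x\<in>{x\<in>{d..<f}. col_stretch c x = z}. if col_stretch c x mod m = h then g x + g (x + 1) else 0)"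
  proof (rule sum_filter_image)
    show "col_stretch c ` {d..<f} \<subseteq> {-1..<T}"
    proof
      fix z assume "z \<in> col_stretch c ` {d..<f}"
      then obtain x where "z = col_stretch c x" by blast
      moreover have "x < c \<or> 0 \<le> (x - c) div Q" using Q pos_imp_zdiv_nonneg_iff[of Q "x - c"] by linarith
      moreover have "(x - c) div Q < T - 1 \<or> c + Q * (T - 1) \<le> x"
        using zdiv_less_iff[of Q "x - c" "T - 1"] Q unfolding mult.commute[of "T - 1"] by linarith
      ultimately have "-1 \<le> z" "z < T" using T unfolding col_stretch_def
        by (cases "x < c"; cases "c + Q * (T - 1) \<le> x"; simp)+
      thus "z \<in> {-1..<T}" by simp
    qed
  qed auto
  also have "\<dots> = (\<Sum>z\<in>{-1..<T}. if z mod m = h then g (lf z) + g (lf (z + 1)) else 0)"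
  proof (rule sum.cong[OF refl])
    fix z assume z: "z \<in> {-1..<T}"
    have "col_stretch c x = z \<longleftrightarrow> lf z \<le> x \<and> x < lf (z + 1)" if "x \<in> {d..<f}" for x
      using col_stretch_iff[OF c d, of z x] z that by (simp add: lf_def)
    hence "x \<in> {x\<in>{d..<f}. col_stretch c x = z} \<longleftrightarrow> x \<in> {lf z..<lf (z + 1)}" for x
      using lfb[of z] lfb[of "z + 1"] by (cases "x \<in> {d..<f}") auto
    hence "{x\<in>{d..<f}. col_stretch c x = z} = {lf z..<lf (z + 1)}" by blast
    moreover have "(\<Sum>x\<in>{x\<in>{d..<f}. col_stretch c x = z}. if col_stretch c x mod m = h then g x + g (x + 1) else 0)
      = (\<Sum>x\<in>{x\<in>{d..<f}. col_stretch c x = z}. if z mod m = h then g x + g (x + 1) else 0)"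
      by (rule sum.cong) auto
    ultimately show "(\<Sum>x\<in>{x\<in>{d..<f}. col_stretch c x = z}. if col_stretch c x mod m = h then g x + g (x + 1) else 0)
      = (if z mod m = h then g (lf z) + g (lf (z + 1)) else 0)"
      using telescope_bit[OF mono[of z], of g] by simp
  qed
  also have "\<dots> = (\<Sum>z\<in>{-1..<T}. if z mod m = h then g (lf z) else 0) + (\<Sum>z\<in>{-1..<T}. if z mod m = h then g (lf (z + 1)) else 0)"
    by (subst sum.distrib[symmetric], rule sum.cong) auto
  also have "(\<Sum>z\<in>{-1..<T}. if z mod m = h then g (lf (z + 1)) else 0) = (\<Sum>w\<in>{0..<T + 1}. if (w - 1) mod m = h then g (lf w) else 0)"
    by (rule sum.reindex_bij_witness[of _ "\<lambda>x. x - 1" "\<lambda>x. x + 1"]) auto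
  also have "{-1..<T} = insert (-1) {0..<T}" using T by auto
  also have "{0..<T + 1} = insert T {0..<T}" using T by auto
  finally have 1: "(\<Sum>x\<in>{d..<f}. if col_stretch c x mod m = h then g x + g (x + 1) else 0)
    = ((if (-1) mod m = h then g (lf (-1)) else 0) + (\<Sum>z\<in>{0..<T}. if z mod m = h then g (lf z) else 0))
    + ((if (T - 1) mod m = h then g (lf T) else 0) + (\<Sum>w\<in>{0..<T}. if (w - 1) mod m = h then g (lf w) else 0))"
    by simp
  have sumif: "(\<Sum>w\<in>{0..<T}. if P w then g (lf w) else 0) = (\<Sum>w\<in>{w\<in>{0..<T}. P w}. g (c + Q * w))" for P
    by (subst sum.inter_filter[symmetric]) (auto simp: lf_def intro!: sum.cong)
  have eq: "(w - 1) mod m = h \<longleftrightarrow> w mod m = (h + 1) mod m" for w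
  proof
    assume "(w - 1) mod m = h"
    hence "((w - 1) mod m + 1) mod m = (h + 1) mod m" by simp
    thus "w mod m = (h + 1) mod m" by (simp add: mod_simps)
  next
    assume "w mod m = (h + 1) mod m"
    hence "(w mod m - 1) mod m = ((h + 1) mod m - 1) mod m" by simp
    thus "(w - 1) mod m = h" using h by (simp add: mod_simps)
  qed
  have e1: "lf (-1) = d" "lf T = f" using T by (auto simp: lf_def)
  show ?thesis unfolding 1 sumif eq e1 by (simp only: ac_simps)
qed

text \<open>After telescoping only the end coefficients and two values of \<open>G\<close> remain,
  and none of them depends on the row.\<close>

lemma rowsum_transfer:
  assumes b: "boundary y \<subseteq> X" "free c X" "0 < c" "c < Q"
    and i: "0 \<le> i" "i < K" "row_uses i j" and i': "0 \<le> i'" "i' < K" "row_uses i' j" and j: "j \<in> {0..<K}"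
    and d: "- D \<le> d" "d < 0" "Q * T \<le> f" "f < Q * T + D" and h: "0 \<le> h" "h < q j"
    and s: "\<And>i. 0 \<le> i \<Longrightarrow> i < K \<Longrightarrow> y False (d * K + i) = s" and t: "\<And>i. 0 \<le> i \<Longrightarrow> i < K \<Longrightarrow> y False (f * K + i) = t"
  shows "rowsum y d f i (\<lambda>r. stretch c r mod q j = h) = rowsum y d f i' (\<lambda>r. stretch c r mod q j = h)"
proof -
  have *: "rowsum y d f i (\<lambda>r. stretch c r mod q j = h) = (if (-1) mod q j = h then s else 0) + (if (T - 1) mod q j = h then t else 0)
     + G y c j j h + G y c j j ((h + 1) mod q j)" if i: "0 \<le> i" "i < K" "row_uses i j" for i
  proof -
    have "rowsum y d f i (\<lambda>r. stretch c r mod q j = h) = (\<Sum>x\<in>{d..<f}. if col_stretch c x mod q j = h then y False (x * K + i) + y False ((x + 1) * K + i) else 0)"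
      by (rule rowsum_eq[OF b i(1,2) d q_dvd_R[OF j i(3)] q_pos])
    also have "\<dots> = (if (-1) mod q j = h then y False (d * K + i) else 0) + (if (T - 1) mod q j = h then y False (f * K + i) else 0)
       + G y c i j h + G y c i j ((h + 1) mod q j)"
      using stretch_sum[OF b(3,4) d(2,3) h, of "\<lambda>x. y False (x * K + i)"] by (simp add: G_def mid_site_def)
    finally show ?thesis using G_same[OF b(1,2) _ b(4) i(1,2) j i(3)] b(3) s[OF i(1,2)] t[OF i(1,2)] by simp
  qed
  show ?thesis using *[OF i] *[OF i'] by simp
qed

text \<open>Vertical variables join two rows and are left out by \<open>fst a < 2\<close>.\<close>

definition row :: "(nat \<times> int) set \<Rightarrow> int \<Rightarrow> (nat \<times> int) set" where
  "row X i = {a\<in>X. fst a < 2 \<and> snd a mod K = i}"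

lemma rowsum_total:
  assumes b: "boundary y \<subseteq> X" "free c X" "0 < c" "c < Q" and i: "0 \<le> i" "i < K"
    and d: "- D \<le> d" "d < 0" "Q * T \<le> f" "f < Q * T + D"
  shows "rowsum y d f i (\<lambda>r. True) = y False (d * K + i) + y False (f * K + i)"
proof -
  \<comment> \<open>Modulus 1 makes the condition on residues vacuous.\<close>
  have "rowsum y d f i (\<lambda>r. stretch c r mod 1 = 0) = (\<Sum>x\<in>{d..<f}. if col_stretch c x mod 1 = 0 then y False (x * K + i) + y False ((x + 1) * K + i) else 0)"
    by (rule rowsum_eq[OF b i d]) auto
  moreover have "0 \<le> Q * T" using Q T by simp
  hence "d \<le> f" using d by simp
  ultimately show ?thesis using telescope_bit[of d f "\<lambda>x. y False (x * K + i)"] by simp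
qed

lemma var_row: assumes "0 \<le> i" "i < K" "r \<in> Uvars d f i \<or> r \<in> Hvars d f i" shows "r mod K = i"
proof -
  obtain x where "r = rep R (x * K + i)" using assms(3) by (auto simp: Uvars_def Hvars_def)
  hence "r mod K = (x * K + i) mod K" by (simp only: rep_mod)
  also have "\<dots> = i mod K" by (rule mod_mult_self3)
  finally show ?thesis using assms(1,2) by simp
qed

lemma row_odd:
  assumes b: "boundary y \<subseteq> X" "free c X" "0 < c" "c < Q" and i: "0 \<le> i" "i < K"
    and d: "- D \<le> d" "d < 0" "Q * T \<le> f" "f < Q * T + D"
    and n: "y False (d * K + i) \<noteq> y False (f * K + i)"
  shows "row (boundary y) i \<noteq> {}"
proof -
  have "rowsum y d f i (\<lambda>r. True) \<noteq> 0" using rowsum_total[OF b i d] n by (simp only: bit_add_eq_0_iff not_False_eq_True)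
  hence "(\<Sum>r\<in>Uvars d f i. bcoeff y (1, r)) \<noteq> 0 \<or> (\<Sum>r\<in>Hvars d f i. bcoeff y (0, r)) \<noteq> 0"
    by (auto simp: rowsum_def)
  then obtain r k where r: "r \<in> Uvars d f i \<or> r \<in> Hvars d f i" "bcoeff y (k, r) \<noteq> 0" "k < 2"
  proof
    assume "(\<Sum>r\<in>Uvars d f i. bcoeff y (1, r)) \<noteq> 0"
    then obtain r where "r \<in> Uvars d f i" "bcoeff y (1, r) \<noteq> 0" by (meson sum.neutral)
    thus ?thesis using that[of r 1] by simp
  next
    assume "(\<Sum>r\<in>Hvars d f i. bcoeff y (0, r)) \<noteq> 0"
    then obtain r where "r \<in> Hvars d f i" "bcoeff y (0, r) \<noteq> 0" by (meson sum.neutral)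
    thus ?thesis using that[of r 0] by simp
  qed
  hence "(k, r) \<in> row (boundary y) i" using var_row[OF i r(1)] by (simp add: row_def boundary_def)
  thus ?thesis by blast
qed

lemma rowsum_thin:
  assumes "boundary y \<subseteq> X" "row X i = {a}" "0 \<le> i" "i < K"
  shows "rowsum y d f i P = (if P (snd a) then rowsum y d f i (\<lambda>r. True) else 0)"
proof -
  have z: "bcoeff y (k, r) = 0" if "(k, r) \<noteq> a" "k < 2" "r \<in> Uvars d f i \<or> r \<in> Hvars d f i" for k r
  proof (rule ccontr)
    assume "bcoeff y (k, r) \<noteq> 0"
    hence "(k, r) \<in> row X i" using var_row[OF assms(3,4) that(3)] assms(1) that(2) by (auto simp: row_def boundary_def)
    thus False using assms(2) that by blast
  qed
  have eq: "(if P r then bcoeff y (k, r) else 0) = (if P (snd a) then bcoeff y (k, r) else 0)"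
    if "k < 2" "r \<in> Uvars d f i \<or> r \<in> Hvars d f i" for k r
    using z[OF _ that] by (cases "(k, r) = a") auto
  show ?thesis unfolding rowsum_def
    using eq[of 1] eq[of 0] by (cases "P (snd a)") (auto intro!: sum.neutral arg_cong2[where f = "(+)"] sum.cong split: if_splits)
qed

text \<open>The row sum over all residues is 1, and in a thin row a single variable can contribute
  it. So its stretch is the only residue modulo \<open>q j\<close> with sum 1, and
  \<open>rowsum_transfer\<close> carries this residue to the other row.\<close>

lemma thin_cong:
  assumes b: "boundary y \<subseteq> X" "free c X" "0 < c" "c < Q"
    and i: "0 \<le> i" "i < K" "row_uses i j" and i': "0 \<le> i'" "i' < K" "row_uses i' j" and j: "j \<in> {0..<K}"
    and d: "- D \<le> d" "d < 0" "Q * T \<le> f" "f < Q * T + D"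
    and s: "\<And>i. 0 \<le> i \<Longrightarrow> i < K \<Longrightarrow> y False (d * K + i) = s" and t: "\<And>i. 0 \<le> i \<Longrightarrow> i < K \<Longrightarrow> y False (f * K + i) = t"
    and st: "s \<noteq> t" and a: "row X i = {a}" "row X i' = {a'}"
  shows "[stretch c (snd a) = stretch c (snd a')] (mod q j)"
proof -
  let ?h = "stretch c (snd a) mod q j"
  have tot: "rowsum y d f i (\<lambda>r. True) = 1" if "0 \<le> i" "i < K" for i
  proof -
    have "rowsum y d f i (\<lambda>r. True) = s + t" using rowsum_total[OF b that d] s t that by simp
    thus ?thesis using st by (metis bit_add_eq_0_iff bit_not_zero_iff)
  qed
  have h: "0 \<le> ?h" "?h < q j" using q_pos[of j] by auto
  have "rowsum y d f i (\<lambda>r. stretch c r mod q j = ?h) = rowsum y d f i' (\<lambda>r. stretch c r mod q j = ?h)"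
    by (rule rowsum_transfer[OF b i i' j d h]) (use s t in auto)
  moreover have "rowsum y d f i (\<lambda>r. stretch c r mod q j = ?h) = 1"
    using rowsum_thin[OF b(1) a(1) i(1,2), of d f "\<lambda>r. stretch c r mod q j = ?h"] tot[OF i(1,2)] by simp
  moreover have "rowsum y d f i' (\<lambda>r. stretch c r mod q j = ?h) = (if stretch c (snd a') mod q j = ?h then 1 else 0)"
    using rowsum_thin[OF b(1) a(2) i'(1,2), of d f "\<lambda>r. stretch c r mod q j = ?h"] tot[OF i'(1,2)] by simp
  ultimately have "(if stretch c (snd a') mod q j = ?h then 1 else 0) = (1::bit)" by metis
  hence "stretch c (snd a') mod q j = ?h" by (metis zero_neq_one)
  thus ?thesis by (simp only: unique_euclidean_semiring_class.cong_def)
qed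

definition colfree :: "int \<Rightarrow> (nat \<times> int) set \<Rightarrow> bool" where
  "colfree d X \<longleftrightarrow> (\<forall>a\<in>X. snd a div K \<noteq> d)"

text \<open>An uncompressed column is a path of \<open>uvar\<close> and \<open>vvar\<close> edges.
  If none of them is in the boundary, the coefficient is constant along the path.\<close>

lemma col_uniform:
  assumes b: "boundary y \<subseteq> X" "colfree d X" and d: "- D \<le> d \<and> d < 0 \<or> Q * T \<le> d \<and> d < Q * T + D" and i: "0 \<le> i" "i < K"
  shows "y False (d * K + i) = y False (d * K)"
proof -
  have z: "bcoeff y (k, d * K + i) = 0" if "0 \<le> i" "i < K" for i k
  proof -
    have "(d * K + i) div K = d" using that by simp
    hence "(k, d * K + i) \<notin> X" using b(2) unfolding colfree_def by (metis snd_conv)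
    thus ?thesis using b(1) by (auto simp: boundary_def)
  qed
  have out: "\<not> (0 \<le> d * K + i \<and> d * K + i < Q * T * K)" if "0 \<le> i" "i < K" for i
  proof
    assume "0 \<le> d * K + i \<and> d * K + i < Q * T * K"
    hence "0 \<le> (d * K + i) div K" "(d * K + i) div K < Q * T"
      using K zdiv_less_iff[of K "d * K + i" "Q * T"] pos_imp_zdiv_nonneg_iff[of K "d * K + i"] by linarith+
    moreover have "(d * K + i) div K = d" using that by simp
    ultimately show False using d by linarith
  qed
  have QT: "0 \<le> Q * T" using Q T by simp
  have rng: "lo \<le> d * K + i" "d * K + i < hi" if "0 \<le> i" "i < K" for i
    using in_range[of d i] that d QT D by auto
  have dU: "y True (d * K + i) = y False (d * K + i)" if "0 \<le> i" "i < K" for i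
  proof -
    have "bcoeff y (1, d * K + i) = dU y (d * K + i)"
      unfolding bcoeff_U by (rule cfs_out[OF out[OF that] _ R_pos]) (use rng[OF that] in simp)
    thus ?thesis using z[OF that, of 1] by (simp add: dU_def bit_add_eq_0_iff)
  qed
  show ?thesis using i
  proof (induction i rule: int_ge_induct)
    case base
    then show ?case by simp
  next
    case (step i)
    have "bcoeff y (2, d * K + (i + 1)) = dV y (d * K + (i + 1))"
      unfolding bcoeff_V by (rule cfs_out[OF out _ S_pos]) (use step rng[of i] rng[of "i + 1"] in auto)
    hence "y True (d * K + i) = y False (d * K + (i + 1))"
      using z[of "i + 1" 2] step by (simp add: dV_def bit_add_eq_0_iff algebra_simps)
    then show ?case using dU[of i] step by simp
  qed
qed

end

section \<open>Wall positions\<close>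

lemma prod_dvd_coprime:
  fixes q :: "'i \<Rightarrow> int"
  assumes "finite A" "\<And>i j. i \<in> A \<Longrightarrow> j \<in> A \<Longrightarrow> i \<noteq> j \<Longrightarrow> coprime (q i) (q j)" "\<And>j. j \<in> A \<Longrightarrow> q j dvd x"
  shows "(\<Prod>j\<in>A. q j) dvd x"
  using assms
proof (induction A rule: finite_induct)
  case empty then show ?case by simp
next
  case (insert a A)
  have "coprime (q a) (\<Prod>j\<in>A. q j)" using insert by (intro prod_coprime_right) auto
  thus ?case using insert by (simp add: divides_mult)
qed

lemma crt_int:
  fixes q u :: "int \<Rightarrow> int"
  assumes "finite A" "\<And>i j. i \<in> A \<Longrightarrow> j \<in> A \<Longrightarrow> i \<noteq> j \<Longrightarrow> coprime (q i) (q j)" "\<And>j. 0 < q j"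
  shows "\<exists>x. \<forall>j\<in>A. [u j = x] (mod q j)"
proof -
  have "\<exists>x. \<forall>j\<in>A. [x = nat (u j mod q j)] (mod nat (q j))"
  proof (rule chinese_remainder_nat)
    show "\<forall>i\<in>A. \<forall>j\<in>A. i \<noteq> j \<longrightarrow> coprime (nat (q i)) (nat (q j))"
      using assms(2,3) by (auto simp: coprime_int_iff[symmetric] less_imp_le)
  qed (use assms in auto)
  then obtain x where x: "\<forall>j\<in>A. [x = nat (u j mod q j)] (mod nat (q j))" by blast
  have "[u j = int x] (mod q j)" if "j \<in> A" for j
  proof -
    have "[int x = int (nat (u j mod q j))] (mod int (nat (q j)))" using x that cong_int_iff by blast
    hence "[int x = u j mod q j] (mod q j)" using assms(3)[of j] by (simp add: less_imp_le)
    thus ?thesis by (metis unique_euclidean_semiring_class.cong_def mod_mod_trivial)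
  qed
  thus ?thesis by blast
qed

lemma small_dvd: "(d::int) dvd x \<Longrightarrow> \<bar>x\<bar> < d \<Longrightarrow> x = 0"
proof (rule ccontr)
  assume "d dvd x" "\<bar>x\<bar> < d" "x \<noteq> 0"
  thus False using dvd_imp_le_int[of x d] by linarith
qed

context helix begin

definition thinrow :: "(nat \<times> int) set \<Rightarrow> int \<Rightarrow> bool" where "thinrow X i \<longleftrightarrow> (\<exists>a. row X i = {a})"

text \<open>\<open>Pos X r\<close> says that \<open>r\<close> is, modulo the \<open>q j\<close>, the position of the cut as seen from each row in
  which \<open>X\<close> has only one variable.\<close>

definition Posc :: "int \<Rightarrow> (nat \<times> int) set \<Rightarrow> int \<Rightarrow> bool" where
  "Posc c X r \<longleftrightarrow> (\<forall>i\<in>{0..<K}. \<forall>a. row X i = {a} \<longrightarrow> (\<forall>j\<in>{0..<K}. row_uses i j \<longrightarrow> [stretch c (snd a) = r] (mod q j)))"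

definition Pos :: "(nat \<times> int) set \<Rightarrow> int \<Rightarrow> bool" where "Pos X r \<longleftrightarrow> (\<exists>c. 0 < c \<and> c < Q \<and> Posc c X r)"

definition PP :: int where "PP = (\<Prod>j\<in>{0..<K}. q j)"

text \<open>Enlarging the set imposes fewer conditions: a row that is thin in \<open>X\<close> is
  thin in \<open>A\<close> with the same variable.\<close>

lemma Pos_antimono:
  assumes "Pos A r" "A \<subseteq> X" "\<And>i. 0 \<le> i \<Longrightarrow> i < K \<Longrightarrow> row A i \<noteq> {}"
  shows "Pos X r"
proof -
  have *: "row A i = {a}" if "row X i = {a}" "0 \<le> i" "i < K" for i a
  proof -
    have "row A i \<subseteq> row X i" using assms(2) by (auto simp: row_def)
    thus ?thesis using that assms(3)[of i] subset_singletonD by metis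
  qed
  have "Posc c X r" if h: "Posc c A r" for c
    unfolding Posc_def
  proof (intro ballI allI impI)
    fix i a j assume i: "i \<in> {0..<K}" "row X i = {a}" "j \<in> {0..<K}" "row_uses i j"
    hence "row A i = {a}" using * by simp
    thus "[stretch c (snd a) = r] (mod q j)" using h i unfolding Posc_def by blast
  qed
  thus ?thesis using assms(1) unfolding Pos_def by blast
qed

lemma Pos_periodic: assumes "Pos X r" "[r = r'] (mod PP)" shows "Pos X r'"
proof -
  have "[r = r'] (mod q j)" if "j \<in> {0..<K}" for j
    using assms(2) that unfolding PP_def by (meson cong_dvd_modulus dvd_prodI finite_atLeastLessThan_int)
  thus ?thesis using assms(1) cong_trans unfolding Pos_def Posc_def by blast
qed

text \<open>Two classes differ by less than one block of \<open>Q\<close> columns.\<close>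

lemma stretch_diff:
  assumes "0 < c" "c < Q" "0 < c'" "c' < Q"
  shows "stretch c r - stretch c' r \<in> {-1, 0, 1}"
proof -
  let ?x = "r div K"
  have "(?x - c) div Q \<le> (?x - c' + 1 * Q) div Q" "(?x - c') div Q \<le> (?x - c + 1 * Q) div Q"
    using assms by (intro zdiv_mono1; simp)+
  hence "(?x - c) div Q \<le> (?x - c') div Q + 1" "(?x - c') div Q \<le> (?x - c) div Q + 1"
    using Q by (simp_all only: div_mult_self1)
  hence "(?x - c) div Q - (?x - c') div Q \<in> {-1, 0, 1}" by auto
  thus ?thesis by (simp add: stretch_def Let_def)
qed

end

text \<open>With \<open>K + e - 1\<close> variables and one in every row, at most
  \<open>e - 1\<close> rows have a second. \<open>Q\<close> and \<open>D\<close> are large enough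
  for the pigeonhole principle to find a free class among 1, ..., \<open>Q - 1\<close> and a free
  column at each end. Halving the product keeps positions near -1 and near \<open>T - 1\<close>
  apart modulo the product.\<close>

locale helix_lb = helix +
  fixes W :: nat
  assumes e2: "2 \<le> e" and W: "int W = K + e - 1" "int W + 1 < Q" "int W < D"
    and cop: "\<And>i j. i \<in> {0..<K} \<Longrightarrow> j \<in> {0..<K} \<Longrightarrow> i \<noteq> j \<Longrightarrow> coprime (q i) (q j)"
    and T_def: "T = (\<Prod>j\<in>{0..<K}. q j) div 2"
begin

definition full :: "(nat \<times> int) set \<Rightarrow> bool" where
  "full X \<longleftrightarrow> finite X \<and> card X \<le> W \<and> (\<forall>i. 0 \<le> i \<longrightarrow> i < K \<longrightarrow> row X i \<noteq> {})"

text \<open>Every row takes one variable of \<open>X\<close>, and every row that is not thin at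
  least one more.\<close>

lemma thick_card:
  assumes "full X"
  shows "card {i\<in>{0..<K}. \<not> thinrow X i} \<le> nat (e - 1)"
proof -
  let ?B = "{i\<in>{0..<K}. \<not> thinrow X i}"
  have fin: "finite X" using assms by (simp add: full_def)
  have finr: "finite (row X i)" for i using fin by (auto simp: row_def)
  have "nat K + card ?B = (\<Sum>i\<in>{0..<K}. 1) + (\<Sum>i\<in>{0..<K}. if \<not> thinrow X i then 1 else 0)"
    using K by (subst sum.inter_filter[symmetric]) simp_all
  also have "\<dots> = (\<Sum>i\<in>{0..<K}. 1 + (if \<not> thinrow X i then 1 else 0))" by (simp only: sum.distrib)
  also have "\<dots> \<le> (\<Sum>i\<in>{0..<K}. card (row X i))"
  proof (rule sum_mono)
    fix i assume i: "i \<in> {0..<K}"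
    hence "row X i \<noteq> {}" using assms by (simp add: full_def)
    hence "card (row X i) \<noteq> 0" using finr by simp
    moreover have "card (row X i) \<noteq> 1" if "\<not> thinrow X i" using that by (auto simp: thinrow_def card_1_singleton_iff)
    ultimately show "1 + (if \<not> thinrow X i then 1 else 0) \<le> card (row X i)" by auto
  qed
  also have "\<dots> = card (\<Union>i\<in>{0..<K}. row X i)"
    by (rule card_UN_disjoint[symmetric]) (use finr in \<open>auto simp: row_def\<close>)
  also have "\<dots> \<le> card X" by (rule card_mono[OF fin]) (auto simp: row_def)
  also have "\<dots> \<le> W" using assms by (simp add: full_def)
  finally show ?thesis using W K e by linarith
qed

lemma rows_card:
  assumes "0 \<le> n" "n < K"
  shows "card ((\<lambda>l. (j - l) mod K) ` {0..<n}) = nat n"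
proof -
  have "inj_on (\<lambda>l. (j - l) mod K) {0..<n}"
  proof (rule inj_onI)
    fix l l' assume l: "l \<in> {0..<n}" "l' \<in> {0..<n}" "(j - l) mod K = (j - l') mod K"
    hence "K dvd (j - l) - (j - l')" by (simp add: mod_eq_dvd_iff)
    hence "K dvd l' - l" by simp
    moreover have "\<bar>l' - l\<bar> < K" using l assms by auto
    ultimately have "l' - l = 0" by (rule small_dvd)
    thus "l = l'" by simp
  qed
  thus ?thesis by (simp add: card_image)
qed

lemma row_uses_row: assumes "0 \<le> l" "l < e" shows "row_uses ((j - l) mod K) j"
proof -
  have "(j - (j - l) mod K) mod K = l mod K" by (simp add: mod_simps)
  moreover have "l mod K = l" using assms e by simp
  ultimately show ?thesis using assms by (simp add: row_uses_def)
qed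

lemma row_uses_row': assumes "0 \<le> l" "l < e - 1" shows "row_uses ((j - l) mod K) ((j + 1) mod K)"
proof -
  have "((j + 1) mod K - (j - l) mod K) mod K = (l + 1) mod K" by (simp add: mod_simps add.commute)
  thus ?thesis using assms e by (simp add: row_uses_def)
qed

text \<open>The modulus \<open>q j\<close> is used by \<open>e\<close> rows, one more than the rows
  that can fail to be thin.\<close>

lemma thin_ex:
  assumes "full X" shows "\<exists>i. 0 \<le> i \<and> i < K \<and> row_uses i j \<and> thinrow X i"
proof (rule ccontr)
  assume n: "\<not> ?thesis"
  have "(\<lambda>l. (j - l) mod K) ` {0..<e} \<subseteq> {i\<in>{0..<K}. \<not> thinrow X i}"
  proof
    fix i assume "i \<in> (\<lambda>l. (j - l) mod K) ` {0..<e}"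
    then obtain l where "i = (j - l) mod K" "0 \<le> l" "l < e" by auto
    moreover from this have "row_uses i j" "0 \<le> i" "i < K" using row_uses_row K by auto
    ultimately show "i \<in> {i\<in>{0..<K}. \<not> thinrow X i}" using n by auto
  qed
  moreover have "finite {i\<in>{0..<K}. \<not> thinrow X i}" by (rule finite_subset[of _ "{0..<K}"]) auto
  ultimately have "nat e \<le> nat (e - 1)"
  proof -
    assume "(\<lambda>l. (j - l) mod K) ` {0..<e} \<subseteq> {i\<in>{0..<K}. \<not> thinrow X i}" "finite {i\<in>{0..<K}. \<not> thinrow X i}"
    from card_mono[OF this(2,1)] show ?thesis using rows_card[of e j] thick_card[OF assms] e by linarith
  qed
  thus False using e by simp
qed

text \<open>Fewer than \<open>e\<close> rows are not thin, and the \<open>e - 1\<close> rows using both \<open>j\<close> and \<open>j + 1\<close> determine \<open>j\<close>.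
  So local agreement of shifts propagates around the cycle of moduli with at most one gap.\<close>

lemma thin_link:
  assumes "full X"
  shows "\<exists>j0. \<forall>j\<in>{0..<K}. j \<noteq> j0 \<longrightarrow> (\<exists>i. 0 \<le> i \<and> i < K \<and> row_uses i j \<and> row_uses i ((j + 1) mod K) \<and> thinrow X i)"
proof -
  define B where "B j = (\<lambda>l. (j - l) mod K) ` {0..<e - 1}" for j
  define Th where "Th = {i\<in>{0..<K}. \<not> thinrow X i}"
  define bad where "bad j \<longleftrightarrow> \<not> (\<exists>i. 0 \<le> i \<and> i < K \<and> row_uses i j \<and> row_uses i ((j + 1) mod K) \<and> thinrow X i)" for j
  have Bth: "B j = Th" if "bad j" for j
  proof (rule card_seteq)
    show "finite Th" by (rule finite_subset[of _ "{0..<K}"]) (auto simp: Th_def)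
    show "B j \<subseteq> Th"
    proof
      fix i assume "i \<in> B j"
      then obtain l where l: "i = (j - l) mod K" "0 \<le> l" "l < e - 1" by (auto simp: B_def)
      hence "row_uses i j" "row_uses i ((j + 1) mod K)" "0 \<le> i" "i < K" using row_uses_row[of l j] row_uses_row'[of l j] K by auto
      thus "i \<in> Th" using that by (auto simp: bad_def Th_def)
    qed
    show "card Th \<le> card (B j)" using thick_card[OF assms] rows_card[of "e - 1" j] e by (simp add: B_def Th_def)
  qed
  \<comment> \<open>\<open>B j\<close> is the cyclic interval of \<open>e - 1\<close> rows ending in
    \<open>j\<close>; its only member with a successor outside is \<open>j\<close>.\<close>
  have uni: "j = u" if j: "0 \<le> j" "j < K" "u \<in> B j" "(u + 1) mod K \<notin> B j" for j u
  proof -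
    obtain l where l: "u = (j - l) mod K" "0 \<le> l" "l < e - 1" using j by (auto simp: B_def)
    have "l = 0"
    proof (rule ccontr)
      assume "l \<noteq> 0"
      hence "(j - (l - 1)) mod K \<in> B j" unfolding B_def using l by (intro imageI) auto
      moreover have "(u + 1) mod K = (j - (l - 1)) mod K" by (simp add: l(1) mod_simps algebra_simps)
      ultimately show False using j by simp
    qed
    thus ?thesis using l j by simp
  qed
  have self: "j \<in> B j" "(j + 1) mod K \<notin> B j" if "0 \<le> j" "j < K" for j
  proof -
    have "(j - 0) mod K \<in> B j" unfolding B_def using e2 by (intro imageI) auto
    thus "j \<in> B j" using that by simp
    show "(j + 1) mod K \<notin> B j"
    proof
      assume "(j + 1) mod K \<in> B j"
      then obtain l where l: "(j + 1) mod K = (j - l) mod K" "0 \<le> l" "l < e - 1" by (auto simp: B_def)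
      hence "K dvd (j + 1) - (j - l)" by (simp add: mod_eq_dvd_iff)
      hence "K dvd l + 1" by (simp add: add.commute)
      thus False using zdvd_imp_le[of K "l + 1"] l e by auto
    qed
  qed
  have "j = j'" if "bad j" "bad j'" "j \<in> {0..<K}" "j' \<in> {0..<K}" for j j'
    using uni[of j' j] self[of j] Bth[OF that(1)] Bth[OF that(2)] that by auto
  hence "\<exists>j0. \<forall>j\<in>{0..<K}. bad j \<longrightarrow> j = j0" by blast
  thus ?thesis unfolding bad_def by blast
qed

text \<open>A cycle stays connected when one edge is removed; the chain of equalities starts just
  after the gap.\<close>

lemma cyc_const:
  fixes g :: "int \<Rightarrow> 'b"
  assumes g: "\<And>j. 0 \<le> j \<Longrightarrow> j < K \<Longrightarrow> j \<noteq> j0 \<Longrightarrow> g j = g ((j + 1) mod K)"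
    and j: "0 \<le> j" "j < K" "0 \<le> j'" "j' < K"
  shows "g j = g j'"
proof -
  obtain j1 where j1: "0 \<le> j1" "j1 < K" "\<And>j. 0 \<le> j \<Longrightarrow> j < K \<Longrightarrow> j \<noteq> j1 \<Longrightarrow> g j = g ((j + 1) mod K)"
  proof (cases "0 \<le> j0 \<and> j0 < K")
    case True thus ?thesis using that[of j0] g by blast
  next
    case False
    hence *: "g j = g ((j + 1) mod K)" if "0 \<le> j" "j < K" for j using g[OF that] that by blast
    have "0 < K" using K by simp
    show ?thesis by (rule that[OF order_refl \<open>0 < K\<close>]) (rule *)
  qed
  have *: "g ((j1 + 1 + l) mod K) = g ((j1 + 1) mod K)" if "0 \<le> l" "l < K" for l
    using that
  proof (induction l rule: int_ge_induct)
    case base then show ?case by simp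
  next
    case (step l)
    let ?j = "(j1 + 1 + l) mod K"
    have "?j \<noteq> j1"
    proof
      assume "?j = j1"
      hence "(j1 + 1 + l) mod K = j1 mod K" using j1 by simp
      hence "K dvd (j1 + 1 + l) - j1" by (simp only: mod_eq_dvd_iff)
      hence "K dvd l + 1" by (simp add: add.commute)
      thus False using zdvd_imp_le[of K "l + 1"] step by auto
    qed
    hence "g ?j = g ((?j + 1) mod K)" using j1(3)[of ?j] K by auto
    moreover have "(?j + 1) mod K = (j1 + 1 + (l + 1)) mod K" by (simp add: mod_simps add.assoc)
    ultimately show ?case using step by simp
  qed
  have **: "g j = g ((j1 + 1) mod K)" if "0 \<le> j" "j < K" for j
  proof -
    have "(j1 + 1 + (j - j1 - 1) mod K) mod K = j" using that by (simp add: mod_simps)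
    thus ?thesis using *[of "(j - j1 - 1) mod K"] K by (metis pos_mod_bound pos_mod_sign order_less_le_trans zero_less_numeral)
  qed
  show ?thesis using **[OF j(1,2)] **[OF j(3,4)] by simp
qed

text \<open>In a thin row both positions are stretches of the same variable for two classes, so they
  differ by -1, 0 or 1 modulo all \<open>q j\<close> of the row. As \<open>q j\<close> is at least
  3, each modulus sees only one of these shifts. By \<open>thin_link\<close> all moduli see the same
  shift, and coprimality combines them.\<close>

lemma Pos_unique:
  assumes X: "full X" and p: "Pos X r" "Pos X r'"
  shows "\<exists>u\<in>{-1,0,1}. [r - r' = u] (mod PP)"
proof -
  obtain c c' where c: "0 < c" "c < Q" "Posc c X r" and c': "0 < c'" "c' < Q" "Posc c' X r'"
    using p by (auto simp: Pos_def)
  have ex: "\<exists>u\<in>{-1,0,1}. \<forall>j\<in>{0..<K}. row_uses i j \<longrightarrow> [r - r' = u] (mod q j)" if i: "0 \<le> i" "i < K" "thinrow X i" for i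
  proof -
    obtain a where a: "row X i = {a}" using i by (auto simp: thinrow_def)
    have "[r - r' = stretch c (snd a) - stretch c' (snd a)] (mod q j)" if "j \<in> {0..<K}" "row_uses i j" for j
    proof -
      have "[stretch c (snd a) = r] (mod q j)" "[stretch c' (snd a) = r'] (mod q j)"
        using c(3) c'(3) a i that unfolding Posc_def by (metis atLeastLessThan_iff)+
      thus ?thesis by (metis cong_diff cong_sym)
    qed
    thus ?thesis using stretch_diff[OF c(1,2) c'(1,2), of "snd a"] by blast
  qed
  have uq: "u = u'" if "u \<in> {-1,0,1}" "u' \<in> {-1,0,1}" "[r - r' = u] (mod q j)" "[r - r' = u'] (mod q j)" for u u' j
  proof -
    have "[u = u'] (mod q j)" using that(3,4) cong_trans cong_sym by blast
    hence "q j dvd u - u'" by (simp add: cong_iff_dvd_diff)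
    moreover have "\<bar>u - u'\<bar> < q j" using that(1,2) q_ge[of j] by auto
    ultimately have "u - u' = 0" by (rule small_dvd)
    thus ?thesis by simp
  qed
  define g where "g j = (THE u. u \<in> {-1,0,1} \<and> [r - r' = u] (mod q j))" for j
  have geq: "g j = u" if "u \<in> {-1,0,1}" "[r - r' = u] (mod q j)" for j u
    unfolding g_def using that uq by (intro the_equality) blast+
  obtain j0 where j0: "\<forall>j\<in>{0..<K}. j \<noteq> j0 \<longrightarrow> (\<exists>i. 0 \<le> i \<and> i < K \<and> row_uses i j \<and> row_uses i ((j + 1) mod K) \<and> thinrow X i)"
    using thin_link[OF X] by blast
  have "g j = g ((j + 1) mod K)" if j: "0 \<le> j" "j < K" "j \<noteq> j0" for j
  proof -
    obtain i where i: "0 \<le> i" "i < K" "row_uses i j" "row_uses i ((j + 1) mod K)" "thinrow X i" using j0 j by auto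
    obtain u where u: "u\<in>{-1,0,1}" "\<forall>j\<in>{0..<K}. row_uses i j \<longrightarrow> [r - r' = u] (mod q j)" using ex i by blast
    have "(j + 1) mod K \<in> {0..<K}" using K by auto
    hence "[r - r' = u] (mod q j)" "[r - r' = u] (mod q ((j + 1) mod K))" using u(2) i j by auto
    thus ?thesis using geq u(1) by metis
  qed
  hence const: "g j = g 0" if "0 \<le> j" "j < K" for j using cyc_const[of j0 g j 0] that K by auto
  have gj: "g j \<in> {-1,0,1} \<and> [r - r' = g j] (mod q j)" if j: "j \<in> {0..<K}" for j
  proof -
    obtain i where "0 \<le> i" "i < K" "row_uses i j" "thinrow X i" using thin_ex[OF X] by blast
    then obtain u where u: "u\<in>{-1,0,1}" "[r - r' = u] (mod q j)" using ex j by blast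
    thus ?thesis using geq by metis
  qed
  have "PP dvd (r - r') - g 0"
    unfolding PP_def
  proof (rule prod_dvd_coprime)
    show "coprime (q i) (q j)" if "i \<in> {0..<K}" "j \<in> {0..<K}" "i \<noteq> j" for i j using cop that by blast
    show "q j dvd r - r' - g 0" if "j \<in> {0..<K}" for j
      using gj[OF that] const[of j] that by (simp add: cong_iff_dvd_diff)
  qed simp
  hence "[r - r' = g 0] (mod PP)" by (simp only: cong_iff_dvd_diff)
  moreover have "g 0 \<in> {-1,0,1}" using gj[of 0] K by simp
  ultimately show ?thesis by blast
qed

section \<open>Sides of a cut\<close>

lemma ex_free:
  assumes "finite X" "card X \<le> W"
  shows "\<exists>c. 0 < c \<and> c < Q \<and> free c X"
proof -
  let ?g = "\<lambda>a::nat \<times> int. snd a div K mod Q"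
  have "card (?g ` X) < card {1..<Q}"
    using card_image_le[OF assms(1), of ?g] assms(2) W(2) by simp
  hence "\<not> {1..<Q} \<subseteq> ?g ` X" using card_mono[of "?g ` X" "{1..<Q}"] assms(1) by auto
  then obtain c where "c \<in> {1..<Q}" "c \<notin> ?g ` X" by blast
  thus ?thesis by (intro exI[of _ c]) (auto simp: free_def)
qed

lemma ex_colfree:
  assumes "finite X" "card X \<le> W"
  shows "\<exists>d. b \<le> d \<and> d < b + D \<and> colfree d X"
proof -
  let ?g = "\<lambda>a::nat \<times> int. snd a div K"
  have "card (?g ` X) < card {b..<b + D}"
    using card_image_le[OF assms(1), of ?g] assms(2) W(3) by simp
  hence "\<not> {b..<b + D} \<subseteq> ?g ` X" using card_mono[of "?g ` X" "{b..<b + D}"] assms(1) by auto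
  then obtain c where "c \<in> {b..<b + D}" "c \<notin> ?g ` X" by blast
  thus ?thesis by (intro exI[of _ c]) (auto simp: colfree_def)
qed

definition startc :: "int \<Rightarrow> bool" where "startc d \<longleftrightarrow> - D \<le> d \<and> d < 0"
definition endc :: "int \<Rightarrow> bool" where "endc d \<longleftrightarrow> Q * T \<le> d \<and> d < Q * T + D"

lemma fin_bd: "finite (boundary y)"
proof -
  have "boundary y \<subseteq> {0,1,2} \<times> (rep R ` {lo..<hi} \<union> rep S ` {lo..<hi})"
  proof
    fix a assume a: "a \<in> boundary y"
    have "\<exists>t\<in>A. rep f t = r" if "cfs A f p r \<noteq> 0" for A f p r
      using that unfolding cfs_def by (metis (mono_tags, lifting) sum.neutral mem_Collect_eq)
    hence *: "r \<in> rep f ` A" if "cfs A f p r = 1" for A f p r using that by fastforce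
    have sub: "{lo + K..<hi} \<subseteq> {lo..<hi}" "{lo + 1..<hi} \<subseteq> {lo..<hi}" using K by auto
    have "fst a = 0 \<and> cfs {lo + K..<hi} R (dH y) (snd a) = 1 \<or> fst a = 1 \<and> cfs {lo..<hi} R (dU y) (snd a) = 1
      \<or> fst a = 2 \<and> cfs {lo + 1..<hi} S (dV y) (snd a) = 1"
      using a by (auto simp: boundary_def bcoeff_def split: if_splits)
    hence "fst a \<in> {0,1,2} \<and> snd a \<in> rep R ` {lo..<hi} \<union> rep S ` {lo..<hi}"
      using * sub by blast
    thus "a \<in> {0,1,2} \<times> (rep R ` {lo..<hi} \<union> rep S ` {lo..<hi})" by (cases a) auto
  qed
  thus ?thesis by (rule finite_subset) simp
qed

lemma full_bd:
  assumes X: "boundary y \<subseteq> X" "finite X" "card X \<le> W" and d: "startc d" "endc f" "colfree d X" "colfree f X"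
    and n: "y False (d * K) \<noteq> y False (f * K)" and i: "0 \<le> i" "i < K"
  shows "row (boundary y) i \<noteq> {}"
proof -
  obtain c where c: "0 < c" "c < Q" "free c X" using ex_free[OF X(2,3)] by blast
  have "y False (d * K + i) = y False (d * K)" "y False (f * K + i) = y False (f * K)"
    using col_uniform[OF X(1) d(3) _ i] col_uniform[OF X(1) d(4) _ i] d by (auto simp: startc_def endc_def)
  thus ?thesis using row_odd[OF X(1) c(3,1,2) i, of d f] d n by (auto simp: startc_def endc_def)
qed

text \<open>For each \<open>j\<close> some row using it is thin, and by \<open>thin_cong\<close> its
  residue does not depend on the choice of the row. The Chinese remainder theorem turns the residues
  into one position.\<close>

lemma Pos_exists:
  assumes X: "boundary y \<subseteq> X" "finite X" "card X \<le> W" and d: "startc d" "endc f" "colfree d X" "colfree f X"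
    and n: "y False (d * K) \<noteq> y False (f * K)"
  shows "full X" "\<exists>r. Pos X r"
proof -
  show full: "full X"
    unfolding full_def
  proof (intro conjI allI impI)
    fix i assume "0 \<le> i" "i < K"
    hence "row (boundary y) i \<noteq> {}" using full_bd[OF X d n] by blast
    thus "row X i \<noteq> {}" using X(1) by (auto simp: row_def)
  qed (use X in auto)
  obtain c where c: "0 < c" "c < Q" "free c X" using ex_free[OF X(2,3)] by blast
  have dd: "- D \<le> d" "d < 0" "Q * T \<le> f" "f < Q * T + D" using d by (auto simp: startc_def endc_def)
  have u: "y False (d * K + i) = y False (d * K)" "y False (f * K + i) = y False (f * K)" if "0 \<le> i" "i < K" for i
    using col_uniform[OF X(1) d(3) _ that] col_uniform[OF X(1) d(4) _ that] dd by auto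
  have "\<exists>i a. 0 \<le> i \<and> i < K \<and> row_uses i j \<and> row X i = {a}" for j
    using thin_ex[OF full, of j] by (auto simp: thinrow_def)
  then obtain ii aa where ia: "\<And>j. 0 \<le> ii j \<and> ii j < K \<and> row_uses (ii j) j \<and> row X (ii j) = {aa j}" by metis
  obtain r where r: "\<forall>j\<in>{0..<K}. [stretch c (snd (aa j)) = r] (mod q j)"
    using crt_int[of "{0..<K}" q "\<lambda>j. stretch c (snd (aa j))"] cop q_pos by auto
  have "Posc c X r"
    unfolding Posc_def
  proof (intro ballI allI impI)
    fix i a j assume i: "i \<in> {0..<K}" "row X i = {a}" "j \<in> {0..<K}" "row_uses i j"
    have "[stretch c (snd a) = stretch c (snd (aa j))] (mod q j)"
      using thin_cong[OF X(1) c(3,1,2) _ _ i(4) _ _ _ i(3) dd u n i(2), of "ii j" "aa j"] ia[of j] i(1) by simp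
    thus "[stretch c (snd a) = r] (mod q j)" using r i(3) cong_trans by blast
  qed
  thus "\<exists>r. Pos X r" using c by (auto simp: Pos_def)
qed

text \<open>Outside the compressed columns a row is an honest path, so a change of coefficient
  between two columns must cross the boundary there.\<close>

lemma col_change:
  assumes dd: "d \<le> d'" "- D \<le> d \<and> d' < 0 \<or> Q * T \<le> d \<and> d' < Q * T + D"
    and n: "y False (d * K + i) \<noteq> y False (d' * K + i)" and i: "0 \<le> i" "i < K"
  shows "\<exists>a\<in>row (boundary y) i. d \<le> snd a div K \<and> snd a div K \<le> d'"
proof (rule ccontr)
  assume nn: "\<not> ?thesis"
  have QT: "0 \<le> Q * T" using Q T by simp
  have out: "\<not> (0 \<le> x * K + i \<and> x * K + i < Q * T * K)" if "d \<le> x" "x \<le> d'" for x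
  proof
    assume "0 \<le> x * K + i \<and> x * K + i < Q * T * K"
    hence "0 \<le> (x * K + i) div K" "(x * K + i) div K < Q * T"
      using K zdiv_less_iff[of K "x * K + i" "Q * T"] pos_imp_zdiv_nonneg_iff[of K "x * K + i"] by linarith+
    moreover have "(x * K + i) div K = x" using i by simp
    ultimately show False using dd that by linarith
  qed
  have z: "bcoeff y (k, x * K + i) = 0" if "d \<le> x" "x \<le> d'" "k < 2" for k x
  proof (rule ccontr)
    assume "bcoeff y (k, x * K + i) \<noteq> 0"
    hence "(k, x * K + i) \<in> row (boundary y) i" using that i by (simp add: row_def boundary_def)
    moreover have "(x * K + i) div K = x" using i by simp
    ultimately show False using nn that by force
  qed
  have "y False (x * K + i) + y False ((x + 1) * K + i) = 0" if "d \<le> x" "x < d'" for x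
  proof -
    have r: "lo \<le> x * K + i" "x * K + i < hi" "lo \<le> (x + 1) * K + i" "(x + 1) * K + i < hi"
      using in_range[of x i] in_range[of "x + 1" i] that dd i QT D by auto
    have "bcoeff y (1, x * K + i) = dU y (x * K + i)"
      unfolding bcoeff_U by (rule cfs_out[OF out _ R_pos]) (use that r in auto)
    moreover have "bcoeff y (0, (x + 1) * K + i) = dH y ((x + 1) * K + i)"
      unfolding bcoeff_H by (rule cfs_out[OF out _ R_pos]) (use that r in \<open>auto simp: algebra_simps\<close>)
    ultimately show ?thesis using z[of x 1] z[of "x + 1" 0] that stretch_step[of y x i] by simp
  qed
  hence "(\<Sum>x\<in>{d..<d'}. y False (x * K + i) + y False ((x + 1) * K + i)) = 0" by (intro sum.neutral) auto
  thus False using telescope_bit[OF dd(1), of "\<lambda>x. y False (x * K + i)"] n by (simp add: bit_add_eq_0_iff)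
qed

lemma start_change:
  assumes d: "startc d" "startc d'" "colfree d (boundary y)" "colfree d' (boundary y)" and n: "y False (d * K) \<noteq> y False (d' * K)"
    and i: "0 \<le> i" "i < K"
  shows "\<exists>a\<in>row (boundary y) i. snd a div K < 0"
proof -
  have u: "y False (d * K + i) = y False (d * K)" "y False (d' * K + i) = y False (d' * K)"
    using col_uniform[OF subset_refl d(3) _ i] col_uniform[OF subset_refl d(4) _ i] d by (auto simp: startc_def)
  show ?thesis
  proof (cases "d \<le> d'")
    case True
    have "\<exists>a\<in>row (boundary y) i. d \<le> snd a div K \<and> snd a div K \<le> d'"
      by (rule col_change[OF True _ _ i]) (use n u d in \<open>auto simp: startc_def\<close>)
    thus ?thesis using d by (force simp: startc_def)
  next
    case False
    have "\<exists>a\<in>row (boundary y) i. d' \<le> snd a div K \<and> snd a div K \<le> d"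
      by (rule col_change[OF _ _ _ i]) (use n u d False in \<open>auto simp: startc_def\<close>)
    thus ?thesis using d by (force simp: startc_def)
  qed
qed

lemma end_change:
  assumes d: "endc d" "endc d'" "colfree d (boundary y)" "colfree d' (boundary y)" and n: "y False (d * K) \<noteq> y False (d' * K)"
    and i: "0 \<le> i" "i < K"
  shows "\<exists>a\<in>row (boundary y) i. Q * T \<le> snd a div K"
proof -
  have u: "y False (d * K + i) = y False (d * K)" "y False (d' * K + i) = y False (d' * K)"
    using col_uniform[OF subset_refl d(3) _ i] col_uniform[OF subset_refl d(4) _ i] d by (auto simp: endc_def)
  show ?thesis
  proof (cases "d \<le> d'")
    case True
    have "\<exists>a\<in>row (boundary y) i. d \<le> snd a div K \<and> snd a div K \<le> d'"
      by (rule col_change[OF True _ _ i]) (use n u d in \<open>auto simp: endc_def\<close>)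
    thus ?thesis using d by (force simp: endc_def)
  next
    case False
    have "\<exists>a\<in>row (boundary y) i. d' \<le> snd a div K \<and> snd a div K \<le> d"
      by (rule col_change[OF _ _ _ i]) (use n u d False in \<open>auto simp: endc_def\<close>)
    thus ?thesis using d by (force simp: endc_def)
  qed
qed

text \<open>In a thin row the only variable is then in a negative column, where
  \<open>stretch\<close> is -1.\<close>

lemma Pos_start:
  assumes "\<And>i. 0 \<le> i \<Longrightarrow> i < K \<Longrightarrow> \<exists>a\<in>row X i. snd a div K < 0" shows "Pos X (-1)"
proof -
  have "stretch 1 (snd a) = -1" if "row X i = {a}" "0 \<le> i" "i < K" for i a
    using assms[OF that(2,3)] that(1) by (simp add: stretch_def)
  hence "Posc 1 X (-1)" by (simp add: Posc_def)
  thus ?thesis using Q by (auto simp: Pos_def intro!: exI[of _ 1])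
qed

lemma Pos_end:
  assumes "\<And>i. 0 \<le> i \<Longrightarrow> i < K \<Longrightarrow> \<exists>a\<in>row X i. Q * T \<le> snd a div K" shows "Pos X (T - 1)"
proof -
  have QT: "0 \<le> Q * T" using Q T by simp
  have "stretch 1 (snd a) = T - 1" if "row X i = {a}" "0 \<le> i" "i < K" for i a
    using assms[OF that(2,3)] that(1) QT by (auto simp: stretch_def Let_def)
  hence "Posc 1 X (T - 1)" by (simp add: Posc_def)
  thus ?thesis using Q by (auto simp: Pos_def intro!: exI[of _ 1])
qed

text \<open>A thin row cannot have a variable at each end.\<close>

lemma not_both:
  assumes X: "finite X" "card X \<le> W"
    and s: "\<And>i. 0 \<le> i \<Longrightarrow> i < K \<Longrightarrow> \<exists>a\<in>row X i. snd a div K < 0"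
    and t: "\<And>i. 0 \<le> i \<Longrightarrow> i < K \<Longrightarrow> \<exists>a\<in>row X i. Q * T \<le> snd a div K"
  shows False
proof -
  have QT: "0 \<le> Q * T" using Q T by simp
  have "full X" using X s by (auto simp: full_def)
  then obtain i a where i: "0 \<le> i" "i < K" "row X i = {a}" using thin_ex[of X 0] by (auto simp: thinrow_def)
  thus False using s[OF i(1,2)] t[OF i(1,2)] QT by auto
qed

text \<open>By \<open>Pos_unique\<close> the difference of the positions is -1, 0 or 1 modulo
  \<open>PP\<close>. It is in fact close to \<open>- T\<close>, hence too large for these, and too
  small to wrap around because \<open>2 * T \<le> PP\<close>.\<close>

lemma Pos_sep:
  assumes X: "full X" and p: "Pos X r" "Pos X r'" and B: "\<bar>r + 1\<bar> \<le> B" "\<bar>r' + 1 - T\<bar> \<le> B" "2 * B + 1 < T"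
  shows False
proof -
  obtain u where u: "u \<in> {-1,0,1}" "[r - r' = u] (mod PP)" using Pos_unique[OF X p] by blast
  have "PP dvd (r - r') - u" using u(2) by (simp only: cong_iff_dvd_diff)
  moreover have "2 * T \<le> PP" using T_def by (simp add: PP_def)
  hence "\<bar>(r - r') - u\<bar> < PP" using B u(1) by auto
  ultimately have "(r - r') - u = 0" by (rule small_dvd)
  thus False using B u(1) by auto
qed

text \<open>The commitment: a sum containing the left end has its cut near -1, one containing the
  right end near \<open>T - 1\<close>, and none contains both. \<open>B\<close> is the distance that
  the cut may have moved.\<close>

definition side :: "int \<Rightarrow> (bool \<Rightarrow> int \<Rightarrow> bit) \<Rightarrow> int \<Rightarrow> int \<Rightarrow> bool" where
  "side B y d f \<longleftrightarrow> (y False (d * K) = 0 \<and> y False (f * K) = 0)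
     \<or> (y False (d * K) = 1 \<and> y False (f * K) = 0 \<and> (\<exists>r. \<bar>r + 1\<bar> \<le> B \<and> Pos (boundary y) r))
     \<or> (y False (d * K) = 0 \<and> y False (f * K) = 1 \<and> (\<exists>r. \<bar>r + 1 - T\<bar> \<le> B \<and> Pos (boundary y) r))"

definition good :: "int \<Rightarrow> (bool \<Rightarrow> int \<Rightarrow> bit) \<Rightarrow> bool" where
  "good B y \<longleftrightarrow> card (boundary y) \<le> W \<and>
     (\<forall>d f. startc d \<longrightarrow> endc f \<longrightarrow> colfree d (boundary y) \<longrightarrow> colfree f (boundary y) \<longrightarrow> side B y d f)"

lemma side_mono: "side B y d f \<Longrightarrow> B \<le> B' \<Longrightarrow> side B' y d f"
proof -
  assume s: "side B y d f" and B: "B \<le> B'"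
  have "\<bar>x\<bar> \<le> B \<Longrightarrow> \<bar>x\<bar> \<le> B'" for x :: int using B by simp
  thus ?thesis using s unfolding side_def by blast
qed

lemma good_mono: "good B y \<Longrightarrow> B \<le> B' \<Longrightarrow> good B' y"
  unfolding good_def using side_mono by blast

text \<open>The coefficients in two free start columns differ only if every row has a boundary
  variable at the start, and then -1 is a position, which every \<open>B\<close> allows; likewise at
  the end. So one pair of free columns decides.\<close>

lemma good_of_side:
  assumes c: "card (boundary y) \<le> W" and d: "startc d" "endc f" "colfree d (boundary y)" "colfree f (boundary y)" and s: "side B y d f"
    and B: "0 \<le> B" "2 * B + 1 < T"
  shows "good B y"
  unfolding good_def
proof (intro conjI allI impI c)
  fix d' f' assume d': "startc d'" "endc f'" "colfree d' (boundary y)" "colfree f' (boundary y)"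
  let ?s = "y False (d * K)" and ?t = "y False (f * K)" and ?s' = "y False (d' * K)" and ?t' = "y False (f' * K)"
  have sc: "Pos (boundary y) (-1)" if "?s \<noteq> ?s'" using Pos_start start_change[OF d(1) d'(1) d(3) d'(3) that] by blast
  have ec: "Pos (boundary y) (T - 1)" if "?t \<noteq> ?t'" using Pos_end end_change[OF d(2) d'(2) d(4) d'(4) that] by blast
  have nb: "?s = ?s' \<or> ?t = ?t'"
    using not_both[OF fin_bd c] start_change[OF d(1) d'(1) d(3) d'(3)] end_change[OF d(2) d'(2) d(4) d'(4)] by blast
  have fl: "full (boundary y)" if "?s \<noteq> ?t" by (rule Pos_exists(1)[OF subset_refl fin_bd c d that])
  have l: "\<exists>r. \<bar>r + 1\<bar> \<le> B \<and> Pos (boundary y) r" if "?s \<noteq> ?s'" using sc[OF that] B by (intro exI[of _ "-1"]) auto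
  have r: "\<exists>r. \<bar>r + 1 - T\<bar> \<le> B \<and> Pos (boundary y) r" if "?t \<noteq> ?t'" using ec[OF that] B by (intro exI[of _ "T - 1"]) auto
  have sep: False if "?s \<noteq> ?t" "\<exists>r. \<bar>r + 1\<bar> \<le> B \<and> Pos (boundary y) r" "\<exists>r. \<bar>r + 1 - T\<bar> \<le> B \<and> Pos (boundary y) r"
    using Pos_sep[OF fl[OF that(1)]] that(2,3) B by blast
  show "side B y d' f'"
    using s nb l r sep unfolding side_def by (cases ?s; cases ?t; cases ?s'; cases ?t'; force)
qed

abbreviation addy :: "(bool \<Rightarrow> int \<Rightarrow> bit) \<Rightarrow> (bool \<Rightarrow> int \<Rightarrow> bit) \<Rightarrow> bool \<Rightarrow> int \<Rightarrow> bit" where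
  "addy y z \<equiv> \<lambda>b t. y b t + z b t"

lemma bcoeff_add: "bcoeff (addy y z) a = bcoeff y a + bcoeff z a"
proof -
  have "dH (addy y z) t = dH y t + dH z t" "dU (addy y z) t = dU y t + dU z t" "dV (addy y z) t = dV y t + dV z t" for t
    by (simp_all add: dH_def dU_def dV_def ac_simps)
  thus ?thesis by (simp add: bcoeff_def cfs_def sum.distrib)
qed

lemma boundary_add: "boundary (addy y z) = (boundary y - boundary z) \<union> (boundary z - boundary y)"
proof -
  have "u + v = 1 \<longleftrightarrow> (u = 1) \<noteq> (v = 1)" for u v :: bit by (cases u; cases v) auto
  thus ?thesis by (auto simp: boundary_def bcoeff_add)
qed

text \<open>Positions of a summand and of the sum are both positions of the union, so they differ by
  at most one. The sum could contain both ends only if the summands contain opposite ends, which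
  \<open>Pos_sep\<close> excludes in the union.\<close>

lemma good_add:
  assumes g: "good B y" "good B z" and c: "card (boundary y \<union> boundary z) \<le> W" and B: "0 \<le> B" "2 * B + 3 < T"
  shows "good (B + 1) (addy y z)"
proof -
  let ?X = "boundary y \<union> boundary z" and ?w = "addy y z"
  have fX: "finite ?X" using fin_bd by simp
  have sub: "boundary ?w \<subseteq> ?X" "boundary y \<subseteq> ?X" "boundary z \<subseteq> ?X" by (auto simp: boundary_add)
  obtain d where d: "startc d" "colfree d ?X" using ex_colfree[OF fX c, of "- D"] by (auto simp: startc_def)
  obtain f where f: "endc f" "colfree f ?X" using ex_colfree[OF fX c, of "Q * T"] by (auto simp: endc_def)
  have cm: "colfree d A" "colfree f A" if "A \<subseteq> ?X" for A using d f that by (auto simp: colfree_def)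
  have cw: "card (boundary ?w) \<le> W" using card_mono[OF fX sub(1)] c by simp
  let ?s = "\<lambda>y. y False (d * K)" and ?t = "\<lambda>y. y False (f * K)"
  have sy: "side B y d f" "side B z d f" using g d f cm sub by (auto simp: good_def)
  have up: "Pos ?X r" if "Pos (boundary x) r" "boundary x \<subseteq> ?X" "?s x \<noteq> ?t x" for x r
    by (rule Pos_antimono[OF that(1,2)]) (rule full_bd[OF that(2) fX c d(1) f(1) d(2) f(2) that(3)])
  have fl: "full ?X" if "boundary x \<subseteq> ?X" "?s x \<noteq> ?t x" for x
    by (rule Pos_exists(1)[OF that(1) fX c d(1) f(1) d(2) f(2) that(2)])
  have ex: "\<exists>r. Pos (boundary ?w) r" if "?s ?w \<noteq> ?t ?w"
    by (rule Pos_exists(2)[OF subset_refl fin_bd cw d(1) f(1) cm[OF sub(1)] that])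
  have tr: "\<exists>r. \<bar>r - m\<bar> \<le> B + 1 \<and> Pos (boundary ?w) r"
    if h: "\<bar>r - m\<bar> \<le> B" "Pos (boundary x) r" "boundary x \<subseteq> ?X" "?s x \<noteq> ?t x" "?s ?w \<noteq> ?t ?w" for r m x
  proof -
    obtain r0 where r0: "Pos (boundary ?w) r0" using ex[OF h(5)] by blast
    obtain u where u: "u \<in> {-1,0,1}" "[r0 - r = u] (mod PP)"
      using Pos_unique[OF fl[OF h(3,4)] up[OF r0 sub(1) h(5)] up[OF h(2,3,4)]] by blast
    have "[r0 = r + u] (mod PP)" using u(2) by (simp add: cong_iff_dvd_diff algebra_simps)
    hence "Pos (boundary ?w) (r + u)" using Pos_periodic[OF r0] by simp
    moreover have "\<bar>(r + u) - m\<bar> \<le> B + 1" using h(1) u(1) by auto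
    ultimately show ?thesis by blast
  qed
  have trl: "\<exists>r. \<bar>r + 1\<bar> \<le> B + 1 \<and> Pos (boundary ?w) r" if h: "\<exists>r. \<bar>r + 1\<bar> \<le> B \<and> Pos (boundary x) r" "boundary x \<subseteq> ?X" "?s x \<noteq> ?t x" "?s ?w \<noteq> ?t ?w" for x
  proof -
    obtain r where r: "\<bar>r + 1\<bar> \<le> B" "Pos (boundary x) r" using h(1) by blast
    have "\<bar>r - (-1)\<bar> \<le> B" using r(1) by simp
    from tr[OF this r(2) h(2,3,4)] show ?thesis by simp
  qed
  have trr: "\<exists>r. \<bar>r + 1 - T\<bar> \<le> B + 1 \<and> Pos (boundary ?w) r" if h: "\<exists>r. \<bar>r + 1 - T\<bar> \<le> B \<and> Pos (boundary x) r" "boundary x \<subseteq> ?X" "?s x \<noteq> ?t x" "?s ?w \<noteq> ?t ?w" for x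
  proof -
    obtain r where r: "\<bar>r + 1 - T\<bar> \<le> B" "Pos (boundary x) r" using h(1) by blast
    have "\<bar>r - (T - 1)\<bar> \<le> B" using r(1) by (simp add: algebra_simps)
    from tr[OF this r(2) h(2,3,4)] show ?thesis by (simp add: algebra_simps)
  qed
  have sep: False if h: "\<exists>r. \<bar>r + 1\<bar> \<le> B \<and> Pos (boundary x) r" "\<exists>r. \<bar>r + 1 - T\<bar> \<le> B \<and> Pos (boundary x') r" "boundary x \<subseteq> ?X" "boundary x' \<subseteq> ?X"
      "?s x \<noteq> ?t x" "?s x' \<noteq> ?t x'" for x x'
  proof -
    obtain r r' where r: "\<bar>r + 1\<bar> \<le> B" "Pos (boundary x) r" "\<bar>r' + 1 - T\<bar> \<le> B" "Pos (boundary x') r'" using h(1,2) by blast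
    have "2 * B + 1 < T" using B by simp
    from Pos_sep[OF fl[OF h(3,5)] up[OF r(2) h(3,5)] up[OF r(4) h(4,6)] r(1,3) this] show False .
  qed
  have "side (B + 1) ?w d f"
    unfolding side_def[of "B + 1"]
    using sy[unfolded side_def] trl[OF _ sub(2)] trl[OF _ sub(3)] trr[OF _ sub(2)] trr[OF _ sub(3)]
      sep[OF _ _ sub(2,3)] sep[OF _ _ sub(3,2)]
    by (cases "?s y"; cases "?t y"; cases "?s z"; cases "?t z"; force)
  thus ?thesis
    by (rule good_of_side[OF cw d(1) f(1) cm[OF sub(1)]]) (use B in auto)
qed

end

section \<open>The commitment family\<close>

context helix begin

definition inc :: "bool \<times> int \<Rightarrow> (nat \<times> int) set" where
  "inc s = (let t = snd s in insert (uvar t)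
     (if fst s then (if t + K < hi then {hvar (t + K)} else {}) \<union> (if t + 1 < hi then {vvar (t + 1)} else {})
      else (if lo + K \<le> t then {hvar t} else {}) \<union> (if lo + 1 \<le> t then {vvar t} else {})))"

definition single_site :: "bool \<times> int \<Rightarrow> bool \<Rightarrow> int \<Rightarrow> bit" where "single_site s b t = (if (b, t) = s then 1 else 0)"

definition axioms_xor :: "((nat \<times> int) set \<times> bit) set" where
  "axioms_xor = {(inc s, if s = (False, lo) then 1 else 0) | s. lo \<le> snd s \<and> snd s < hi}"

lemma cfs_delta: "finite A \<Longrightarrow> cfs A f (\<lambda>t. if t = u then 1 else 0) r = (if u \<in> A \<and> rep f u = r then 1 else 0)"
  by (simp add: cfs_def)

text \<open>The edges at one site are of different kinds, so the identification cannot make two of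
  them cancel.\<close>

lemma boundary_site:
  assumes "lo \<le> snd s" "snd s < hi"
  shows "boundary (single_site s) = inc s"
proof (rule set_eqI)
  fix a :: "nat \<times> int"
  obtain b t where s: "s = (b, t)" by (cases s)
  have U: "dU (single_site s) = (\<lambda>u. if u = t then 1 else 0)" by (cases b) (auto simp: dU_def single_site_def s)
  have H: "dH (single_site s) = (\<lambda>u. if u = (if b then t + K else t) then 1 else 0)" using K by (cases b) (auto simp: dH_def single_site_def s)
  have V: "dV (single_site s) = (\<lambda>u. if u = (if b then t + 1 else t) then 1 else 0)" by (cases b) (auto simp: dV_def single_site_def s)
  have lt: "t < hi" "lo \<le> t" using assms s by auto
  have "bcoeff (single_site s) a = 1 \<longleftrightarrow> a \<in> inc s"
    unfolding bcoeff_def U H V using lt K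
    by (cases a; cases b) (auto simp: cfs_delta inc_def s uvar_def hvar_def vvar_def)
  thus "a \<in> boundary (single_site s) \<longleftrightarrow> a \<in> inc s" by (simp add: boundary_def)
qed

lemma finite_inc: "finite (inc s)" and card_inc: "card (inc s) \<le> 3"
proof -
  show "finite (inc s)" by (simp add: inc_def Let_def)
  have "inc s \<subseteq> {uvar (snd s), hvar (if fst s then snd s + K else snd s), vvar (if fst s then snd s + 1 else snd s)}"
    by (auto simp: inc_def Let_def split: if_splits)
  hence "card (inc s) \<le> card {uvar (snd s), hvar (if fst s then snd s + K else snd s), vvar (if fst s then snd s + 1 else snd s)}"
    by (intro card_mono) auto
  also have "\<dots> \<le> 3" by (simp add: card_insert_if)
  finally show "card (inc s) \<le> 3" .
qed

end

context helix_lb begin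

text \<open>An in-site in an uncompressed column puts its \<open>uvar\<close> into that column, so
  the coefficient is 0 in every free column.\<close>

lemma good_site:
  assumes "lo \<le> snd s" "snd s < hi"
  shows "good 0 (single_site s)"
  unfolding good_def
proof (intro conjI allI impI)
  have "3 \<le> W" using W(1) e e2 K by linarith
  thus "card (boundary (single_site s)) \<le> W" using boundary_site[OF assms] card_inc[of s] by simp
  fix d f assume d: "startc d" "endc f" "colfree d (boundary (single_site s))" "colfree f (boundary (single_site s))"
  have z: "single_site s False (x * K) = 0" if x: "x < 0 \<or> Q * T \<le> x" "colfree x (boundary (single_site s))" for x
  proof (rule ccontr)
    assume "single_site s False (x * K) \<noteq> 0"
    hence s: "s = (False, x * K)" by (auto simp: single_site_def split: if_splits)
    have "x * K < 0 \<or> Q * T * K \<le> x * K" using x(1) K by (auto simp: mult_neg_pos intro: mult_right_mono)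
    hence "rep R (x * K) = x * K" by (intro rep_out) auto
    hence "(1, x * K) \<in> boundary (single_site s)" unfolding boundary_site[OF assms] by (simp add: inc_def s uvar_def Let_def)
    thus False using x(2) K by (force simp: colfree_def)
  qed
  show "side 0 (single_site s) d f" using z[of d] z[of f] d by (simp add: side_def startc_def endc_def)
qed

text \<open>Only the constraint at \<open>(False, lo)\<close> is odd, so \<open>y False lo\<close>
  is the right-hand side of the sum. Level \<open>n\<close> holds the axioms with radius 0, and
  every addition moves one level down and widens the radius by 1.\<close>

definition Lfam :: "nat \<Rightarrow> nat \<Rightarrow> ((nat \<times> int) set \<times> bit) set" where
  "Lfam n d = {(boundary y, y False lo) | y. good (int n - int d) y}"

lemma Lfam_axioms: "axioms_xor \<subseteq> Lfam n n"
proof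
  fix p assume "p \<in> axioms_xor"
  then obtain s where s: "p = (inc s, if s = (False, lo) then 1 else 0)" "lo \<le> snd s" "snd s < hi"
    by (auto simp: axioms_xor_def)
  have "single_site s False lo = (if s = (False, lo) then 1 else 0)" by (auto simp: single_site_def)
  thus "p \<in> Lfam n n" unfolding Lfam_def using good_site[OF s(2,3)] boundary_site[OF s(2,3)] s(1) by auto
qed

lemma Lfam_decreasing: "Lfam n (Suc d) \<subseteq> Lfam n d"
  unfolding Lfam_def using good_mono[of "int n - int (Suc d)" _ "int n - int d"] by fastforce

text \<open>An empty boundary meets no row, so the coefficients at both ends are equal, and
  \<open>side\<close> leaves only 0. The site \<open>lo\<close> lies in the start column
  \<open>- D\<close>.\<close>

lemma Lfam_empty: assumes "({}, b) \<in> Lfam n d" shows "b = 0"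
proof -
  obtain y where y: "boundary y = {}" "b = y False lo" "good (int n - int d) y" using assms by (auto simp: Lfam_def)
  have d: "startc (- D)" "endc (Q * T)" "colfree (- D) (boundary y)" "colfree (Q * T) (boundary y)"
    using D y(1) by (auto simp: startc_def endc_def colfree_def)
  have s: "side (int n - int d) y (- D) (Q * T)" using y(3) d by (simp add: good_def)
  have "y False (- D * K) = y False (Q * T * K)"
    using full_bd[of y "{}", OF _ _ _ d(1,2), of 0] y(1) K by (auto simp: colfree_def row_def)
  hence "y False (- D * K) = 0" using s by (auto simp: side_def)
  thus ?thesis using y(2) by (simp add: lo_def)
qed

lemma Lfam_closed:
  assumes p: "(A, a) \<in> Lfam n (Suc d)" "(B, b) \<in> Lfam n (Suc d)" and c: "card (A \<union> B) \<le> W" and n: "d < n" "2 * int n + 1 < T"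
  shows "((A - B) \<union> (B - A), a + b) \<in> Lfam n d"
proof -
  let ?r = "int n - int (Suc d)"
  obtain y z where y: "A = boundary y" "a = y False lo" "good ?r y" and z: "B = boundary z" "b = z False lo" "good ?r z"
    using p by (auto simp: Lfam_def)
  have "good (?r + 1) (addy y z)"
    by (rule good_add[OF y(3) z(3)]) (use c y z n in auto)
  moreover have "?r + 1 = int n - int d" by simp
  ultimately have "good (int n - int d) (addy y z)" by (simp only:)
  thus ?thesis unfolding Lfam_def using boundary_add[of y z] y z by auto
qed

end

section \<open>The sweep and the number of variables\<close>

context helix begin

text \<open>The edges from positions before \<open>t\<close> to positions from \<open>t\<close> on:
  one vertical edge and at most \<open>K\<close> horizontal ones. In \<open>midwall\<close> the
  in-site of \<open>t\<close> has changed sides.\<close>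

definition wall :: "int \<Rightarrow> (nat \<times> int) set" where
  "wall t = (if lo < t \<and> t < hi then {vvar t} else {}) \<union> hvar ` {s\<in>{t..<t + K}. lo + K \<le> s \<and> s < hi}"

definition midwall :: "int \<Rightarrow> (nat \<times> int) set" where
  "midwall t = {uvar t} \<union> hvar ` {s\<in>{t + 1..<t + K}. lo + K \<le> s \<and> s < hi}"

text \<open>Positions less than \<open>K\<close> apart lie in different rows, and \<open>rep\<close>
  preserves rows; so no two edges of a wall are identified.\<close>

lemma hvar_inj: assumes "hvar s = hvar s'" "\<bar>s - s'\<bar> < K" shows "s = s'"
proof -
  have "s mod K = s' mod K" using assms(1) rep_mod[of R s] rep_mod[of R s'] by (simp add: hvar_def)
  hence "K dvd s - s'" by (simp add: mod_eq_dvd_iff)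
  moreover have "s - s' = 0 \<or> K \<le> \<bar>s - s'\<bar>" using dvd_imp_le_int[of "s - s'" K] calculation K by auto
  ultimately show ?thesis using assms(2) by auto
qed

lemma kinds: "hvar s \<noteq> uvar t" "hvar s \<noteq> vvar t" "uvar s \<noteq> vvar t" "uvar s \<noteq> hvar t" "vvar s \<noteq> hvar t" "vvar s \<noteq> uvar t"
  by (simp_all add: hvar_def uvar_def vvar_def)

lemma wall_in:
  assumes "lo \<le> t" "t < hi"
  shows "midwall t = (wall t - inc (False, t)) \<union> (inc (False, t) - wall t)"
proof -
  let ?A = "{s\<in>{t + 1..<t + K}. lo + K \<le> s \<and> s < hi}"
  define HA where "HA = hvar ` ?A"
  have n: "hvar t \<notin> HA" using hvar_inj[of t] unfolding HA_def by fastforce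
  have n': "uvar t \<notin> HA" "vvar t \<notin> HA" "uvar t \<noteq> vvar t" "uvar t \<noteq> hvar t" "vvar t \<noteq> hvar t" using kinds by (auto simp: HA_def)
  have s: "{s\<in>{t..<t + K}. lo + K \<le> s \<and> s < hi} = (if lo + K \<le> t then insert t ?A else ?A)" using assms K by auto
  have "wall t = (if lo < t then {vvar t} else {}) \<union> ((if lo + K \<le> t then {hvar t} else {}) \<union> HA)"
    unfolding wall_def s HA_def using assms by auto
  moreover have "inc (False, t) = {uvar t} \<union> (if lo + K \<le> t then {hvar t} else {}) \<union> (if lo < t then {vvar t} else {})"
    by (auto simp: inc_def Let_def)
  moreover have "midwall t = {uvar t} \<union> HA" by (simp add: midwall_def HA_def)
  ultimately show ?thesis using n n' by (simp only:) (cases "lo < t"; cases "lo + K \<le> t"; auto)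
qed

lemma wall_out:
  assumes "lo \<le> t" "t < hi"
  shows "wall (t + 1) = (midwall t - inc (True, t)) \<union> (inc (True, t) - midwall t)"
proof -
  let ?A = "{s\<in>{t + 1..<t + K}. lo + K \<le> s \<and> s < hi}"
  define HA where "HA = hvar ` ?A"
  have n: "hvar (t + K) \<notin> HA"
  proof
    assume "hvar (t + K) \<in> HA"
    then obtain x where "hvar (t + K) = hvar x" "t + 1 \<le> x" "x < t + K" by (auto simp: HA_def)
    thus False using hvar_inj[of "t + K" x] by auto
  qed
  have n': "uvar t \<notin> HA" "vvar (t + 1) \<notin> HA" "uvar t \<noteq> vvar (t + 1)" "uvar t \<noteq> hvar (t + K)" "vvar (t + 1) \<noteq> hvar (t + K)"
    using kinds by (auto simp: HA_def)
  have s: "{s\<in>{t + 1..<t + 1 + K}. lo + K \<le> s \<and> s < hi} = (if t + K < hi then insert (t + K) ?A else ?A)" using assms K by auto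
  have "wall (t + 1) = (if t + 1 < hi then {vvar (t + 1)} else {}) \<union> ((if t + K < hi then {hvar (t + K)} else {}) \<union> HA)"
    unfolding wall_def s HA_def using assms by auto
  moreover have "inc (True, t) = {uvar t} \<union> (if t + K < hi then {hvar (t + K)} else {}) \<union> (if t + 1 < hi then {vvar (t + 1)} else {})"
    by (auto simp: inc_def Let_def)
  moreover have "midwall t = {uvar t} \<union> HA" by (simp add: midwall_def HA_def)
  ultimately show ?thesis using n n' by (simp only:) (cases "t + 1 < hi"; cases "t + K < hi"; auto)
qed

lemma wall_finite: "finite (wall t)" "finite (midwall t)"
proof -
  have "finite {s\<in>{a..<b}. lo + K \<le> s \<and> s < hi}" for a b :: int by (rule finite_subset[of _ "{a..<b}"]) auto
  thus "finite (wall t)" "finite (midwall t)" by (auto simp: wall_def midwall_def)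
qed

lemma wall_card: "card (wall t \<union> inc (False, t)) \<le> nat K + 2" "card (midwall t \<union> inc (True, t)) \<le> nat K + 2"
proof -
  have c: "card ({a, b} \<union> hvar ` {u..<u + K}) \<le> nat K + 2" for a b u
  proof -
    have "card ({a, b} \<union> hvar ` {u..<u + K}) \<le> card {a, b} + card (hvar ` {u..<u + K})" by (rule card_Un_le)
    moreover have "card (hvar ` {u..<u + K}) \<le> nat K" using card_image_le[of "{u..<u + K}" hvar] by simp
    moreover have "card {a, b} \<le> 2" by (simp add: card_insert_if)
    ultimately show ?thesis by simp
  qed
  have "wall t \<union> inc (False, t) \<subseteq> {uvar t, vvar t} \<union> hvar ` {t..<t + K}"
    using K by (auto simp: wall_def inc_def Let_def split: if_splits)
  hence "card (wall t \<union> inc (False, t)) \<le> card ({uvar t, vvar t} \<union> hvar ` {t..<t + K})" by (intro card_mono) auto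
  thus "card (wall t \<union> inc (False, t)) \<le> nat K + 2" using c order_trans by blast
  have "midwall t \<union> inc (True, t) \<subseteq> {uvar t, vvar (t + 1)} \<union> hvar ` {t + 1..<t + 1 + K}"
    using K by (auto simp: midwall_def inc_def Let_def split: if_splits)
  hence "card (midwall t \<union> inc (True, t)) \<le> card ({uvar t, vvar (t + 1)} \<union> hvar ` {t + 1..<t + 1 + K})" by (intro card_mono) auto
  thus "card (midwall t \<union> inc (True, t)) \<le> nat K + 2" using c order_trans by blast
qed

lemma lo_less_hi: "lo < hi"
proof -
  have "0 < hi" using hi_ge K Q T by (smt (verit) mult_nonneg_nonneg)
  thus ?thesis using lo_le by simp
qed

text \<open>The constraints from position \<open>t\<close> on sum to the wall at \<open>t\<close>
  with right-hand side 0, or 1 once the charge at \<open>lo\<close> is included. The opposite parity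
  therefore loses, by induction from \<open>hi\<close> down to the empty wall at \<open>lo\<close>.
  At most \<open>K + 2 = k + 3\<close> variables are remembered at a time.\<close>

theorem sweep:
  assumes grp: "\<And>a. finite (grp a)" "\<And>a. card (grp a) = m" "\<And>a b. a \<noteq> b \<Longrightarrow> grp a \<inter> grp b = {}"
    and F: "F = (\<Union>(S, b)\<in>axioms_xor. xlift grp S b)" and w: "(nat K + 2) * m \<le> w"
  shows "derivable F w {}"
proof -
  have ax: "xlift grp (inc s) (if s = (False, lo) then 1 else 0) \<subseteq> F" if "lo \<le> snd s" "snd s < hi" for s
    unfolding F axioms_xor_def using that by blast
  have wd: "n * m \<le> w" if "n \<le> nat K + 2" for n using that w mult_le_mono1 order_trans by blast
  have main: "\<forall>\<alpha>. parity \<alpha> (bits grp (wall t)) = (if t = lo then 0 else 1) \<longrightarrow> loses F w (bits grp (wall t)) \<alpha>"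
    if "t \<le> hi" "lo \<le> t" for t
    using that
  proof (induction t rule: int_le_induct)
    case base
    have "wall hi = {}" by (auto simp: wall_def)
    thus ?case using lo_less_hi by (simp add: bits_def parity_def)
  next
    case (step t0)
    define t where "t = t0 - 1"
    have t: "lo \<le> t" "t < hi" "t0 = t + 1" "t + 1 \<noteq> lo" using step by (auto simp: t_def)
    have next_: "\<And>\<alpha>. parity \<alpha> (bits grp (wall (t + 1))) = 1 \<Longrightarrow> loses F w (bits grp (wall (t + 1))) \<alpha>"
      using step.IH t by auto
    have mid: "loses F w (bits grp (midwall t)) \<beta>" if "parity \<beta> (bits grp (midwall t)) = 1" for \<beta>
      by (rule loses_step[where S = "inc (True, t)" and b = 0 and p = 1, OF grp _ finite_inc wall_finite(2) wd[OF wall_card(2)] wall_out[OF t(1,2)]])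
        (use ax[of "(True, t)"] t next_ that in auto)
    have "loses F w (bits grp (wall t)) \<alpha>" if "parity \<alpha> (bits grp (wall t)) = (if t = lo then 0 else 1)" for \<alpha>
      by (rule loses_step[where S = "inc (False, t)" and b = "if t = lo then 1 else 0" and p = "if t = lo then 0 else 1",
            OF grp _ finite_inc wall_finite(1) wd[OF wall_card(1)] wall_in[OF t(1,2)]])
        (use ax[of "(False, t)"] t mid that in \<open>auto split: if_splits\<close>)
    thus ?case unfolding t_def by blast
  qed
  have "wall lo = {}" using K by (auto simp: wall_def)
  hence "loses F w {} (\<lambda>_. False)" using main[of lo] lo_less_hi by (simp add: bits_def parity_def)
  thus ?thesis by (auto simp: loses_def fclause_def)
qed

section \<open>Counting variables and constraints\<close>

definition allvars :: "(nat \<times> int) set" where "allvars = (\<Union>s\<in>{s. lo \<le> snd s \<and> snd s < hi}. inc s)"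

definition Ureps :: "int set" where "Ureps = rep R ` {lo..<hi}"

lemma rep_mid: "0 \<le> t \<Longrightarrow> t < Q * T * K \<Longrightarrow> rep f t = t mod (K * (Q * f (t mod K)))"
  by (simp add: rep_def)

lemma rep_lt: "1 \<le> f (t mod K) \<Longrightarrow> 0 \<le> t \<Longrightarrow> rep f t \<le> t"
  using K Q by (simp add: rep_def zmod_le_nonneg_dividend)

lemma rep_kap:
  assumes "\<And>i. 1 \<le> f i" "\<And>i. 1 \<le> g i" "g (t mod K) dvd f (t mod K)"
  shows "rep g (rep f t) = rep g t"
proof (cases "0 \<le> t \<and> t < Q * T * K")
  case True
  hence "0 \<le> rep f t \<and> rep f t < Q * T * K" using rep_nonneg_iff[of f t] rep_less_iff[of f t] assms(1) by auto
  moreover have "K * (Q * g (t mod K)) dvd K * (Q * f (t mod K))" using assms(3) by (simp add: mult_dvd_mono)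
  ultimately show ?thesis using True by (simp add: rep_def mod_mod_cancel)
qed (simp add: rep_out)

lemma inc_In: assumes "lo \<le> t" "t < hi" shows "inc (False, t) = inc (False, rep R t)" "(t = lo) = (rep R t = lo)"
proof -
  have u: "uvar (rep R t) = uvar t" "hvar (rep R t) = hvar t" using rep_kap[of R R t] R_pos by (auto simp: uvar_def hvar_def)
  have v: "vvar (rep R t) = vvar t" using rep_kap[of R S t] R_pos S_pos S_dvd_R by (auto simp: vvar_def)
  have "0 \<le> rep R t" if "0 \<le> t" using rep_nonneg_iff[of R t] R_pos that by blast
  moreover have "rep R t = t" if "\<not> 0 \<le> t" using that by (intro rep_out) auto
  ultimately have c: "(lo + K \<le> rep R t) = (lo + K \<le> t)" "(lo + 1 \<le> rep R t) = (lo + 1 \<le> t)" "(t = lo) = (rep R t = lo)"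
    using lo_le by (cases "0 \<le> t"; fastforce)+
  show "inc (False, t) = inc (False, rep R t)" "(t = lo) = (rep R t = lo)" using u v c by (simp_all add: inc_def)
qed

text \<open>The vertical edge leaving \<open>t\<close> has the period \<open>S\<close> of the next
  row, which divides \<open>R\<close> of the row of \<open>t\<close>. In the last compressed column
  the horizontal edges leave the compressed part, so the constraints there need not be
  repetitions.\<close>

lemma inc_Out: assumes t: "0 \<le> t" "t < Q * T * K - K" shows "inc (True, t) = inc (True, rep R t)"
proof -
  let ?r = "rep R t" and ?n = "K * (Q * R (t mod K))"
  have mid: "0 \<le> t \<and> t < Q * T * K" using t K by auto
  have r: "0 \<le> ?r" "?r \<le> t" using rep_nonneg_iff[of R t] rep_lt[of R t] R_pos t by auto
  have re: "?r = t mod ?n" using mid by (simp add: rep_def)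
  have u: "uvar ?r = uvar t" using rep_kap[of R R t] R_pos by (auto simp: uvar_def)
  have "hvar (?r + K) = hvar (t + K)"
  proof -
    have row: "(?r + K) mod K = t mod K" "(t + K) mod K = t mod K" using rep_mod[of R t] by simp_all
    have "(?r + K) mod ?n = (t + K) mod ?n" unfolding re by (rule mod_add_left_eq)
    moreover have "rep R (?r + K) = (?r + K) mod ?n" by (subst rep_mid) (use t r K row in simp_all)
    moreover have "rep R (t + K) = (t + K) mod ?n" by (subst rep_mid) (use t r K row in simp_all)
    ultimately show ?thesis by (simp only: hvar_def)
  qed
  moreover have "vvar (?r + 1) = vvar (t + 1)"
  proof -
    let ?i = "(t + 1) mod K"
    have i: "(?r + 1) mod K = ?i" using rep_mod[of R t] by (metis mod_add_left_eq)
    have "(?i - 1) mod K = t mod K" by (simp add: mod_simps)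
    hence "S ?i dvd R (t mod K)" using S_dvd_R'[of ?i] by simp
    hence d: "K * (Q * S ?i) dvd ?n" by (simp add: mult_dvd_mono)
    have "(?r + 1) mod (K * (Q * S ?i)) = (t + 1) mod (K * (Q * S ?i))"
      unfolding re by (metis d mod_add_left_eq mod_mod_cancel)
    moreover have "rep S (?r + 1) = (?r + 1) mod (K * (Q * S ?i))" by (subst rep_mid) (use t r K i in simp_all)
    moreover have "rep S (t + 1) = (t + 1) mod (K * (Q * S ?i))" by (subst rep_mid) (use t K in simp_all)
    ultimately show ?thesis by (simp only: vvar_def)
  qed
  moreover have "t + K < hi" "?r + K < hi" "t + 1 < hi" "?r + 1 < hi" using t r hi_ge K by auto
  ultimately show ?thesis using u by (simp add: inc_def)
qed

lemma Ureps_card_K: "nat K \<le> card Ureps"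
proof -
  have "{lo..<lo + K} \<subseteq> Ureps"
  proof
    fix t assume t: "t \<in> {lo..<lo + K}"
    hence "t < 0" using lo_le by auto
    hence "rep R t = t" by (intro rep_out) auto
    moreover have "t < hi" using \<open>t < 0\<close> lo_less_hi hi_ge K Q T by (smt (verit) mult_nonneg_nonneg)
    ultimately show "t \<in> Ureps" using t unfolding Ureps_def by force
  qed
  from card_mono[OF _ this] show ?thesis by (simp add: Ureps_def)
qed

lemma Ureps_allvars: "card Ureps \<le> card allvars"
proof -
  have "allvars \<subseteq> (\<Union>r\<in>Ureps. inc (False, r)) \<union> (\<Union>t\<in>{lo..<hi}. inc (True, t))"
  proof
    fix a assume "a \<in> allvars"
    then obtain b t where t: "a \<in> inc (b, t)" "lo \<le> t" "t < hi" by (auto simp: allvars_def)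
    show "a \<in> (\<Union>r\<in>Ureps. inc (False, r)) \<union> (\<Union>t\<in>{lo..<hi}. inc (True, t))"
    proof (cases b)
      case True thus ?thesis using t by auto
    next
      case False
      hence "a \<in> inc (False, rep R t)" using t inc_In by simp
      thus ?thesis using t by (auto simp: Ureps_def)
    qed
  qed
  moreover have "finite ((\<Union>r\<in>Ureps. inc (False, r)) \<union> (\<Union>t\<in>{lo..<hi}. inc (True, t)))"
    using finite_inc by (simp add: Ureps_def)
  ultimately have fin: "finite allvars" by (rule finite_subset)
  have "Pair 1 ` Ureps \<subseteq> allvars"
  proof
    fix a :: "nat \<times> int" assume "a \<in> Pair 1 ` Ureps"
    then obtain t where "a = uvar t" "lo \<le> t" "t < hi" by (auto simp: Ureps_def uvar_def)
    thus "a \<in> allvars" unfolding allvars_def by (intro UN_I[of "(False, t)"]) (auto simp: inc_def)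
  qed
  from card_mono[OF fin this] show "card Ureps \<le> card allvars" by (simp add: card_image inj_on_def)
qed

text \<open>Identified sites have the same constraint, except for the \<open>K\<close> out-sites of
  the last compressed column; these are paid for by a third copy of \<open>Ureps\<close>.\<close>

lemma axioms_card: "finite axioms_xor \<and> card axioms_xor \<le> 3 * card allvars"
proof -
  let ?f = "\<lambda>s. (inc s, if s = (False, lo) then 1 else (0::bit))"
  let ?E = "{Q * T * K - K..<Q * T * K}"
  let ?A = "(\<lambda>r. ?f (False, r)) ` Ureps" and ?B = "(\<lambda>r. ?f (True, r)) ` (Ureps \<union> ?E)"
  have finU: "finite Ureps" by (simp add: Ureps_def)
  have "axioms_xor \<subseteq> ?A \<union> ?B"
  proof
    fix p assume "p \<in> axioms_xor"
    then obtain s where s: "p = ?f s" "lo \<le> snd s" "snd s < hi" by (auto simp: axioms_xor_def)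
    obtain b t where bt: "s = (b, t)" by (cases s)
    have t: "lo \<le> t" "t < hi" using s bt by auto
    hence r: "rep R t \<in> Ureps" by (auto simp: Ureps_def)
    show "p \<in> ?A \<union> ?B"
    proof (cases b)
      case False
      have "p = ?f (False, rep R t)" using s bt False inc_In[OF t] by simp
      thus ?thesis using r by blast
    next
      case True
      consider "0 \<le> t" "t < Q * T * K - K" | "t \<in> ?E" | "\<not> (0 \<le> t \<and> t < Q * T * K)" by force
      thus ?thesis
      proof cases
        case 1
        have "p = ?f (True, rep R t)" using s bt True inc_Out[OF 1] by simp
        thus ?thesis using r by blast
      next
        case 2
        have "p = ?f (True, t)" using s(1) bt True by simp
        thus ?thesis using 2 by blast
      next
        case 3
        hence "t \<in> Ureps" using r rep_out[of t R] by simp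
        moreover have "p = ?f (True, t)" using s(1) bt True by simp
        ultimately show ?thesis by blast
      qed
    qed
  qed
  moreover have fin: "finite (?A \<union> ?B)" using finU by auto
  ultimately have "finite axioms_xor" "card axioms_xor \<le> card (?A \<union> ?B)" by (auto intro: finite_subset card_mono)
  moreover have "card (?A \<union> ?B) \<le> card ?A + card ?B" by (rule card_Un_le)
  moreover have "card ?A \<le> card Ureps" by (rule card_image_le[OF finU])
  moreover have "card ?B \<le> card (Ureps \<union> ?E)" by (rule card_image_le) (use finU in auto)
  moreover have "card (Ureps \<union> ?E) \<le> card Ureps + nat K" using card_Un_le[of Ureps ?E] by simp
  ultimately show ?thesis using Ureps_card_K Ureps_allvars by linarith
qed

text \<open>Sites in blocks below \<open>R i\<close> are their own representatives.\<close>

lemma allvars_lower: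
  assumes r: "\<And>i. int r \<le> R i"
  shows "nat K * nat Q * r \<le> card allvars"
proof -
  let ?f = "\<lambda>(i, c, z). mid_site z c i"
  let ?X = "{0..<K} \<times> {0..<Q} \<times> {0..<int r}"
  have "inj_on ?f ?X"
  proof (rule inj_onI)
    fix a b assume "a \<in> ?X" "b \<in> ?X" "?f a = ?f b"
    thus "a = b" using mid_site_inj[of "snd (snd a)" "fst (snd a)" "fst a" "snd (snd b)" "fst (snd b)" "fst b"]
      by (auto simp: split_beta prod_eq_iff)
  qed
  hence "card (?f ` ?X) = nat K * nat Q * r" by (simp add: card_image card_cartesian_product)
  moreover have "?f ` ?X \<subseteq> Ureps"
  proof
    fix t assume "t \<in> ?f ` ?X"
    then obtain i c z where t: "t = mid_site z c i" "0 \<le> i" "i < K" "0 \<le> c" "c < Q" "0 \<le> z" "z < int r" by auto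
    have z: "z < R i" "z < T" using t r[of i] R_le[of i] by auto
    have "rep R t = t" using rep_pt[of c i z R] t z R_pos[of i] by simp
    moreover have "0 \<le> t \<and> t < Q * T * K" using mid_site_mid_iff[of c i z] t z by simp
    hence "t \<in> {lo..<hi}" using mid_sub(2) by auto
    ultimately show "t \<in> Ureps" unfolding Ureps_def by force
  qed
  ultimately have "nat K * nat Q * r \<le> card Ureps" using card_mono[of Ureps "?f ` ?X"] by (simp add: Ureps_def)
  thus ?thesis using Ureps_allvars by simp
qed

lemma rep_image_card:
  assumes f: "\<And>i. 1 \<le> f i" "\<And>i. f i \<le> int r"
  shows "card (rep f ` {lo..<hi}) \<le> 2 * nat D * nat K + nat K * nat Q * r"
proof -
  let ?f = "\<lambda>(i, c, z). mid_site z c i"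
  let ?X = "{0..<K} \<times> {0..<Q} \<times> {0..<int r}"
  have "rep f ` {lo..<hi} \<subseteq> ({lo..<0} \<union> {Q * T * K..<hi}) \<union> ?f ` ?X"
  proof
    fix u assume "u \<in> rep f ` {lo..<hi}"
    then obtain t where t: "u = rep f t" "lo \<le> t" "t < hi" by auto
    show "u \<in> ({lo..<0} \<union> {Q * T * K..<hi}) \<union> ?f ` ?X"
    proof (cases "0 \<le> t \<and> t < Q * T * K")
      case False
      hence "u = t" using t rep_out by simp
      thus ?thesis using False t by auto
    next
      case True
      obtain z c i where p: "t = mid_site z c i" "0 \<le> c" "c < Q" "0 \<le> i" "i < K" using mid_site_ex by blast
      have z: "0 \<le> z" "z < T" using True p mid_site_mid_iff by auto
      have "u = mid_site (z mod f i) c i" using rep_pt[OF p(2-5) z f(1)] t p by simp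
      moreover have "0 < f i" using f(1)[of i] by simp
      hence "0 \<le> z mod f i" "z mod f i < int r" using f(2)[of i] pos_mod_bound[of "f i" z] pos_mod_sign[of "f i" z] by linarith+
      ultimately have "u = ?f (i, c, z mod f i)" "(i, c, z mod f i) \<in> ?X" using p by auto
      thus ?thesis by blast
    qed
  qed
  hence "card (rep f ` {lo..<hi}) \<le> card (({lo..<0} \<union> {Q * T * K..<hi}) \<union> ?f ` ?X)" by (intro card_mono) auto
  also have "\<dots> \<le> card ({lo..<0} \<union> {Q * T * K..<hi}) + card (?f ` ?X)" by (rule card_Un_le)
  also have "\<dots> \<le> (card {lo..<0} + card {Q * T * K..<hi}) + card ?X"
    by (intro add_mono card_Un_le card_image_le) auto
  also have "\<dots> = 2 * nat D * nat K + nat K * nat Q * r"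
    using K D by (simp add: lo_def hi_def card_cartesian_product algebra_simps nat_mult_distrib)
  finally show ?thesis .
qed

lemma allvars_upper:
  assumes r: "\<And>i. R i \<le> int r"
  shows "card allvars \<le> 3 * (2 * nat D * nat K + nat K * nat Q * r)"
proof -
  let ?A = "rep R ` {lo..<hi}" and ?B = "rep S ` {lo..<hi}"
  have Sr: "S i \<le> int r" for i
  proof -
    have "S i \<le> R i" by (rule zdvd_imp_le[OF S_dvd_R]) (use R_pos[of i] in simp)
    thus ?thesis using r[of i] by simp
  qed
  have "allvars \<subseteq> (Pair 0 ` ?A \<union> Pair 1 ` ?A) \<union> Pair 2 ` ?B"
  proof
    fix a assume "a \<in> allvars"
    then obtain b t where t: "a \<in> inc (b, t)" "lo \<le> t" "t < hi" by (auto simp: allvars_def)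
    have "(\<exists>u\<in>{lo..<hi}. a = hvar u) \<or> (\<exists>u\<in>{lo..<hi}. a = uvar u) \<or> (\<exists>u\<in>{lo..<hi}. a = vvar u)"
      using t K by (cases b) (auto simp: inc_def Let_def split: if_splits)
    thus "a \<in> (Pair 0 ` ?A \<union> Pair 1 ` ?A) \<union> Pair 2 ` ?B" by (auto simp: hvar_def uvar_def vvar_def)
  qed
  hence "card allvars \<le> card ((Pair 0 ` ?A \<union> Pair 1 ` ?A) \<union> Pair (2::nat) ` ?B)" by (intro card_mono) auto
  also have "\<dots> \<le> (card (Pair (0::nat) ` ?A) + card (Pair (1::nat) ` ?A)) + card (Pair (2::nat) ` ?B)"
    by (meson add_le_mono1 card_Un_le order_trans)
  also have "\<dots> \<le> (card ?A + card ?A) + card ?B" by (intro add_mono card_image_le) auto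
  also have "\<dots> \<le> (n + n) + n" if "card ?A \<le> n" "card ?B \<le> n" for n using that by simp
  finally have "card allvars \<le> (n + n) + n" if "card ?A \<le> n" "card ?B \<le> n" for n using that by blast
  from this[OF rep_image_card[of R r, OF R_pos r] rep_image_card[of S r, OF S_pos Sr]] show ?thesis
    by (simp add: algebra_simps)
qed

end

section \<open>Primes between n and 2n\<close>

lemma multiplicity_card:
  fixes p n :: nat
  assumes p: "prime p" and n: "0 < n" "n < p ^ Suc L"
  shows "multiplicity p n = card {j\<in>{1..L}. p ^ j dvd n}"
proof -
  have nu: "\<not> is_unit p" using p by auto
  have dv: "p ^ j dvd n \<longleftrightarrow> j \<le> multiplicity p n" for j
    using power_dvd_iff_le_multiplicity[of n p j] n nu by simp
  have "p ^ multiplicity p n \<le> n" using dv[of "multiplicity p n"] n by (simp add: dvd_imp_le)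
  hence "p ^ multiplicity p n < p ^ Suc L" using n by simp
  hence "multiplicity p n < Suc L" using power_less_imp_less_exp[OF prime_gt_1_nat[OF p]] by blast
  hence "{j\<in>{1..L}. p ^ j dvd n} = {1..multiplicity p n}" unfolding dv by auto
  thus ?thesis by simp
qed

lemma legendre:
  fixes p n :: nat
  assumes p: "prime p" and n: "n < p ^ Suc L"
  shows "multiplicity p (fact n) = (\<Sum>j=1..L. n div p ^ j)"
  using n
proof (induction n)
  case 0 thus ?case by simp
next
  case (Suc n)
  have "multiplicity p (fact (Suc n)) = multiplicity p (Suc n) + multiplicity p (fact n)"
    using p by (simp del: of_nat_Suc mult_Suc add: prime_elem_multiplicity_mult_distrib fact_Suc)
  also have "multiplicity p (Suc n) = card {j\<in>{1..L}. p ^ j dvd Suc n}"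
    by (rule multiplicity_card) (use p Suc.prems in auto)
  also have "\<dots> = (\<Sum>j=1..L. if p ^ j dvd Suc n then 1 else 0)" by (simp add: sum.If_cases Int_def)
  also have "multiplicity p (fact n) = (\<Sum>j=1..L. n div p ^ j)" using Suc by simp
  also have "(\<Sum>j=1..L. if p ^ j dvd Suc n then 1 else 0) + (\<Sum>j=1..L. n div p ^ j) = (\<Sum>j=1..L. Suc n div p ^ j)"
    unfolding sum.distrib[symmetric] by (rule sum.cong) (auto simp: div_Suc dvd_eq_mod_eq_0)
  finally show ?case .
qed

lemma mult_central:
  fixes p n :: nat
  assumes p: "prime p" and n: "2 * n < p ^ Suc L"
  shows "multiplicity p ((2 * n) choose n) + 2 * (\<Sum>j=1..L. n div p ^ j) = (\<Sum>j=1..L. (2 * n) div p ^ j)"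
proof -
  have "fact n * fact n * ((2 * n) choose n) = (fact (2 * n) :: nat)"
    using binomial_fact_lemma[of n "2 * n"] by simp
  hence "multiplicity p (fact (2 * n)) = multiplicity p ((fact n * fact n) * ((2 * n) choose n) :: nat)" by simp
  also have "\<dots> = 2 * multiplicity p (fact n) + multiplicity p ((2 * n) choose n)"
    using p by (simp add: prime_elem_multiplicity_mult_distrib)
  finally show ?thesis using legendre[OF p n] legendre[OF p, of n L] n by simp
qed

text \<open>By Legendre's formula this compares the contributions of a prime power \<open>d\<close>
  to the exponents in \<open>6 m\<close> choose \<open>3 m\<close> and \<open>2 m\<close> choose
  \<open>m\<close>: the excess is at most 1, and none for \<open>d\<close> in
  \<open>(6 m / 7, 3 m]\<close>.\<close>

lemma floor_ineq:
  fixes d m :: nat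
  assumes d: "0 < d"
  shows "(6 * m) div d + 2 * (m div d) \<le> 2 * ((3 * m) div d) + (2 * m) div d + 1"
    and "6 * m < 7 * d \<Longrightarrow> d \<le> 3 * m \<Longrightarrow> (6 * m) div d + 2 * (m div d) \<le> 2 * ((3 * m) div d) + (2 * m) div d"
proof -
  have "(6 * m) div d \<le> 2 * ((3 * m) div d) + 1"
  proof -
    have "3 * m < d * ((3 * m) div d + 1)" using d by (simp add: dividend_less_times_div)
    hence "6 * m < d * (2 * ((3 * m) div d) + 2)" by (simp add: algebra_simps)
    hence "(6 * m) div d < 2 * ((3 * m) div d) + 2" by (simp add: less_mult_imp_div_less mult.commute)
    thus ?thesis by simp
  qed
  moreover have "2 * (m div d) \<le> (2 * m) div d"
  proof -
    have "d * (m div d) \<le> m" by simp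
    hence "d * (2 * (m div d)) \<le> 2 * m" by simp
    thus ?thesis using d by (simp add: less_eq_div_iff_mult_less_eq mult.commute)
  qed
  ultimately show "(6 * m) div d + 2 * (m div d) \<le> 2 * ((3 * m) div d) + (2 * m) div d + 1" by simp
next
  assume m: "6 * m < 7 * d" "d \<le> 3 * m"
  have dl: "k \<le> x div d \<longleftrightarrow> k * d \<le> x" for k x using d by (simp add: less_eq_div_iff_mult_less_eq)
  have du: "x div d < k \<longleftrightarrow> x < k * d" for k x using d by (simp add: div_less_iff_less_mult)
  show "(6 * m) div d + 2 * (m div d) \<le> 2 * ((3 * m) div d) + (2 * m) div d"
  proof (cases "d \<le> m")
    case True
    have "m div d = 1" using dl[of 1 m] du[of m 2] m True by simp
    moreover have "(6 * m) div d < 7" using du m by simp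
    moreover have "3 \<le> (3 * m) div d" "2 \<le> (2 * m) div d" using dl True by simp_all
    ultimately show ?thesis by simp
  next
    case False
    have m0: "m div d = 0" using False by simp
    have t1: "1 \<le> (3 * m) div d" using dl[of 1 "3 * m"] m by simp
    show ?thesis
    proof (cases "2 * d \<le> 3 * m")
      case True
      have "2 \<le> (3 * m) div d" "1 \<le> (2 * m) div d" using dl[of 2 "3 * m"] dl[of 1 "2 * m"] True by simp_all
      moreover have "(6 * m) div d < 6" using du[of "6 * m" 6] False by simp
      ultimately show ?thesis using m0 by simp
    next
      case F: False
      have "(6 * m) div d < 4" using du[of "6 * m" 4] F by simp
      moreover have "(6 * m) div d < 3" if "\<not> 1 \<le> (2 * m) div d" using du[of "6 * m" 3] dl[of 1 "2 * m"] that by simp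
      ultimately show ?thesis using m0 t1 by fastforce
    qed
  qed
qed

definition primes_to :: "nat \<Rightarrow> nat set" where "primes_to n = {p. prime p \<and> p \<le> n}"

lemma primes_to_finite: "finite (primes_to n)"
  by (rule finite_subset[of _ "{..n}"]) (auto simp: primes_to_def)

lemma prod_primes_dvd:
  fixes x :: nat
  assumes "finite A" "\<And>p. p \<in> A \<Longrightarrow> prime p" "\<And>p. p \<in> A \<Longrightarrow> p dvd x"
  shows "\<Prod>A dvd x"
  using assms
proof (induction A rule: finite_induct)
  case empty thus ?case by simp
next
  case (insert p A)
  have "coprime p (\<Prod>A)" using insert by (intro prod_coprime_right) (auto intro: primes_coprime)
  thus ?case using insert by (simp add: divides_mult)
qed

text \<open>For \<open>n = 2 k + 1\<close> the primes above \<open>k + 1\<close> divide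
  \<open>n\<close> choose \<open>k\<close>. This binomial coefficient occurs twice in its row, so it
  is at most \<open>4 ^ k\<close>.\<close>

lemma primorial_le: "\<Prod>(primes_to n) \<le> 4 ^ n"
proof (induction n rule: less_induct)
  case (less n)
  consider "n \<le> 2" | "n > 2" "even n" | k where "n = 2 * k + 1" "k \<ge> 1"
    by (metis One_nat_def Suc_eq_plus1 Suc_leI bot_nat_0.not_eq_extremum linorder_not_less mult_0_right oddE one_le_numeral plus_1_eq_Suc zero_less_Suc)
  thus ?case
  proof cases
    case 1
    have "primes_to 0 = {}" "primes_to 1 = {}" "primes_to 2 = {2}"
      by (auto simp: primes_to_def dest: prime_ge_2_nat)
    moreover have "n = 0 \<or> n = 1 \<or> n = 2" using 1 by auto
    ultimately show ?thesis by auto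
  next
    case 2
    have "\<not> prime n" using 2 prime_odd_nat by auto
    hence "primes_to n = primes_to (n - 1)" using 2 by (auto simp: primes_to_def le_Suc_eq) (metis Suc_pred le_Suc_eq nat_less_le not_less_zero neq0_conv)
    hence "\<Prod>(primes_to n) \<le> 4 ^ (n - 1)" using less[of "n - 1"] 2 by simp
    also have "\<dots> \<le> 4 ^ n" by (rule power_increasing) auto
    finally show ?thesis .
  next
    case (3 k)
    let ?A = "{p. prime p \<and> k + 1 < p \<and> p \<le> n}"
    have fA: "finite ?A" by (rule finite_subset[of _ "{..n}"]) auto
    have "\<Prod>?A dvd n choose k"
    proof (rule prod_primes_dvd[OF fA])
      fix p assume p: "p \<in> ?A"
      have "fact k * fact (n - k) * (n choose k) = (fact n :: nat)" by (rule binomial_fact_lemma) (use 3 in simp)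
      moreover have "p dvd fact n" using p prime_dvd_fact_iff by blast
      ultimately have "p dvd fact k * fact (n - k) * (n choose k)" by simp
      moreover have "prime p" "\<not> p \<le> k" "\<not> p \<le> n - k" using p 3 by auto
      hence "\<not> p dvd fact k" "\<not> p dvd fact (n - k)" by (simp_all only: prime_dvd_fact_iff not_False_eq_True)
      ultimately show "p dvd n choose k" using p by (auto simp: prime_dvd_mult_iff)
    qed auto
    hence "\<Prod>?A \<le> n choose k" using 3 by (intro dvd_imp_le) auto
    also have "\<dots> \<le> 4 ^ k"
    proof -
      have "(n choose k) + (n choose (k + 1)) \<le> (\<Sum>i\<le>n. n choose i)"
      proof -
        have "(n choose k) + (n choose (k + 1)) = (\<Sum>i\<in>{k, k + 1}. n choose i)" by simp
        also have "\<dots> \<le> (\<Sum>i\<le>n. n choose i)" by (rule sum_mono2) (use 3 in auto)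
        finally show ?thesis .
      qed
      moreover have "n choose (k + 1) = n choose k" using 3 binomial_symmetric[of k n] by simp
      moreover have "(\<Sum>i\<le>n. n choose i) = 2 * 4 ^ k" using choose_row_sum[of n] 3 by (simp add: power_mult)
      ultimately show ?thesis by simp
    qed
    finally have A: "\<Prod>?A \<le> 4 ^ k" .
    have "primes_to n = primes_to (k + 1) \<union> ?A" using 3 by (auto simp: primes_to_def)
    hence "\<Prod>(primes_to n) = \<Prod>(primes_to (k + 1)) * \<Prod>?A"
      by (simp only:) (rule prod.union_disjoint[OF primes_to_finite fA], auto simp: primes_to_def)
    also have "\<dots> \<le> 4 ^ (k + 1) * 4 ^ k" using less[of "k + 1"] 3 A by (intro mult_mono) auto
    also have "\<dots> = 4 ^ n" using 3 by (simp add: power_add mult_2)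
    finally show ?thesis .
  qed
qed

lemma prod_multiplicities:
  fixes n :: nat
  assumes "0 < n" "prime_factors n \<subseteq> A" "finite A" "\<And>p. p \<in> A \<Longrightarrow> prime p"
  shows "n = (\<Prod>p\<in>A. p ^ multiplicity p n)"
proof -
  have "n = (\<Prod>p\<in>prime_factors n. p ^ multiplicity p n)" using assms by (simp add: prod_prime_factors)
  also have "\<dots> = (\<Prod>p\<in>A. p ^ multiplicity p n)"
    by (rule prod.mono_neutral_left) (use assms in \<open>auto simp: prime_factors_multiplicity\<close>)
  finally show ?thesis .
qed

lemma central_factors: "prime_factors ((2 * n) choose n) \<subseteq> primes_to (2 * n)"
proof
  fix p assume "p \<in> prime_factors ((2 * n) choose n)"
  hence p: "prime p" "p dvd (2 * n) choose n" by auto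
  have "fact n * fact n * ((2 * n) choose n) = (fact (2 * n) :: nat)" using binomial_fact_lemma[of n "2 * n"] by simp
  hence "p dvd fact (2 * n)" using p(2) by (metis dvd_mult)
  thus "p \<in> primes_to (2 * n)" using p(1) by (simp add: prime_dvd_fact_iff primes_to_def)
qed

text \<open>Apart from the primes up to \<open>sqrt (6 * m)\<close>, those in \<open>(6 * m / 7, 3 * m]\<close> do not divide the quotient
  of the two binomial coefficients, which makes Chebyshev's argument strong enough for the interval
  from \<open>3 * m\<close> to \<open>6 * m\<close>.\<close>

lemma central_quotient:
  fixes m :: nat
  assumes m: "1 \<le> m"
  defines "A \<equiv> {p. prime p \<and> 3 * m < p \<and> p \<le> 6 * m}"
  defines "s \<equiv> nat \<lfloor>sqrt (6 * m)\<rfloor>"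
  shows "(6 * m) choose (3 * m) \<le> ((2 * m) choose m) * ((6 * m) ^ card A * (4 ^ (6 * m div 7) * (6 * m) ^ s))"
proof -
  let ?P = "primes_to (6 * m)"
  let ?C = "(6 * m) choose (3 * m)" and ?c = "(2 * m) choose m"
  \<comment> \<open>The largest \<open>l\<close> with \<open>p ^ l \<le> 6 * m\<close>.\<close>
  define L where "L p = (LEAST l. 6 * m < p ^ Suc l)" for p
  have L: "6 * m < p ^ Suc (L p)" "p ^ L p \<le> 6 * m" if "prime p" for p
  proof -
    have "6 * m < p ^ Suc (6 * m)" using prime_gt_1_nat[OF that] power_gt_expt[of p "Suc (6 * m)"] by simp
    thus 1: "6 * m < p ^ Suc (L p)" unfolding L_def by (rule LeastI)
    show "p ^ L p \<le> 6 * m"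
    proof (cases "L p")
      case 0 thus ?thesis using m by simp
    next
      case (Suc l)
      hence "\<not> 6 * m < p ^ Suc l" using not_less_Least[of l "\<lambda>l. 6 * m < p ^ Suc l"] by (simp add: L_def)
      thus ?thesis using Suc by simp
    qed
  qed
  have ssq: "6 * m < (s + 1)\<^sup>2"
  proof -
    have "sqrt (6 * m) < real s + 1" unfolding s_def by linarith
    hence "(sqrt (6 * m))\<^sup>2 < (real s + 1)\<^sup>2" by (intro power_strict_mono) auto
    hence "real (6 * m) < real ((s + 1)\<^sup>2)" by (simp add: add.commute)
    thus ?thesis by (simp only: of_nat_less_iff)
  qed
  \<comment> \<open>A bound for the excess of the exponent of \<open>p\<close>. Above
    \<open>s\<close> only the first power of \<open>p\<close> is at most \<open>6 * m\<close>, and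
    it counts only for \<open>p\<close> in \<open>A\<close> or up to
    \<open>6 * m / 7\<close>.\<close>
  define ex where "ex p = (if p \<in> A then 1 else 0) + ((if p \<le> 6 * m div 7 then 1 else 0) + (if p \<le> s then L p else 0))" for p
  have key: "multiplicity p ?C \<le> multiplicity p ?c + ex p" if p: "p \<in> ?P" for p
  proof -
    have pp: "prime p" using p by (simp add: primes_to_def)
    have p0: "0 < p ^ j" for j using pp prime_gt_0_nat by simp
    let ?e = "\<lambda>j. if 6 * m < 7 * p ^ j \<and> p ^ j \<le> 3 * m then 0 else (1::nat)"
    have c1: "multiplicity p ?C + 2 * (\<Sum>j=1..L p. (3 * m) div p ^ j) = (\<Sum>j=1..L p. (6 * m) div p ^ j)"
      using mult_central[OF pp, of "3 * m" "L p"] L(1)[OF pp] by simp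
    have c2: "multiplicity p ?c + 2 * (\<Sum>j=1..L p. m div p ^ j) = (\<Sum>j=1..L p. (2 * m) div p ^ j)"
      using mult_central[OF pp, of m "L p"] L(1)[OF pp] by simp
    have "(\<Sum>j=1..L p. (6 * m) div p ^ j + 2 * (m div p ^ j)) \<le> (\<Sum>j=1..L p. 2 * ((3 * m) div p ^ j) + (2 * m) div p ^ j + ?e j)"
    proof (rule sum_mono)
      fix j
      show "(6 * m) div p ^ j + 2 * (m div p ^ j) \<le> 2 * ((3 * m) div p ^ j) + (2 * m) div p ^ j + ?e j"
        using floor_ineq[OF p0, of m j] by auto
    qed
    hence "multiplicity p ?C \<le> multiplicity p ?c + (\<Sum>j=1..L p. ?e j)"
      using c1 c2 by (simp add: sum.distrib sum_distrib_left)
    also have "(\<Sum>j=1..L p. ?e j) \<le> ex p"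
    proof (cases "p \<le> s")
      case True
      have "(\<Sum>j=1..L p. ?e j) \<le> (\<Sum>j=1..L p. 1)" by (rule sum_mono) simp
      thus ?thesis using True by (simp add: ex_def)
    next
      case False
      have "(s + 1)\<^sup>2 \<le> p\<^sup>2" using False by (intro power_mono) auto
      with ssq have "6 * m < p\<^sup>2" by (rule less_le_trans)
      hence "L p \<le> 1" unfolding L_def by (intro Least_le) (simp add: power2_eq_square)
      hence "L p = 0 \<or> L p = 1" by auto
      thus ?thesis using p False by (auto simp: ex_def A_def primes_to_def)
    qed
    finally show ?thesis by simp
  qed
  have fP: "finite ?P" by (rule primes_to_finite)
  have "?C = (\<Prod>p\<in>?P. p ^ multiplicity p ?C)"
    by (rule prod_multiplicities) (use central_factors[of "3 * m"] fP in \<open>auto simp: primes_to_def\<close>)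
  also have "\<dots> \<le> (\<Prod>p\<in>?P. p ^ multiplicity p ?c * p ^ ex p)"
  proof (rule prod_mono, intro conjI)
    fix p assume p: "p \<in> ?P"
    have "1 \<le> p" using p prime_ge_1_nat by (auto simp: primes_to_def)
    hence "p ^ multiplicity p ?C \<le> p ^ (multiplicity p ?c + ex p)" using key[OF p] by (rule power_increasing[rotated])
    thus "p ^ multiplicity p ?C \<le> p ^ multiplicity p ?c * p ^ ex p" by (simp add: power_add)
  qed simp
  also have "\<dots> = ?c * (\<Prod>p\<in>?P. p ^ ex p)"
  proof -
    have "primes_to (2 * m) \<subseteq> ?P" by (auto simp: primes_to_def)
    hence "?c = (\<Prod>p\<in>?P. p ^ multiplicity p ?c)"
      by (intro prod_multiplicities) (use central_factors[of m] fP in \<open>auto simp: primes_to_def\<close>)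
    thus ?thesis by (simp add: prod.distrib)
  qed
  also have "(\<Prod>p\<in>?P. p ^ ex p) = (\<Prod>p\<in>?P. if p \<in> A then p else 1) * ((\<Prod>p\<in>?P. if p \<le> 6 * m div 7 then p else 1) * (\<Prod>p\<in>?P. if p \<le> s then p ^ L p else 1))"
    unfolding prod.distrib[symmetric] by (rule prod.cong) (auto simp: ex_def power_add)
  also have "\<dots> \<le> (6 * m) ^ card A * (4 ^ (6 * m div 7) * (6 * m) ^ s)"
  proof (intro mult_mono)
    have "(\<Prod>p\<in>?P. if p \<in> A then p else 1) = (\<Prod>p\<in>{p\<in>?P. p \<in> A}. p)" by (subst prod.inter_filter[OF fP, symmetric]) simp
    also have "{p\<in>?P. p \<in> A} = A" by (auto simp: A_def primes_to_def)
    also have "(\<Prod>p\<in>A. p) \<le> (\<Prod>p\<in>A. 6 * m)" by (rule prod_mono) (auto simp: A_def)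
    finally show "(\<Prod>p\<in>?P. if p \<in> A then p else 1) \<le> (6 * m) ^ card A" by simp
    have "(\<Prod>p\<in>?P. if p \<le> 6 * m div 7 then p else 1) = (\<Prod>p\<in>{p\<in>?P. p \<le> 6 * m div 7}. p)" by (subst prod.inter_filter[OF fP, symmetric]) simp
    also have "{p\<in>?P. p \<le> 6 * m div 7} = primes_to (6 * m div 7)" by (auto simp: primes_to_def)
    finally show "(\<Prod>p\<in>?P. if p \<le> 6 * m div 7 then p else 1) \<le> 4 ^ (6 * m div 7)" using primorial_le by simp
    have "(\<Prod>p\<in>?P. if p \<le> s then p ^ L p else 1) = (\<Prod>p\<in>{p\<in>?P. p \<le> s}. p ^ L p)" by (subst prod.inter_filter[OF fP, symmetric]) simp
    also have "\<dots> \<le> (\<Prod>p\<in>{p\<in>?P. p \<le> s}. 6 * m)" by (rule prod_mono) (use L(2) in \<open>auto simp: primes_to_def\<close>)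
    also have "\<dots> = (6 * m) ^ card {p\<in>?P. p \<le> s}" by simp
    also have "\<dots> \<le> (6 * m) ^ s"
    proof (rule power_increasing)
      have "card {p\<in>?P. p \<le> s} \<le> card {1..s}" by (rule card_mono) (auto simp: primes_to_def dest: prime_ge_1_nat)
      thus "card {p\<in>?P. p \<le> s} \<le> s" by simp
    qed (use m in simp)
    finally show "(\<Prod>p\<in>?P. if p \<le> s then p ^ L p else 1) \<le> (6 * m) ^ s" .
  qed auto
  finally show ?thesis by simp
qed

text \<open>The quotient leaves \<open>4 ^ m\<close> to the power 3 - 1 - 6/7 = 8/7. With ln 4 at
  least 4/3 and \<open>3 * m \<ge> n\<close> this is 32/63 times \<open>n\<close> on the logarithmic
  scale; the margin over 1/2 absorbs all lower-order terms.\<close>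

theorem primes_in_interval:
  "\<exists>n1::nat. \<forall>n\<ge>n1. \<forall>k. real k \<le> real n / (2 * ln (real n)) \<longrightarrow> k + 1 \<le> card {p. prime p \<and> n \<le> p \<and> p \<le> 2 * n}"
proof -
  have "eventually (\<lambda>x::real. x / (2 * ln x) \<le> (32 / 63) * x / ln (2 * x + 4) - sqrt (2 * x + 4) - 7) at_top"
    by real_asymp
  hence "eventually (\<lambda>n::nat. real n / (2 * ln n) \<le> (32 / 63) * real n / ln (2 * real n + 4) - sqrt (2 * real n + 4) - 7) at_top"
    by (rule eventually_compose_filterlim) (rule filterlim_real_sequentially)
  then obtain n0 where n0: "\<And>n::nat. n \<ge> n0 \<Longrightarrow> real n / (2 * ln n) \<le> (32 / 63) * real n / ln (2 * real n + 4) - sqrt (2 * real n + 4) - 7"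
    by (auto simp: eventually_at_top_linorder)
  show ?thesis
  proof (intro exI[of _ "max n0 1"] allI impI)
    fix n k :: nat assume n: "n \<ge> max n0 1" and k: "real k \<le> real n / (2 * ln (real n))"
    \<comment> \<open>Rounding \<open>n\<close> up to a multiple of 3 moves the interval up to
      \<open>6 * m \<le> 2 * n + 4\<close>, so at most four primes lie outside
      \<open>[n, 2 n]\<close>.\<close>
    define m where "m = (n + 2) div 3"
    have m: "1 \<le> m" "n \<le> 3 * m" "3 * m \<le> n + 2" using n by (auto simp: m_def)
    let ?A = "{p. prime p \<and> 3 * m < p \<and> p \<le> 6 * m}"
    define s where "s = nat \<lfloor>sqrt (6 * m)\<rfloor>"
    define l where "l = ln (real (6 * m))"
    have l0: "0 < l" using m by (simp add: l_def)
    have "4 ^ (3 * m) / (2 * real (3 * m)) \<le> real ((2 * (3 * m)) choose (3 * m))"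
      using central_binomial_lower_bound[of "3 * m"] m by simp
    also have "\<dots> = real ((6 * m) choose (3 * m))" by simp
    also have "\<dots> \<le> real (((2 * m) choose m) * ((6 * m) ^ card ?A * (4 ^ (6 * m div 7) * (6 * m) ^ s)))"
      using central_quotient[OF m(1)] unfolding s_def by (simp only: of_nat_le_iff)
    also have "\<dots> \<le> real (4 ^ m * ((6 * m) ^ card ?A * (4 ^ (6 * m div 7) * (6 * m) ^ s)))"
    proof -
      have "(2 * m) choose m \<le> 2 ^ (2 * m)" by (rule binomial_le_pow2)
      hence "(2 * m) choose m \<le> 4 ^ m" by (simp add: power_mult)
      thus ?thesis by (simp only: of_nat_le_iff mult_le_mono1)
    qed
    finally have "ln (4 ^ (3 * m) / (2 * real (3 * m))) \<le> ln (real (4 ^ m * ((6 * m) ^ card ?A * (4 ^ (6 * m div 7) * (6 * m) ^ s))))"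
      using m by (subst ln_le_cancel_iff) auto
    moreover have "ln (4 ^ (3 * m) / (2 * real (3 * m))) = 3 * m * ln 4 - l"
      using m by (simp add: ln_div ln_realpow l_def)
    moreover have "ln (real (4 ^ m * ((6 * m) ^ card ?A * (4 ^ (6 * m div 7) * (6 * m) ^ s))))
       = m * ln 4 + (card ?A * l + ((6 * m div 7) * ln 4 + s * l))"
      using m by (simp add: ln_mult ln_realpow l_def algebra_simps)
    ultimately have 1: "3 * m * ln 4 - l \<le> m * ln 4 + (card ?A * l + (real (6 * m div 7) * ln 4 + s * l))" by simp
    have ln4: "(4::real) / 3 \<le> ln 4"
    proof -
      have "ln (4::real) = 2 * ln 2" using ln_realpow[of 2 2] by simp
      thus ?thesis using ln2_ge_two_thirds by simp
    qed
    have "7 * (6 * m div 7) \<le> 6 * m" by simp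
    hence "real (7 * (6 * m div 7)) \<le> real (6 * m)" by (simp only: of_nat_le_iff)
    hence "real (6 * m div 7) \<le> 6 * m / 7" by simp
    hence "real (6 * m div 7) * ln 4 \<le> (6 * m / 7) * ln 4" using ln4 by (intro mult_right_mono) auto
    moreover have "(6 * m / 7) * ln 4 = 6 / 7 * (m * ln 4)" "3 * m * ln 4 = 3 * (m * ln 4)" "(8 / 7) * m * ln 4 = 8 / 7 * (m * ln 4)"
      "(card ?A + s + 1) * l = card ?A * l + s * l + l" by (simp_all add: algebra_simps)
    ultimately have "(8 / 7) * m * ln 4 \<le> (card ?A + s + 1) * l" using 1 by linarith
    moreover have "(8 / 7) * m * (4 / 3) \<le> (8 / 7) * m * ln 4" using ln4 by (intro mult_left_mono) auto
    moreover have "(32 / 63) * real n \<le> (8 / 7) * m * (4 / 3)" using m by simp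
    ultimately have "(32 / 63) * real n \<le> (card ?A + s + 1) * l" by linarith
    hence "(32 / 63) * real n / l \<le> card ?A + s + 1" using l0 by (simp add: pos_divide_le_eq)
    moreover have "l \<le> ln (2 * real n + 4)" unfolding l_def using m by (subst ln_le_cancel_iff) auto
    hence "(32 / 63) * real n / ln (2 * real n + 4) \<le> (32 / 63) * real n / l" using l0 by (intro divide_left_mono mult_pos_pos) auto
    moreover have "real s \<le> sqrt (2 * real n + 4)"
    proof -
      have "real s \<le> sqrt (6 * m)" by (simp add: s_def)
      also have "\<dots> \<le> sqrt (2 * real n + 4)" using m by (intro real_sqrt_le_mono) linarith
      finally show ?thesis .
    qed
    ultimately have "real n / (2 * ln n) + 6 \<le> card ?A" using n0[of n] n by simp
    hence "k + 6 \<le> card ?A" using k by linarith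
    moreover have "card ?A \<le> card ({p. prime p \<and> n \<le> p \<and> p \<le> 2 * n} \<union> {2 * n + 1..2 * n + 4})"
      by (rule card_mono) (use m in \<open>auto intro: finite_subset[of _ "{..2 * n}"]\<close>)
    moreover have "card ({p. prime p \<and> n \<le> p \<and> p \<le> 2 * n} \<union> {2 * n + 1..2 * n + 4}) \<le> card {p. prime p \<and> n \<le> p \<and> p \<le> 2 * n} + 4"
      using card_Un_le[of "{p. prime p \<and> n \<le> p \<and> p \<le> 2 * n}" "{2 * n + 1..2 * n + 4}"] by simp
    ultimately show "k + 1 \<le> card {p. prime p \<and> n \<le> p \<and> p \<le> 2 * n}" by linarith
  qed
qed

section \<open>The lifted formula\<close>

text \<open>An assignment matters only through the set of bits it makes true, so there are finitely
  many clauses.\<close>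

lemma xlift_image: "xlift grp S b \<subseteq> (\<lambda>T. fclause (\<Union>a\<in>S. grp a) (\<lambda>v. v \<in> T)) ` Pow (\<Union>a\<in>S. grp a)"
proof
  fix C assume "C \<in> xlift grp S b"
  then obtain \<alpha> where C: "C = fclause (\<Union>a\<in>S. grp a) \<alpha>" by (auto simp: xlift_def)
  let ?U = "\<Union>a\<in>S. grp a"
  have "C = fclause ?U (\<lambda>v. v \<in> {v\<in>?U. \<alpha> v})" unfolding C by (rule fclause_cong) auto
  thus "C \<in> (\<lambda>T. fclause ?U (\<lambda>v. v \<in> T)) ` Pow ?U" by blast
qed

text \<open>Both parities occur on a nonempty set of bits. Hence every variable of a constraint
  really occurs in the formula, as the lower bound on their number requires.\<close>

lemma xlift_nonempty:
  assumes "finite (\<Union>a\<in>S. grp a)" "(\<Union>a\<in>S. grp a) \<noteq> {}"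
  shows "\<exists>C. C \<in> xlift grp S b"
proof -
  let ?U = "\<Union>a\<in>S. grp a"
  obtain v0 where v0: "v0 \<in> ?U" using assms(2) by blast
  have "parity (\<lambda>v. v = v0) ?U = 1" "parity (\<lambda>v. False) ?U = 0" using assms(1) v0 by (simp_all add: parity_def)
  hence "\<exists>\<alpha>. parity \<alpha> ?U \<noteq> b" by (cases b) (metis zero_neq_one)+
  thus ?thesis by (auto simp: xlift_def)
qed

locale lifted_system =
  fixes Ax :: "('a set \<times> bit) set" and grp :: "'a \<Rightarrow> 'v set" and m :: nat
  assumes fin: "finite Ax" "\<And>S b. (S, b) \<in> Ax \<Longrightarrow> finite S \<and> S \<noteq> {} \<and> card S \<le> 3"
    and grp: "\<And>a. finite (grp a)" "\<And>a. card (grp a) = m" "\<And>a b. a \<noteq> b \<Longrightarrow> grp a \<inter> grp b = {}" and m: "1 \<le> m"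
begin

definition F :: "'v formula" where "F = (\<Union>(S, b)\<in>Ax. xlift grp S b)"

definition V :: "'a set" where "V = (\<Union>(S, b)\<in>Ax. S)"

lemma U: assumes "(S, b) \<in> Ax"
  shows "finite (\<Union>a\<in>S. grp a)" "(\<Union>a\<in>S. grp a) \<noteq> {}" "card (\<Union>a\<in>S. grp a) \<le> 3 * m"
proof -
  show "finite (\<Union>a\<in>S. grp a)" using fin(2)[OF assms] grp by auto
  have "grp a \<noteq> {}" for a using grp(2)[of a] m by auto
  thus "(\<Union>a\<in>S. grp a) \<noteq> {}" using fin(2)[OF assms] by auto
  have "card (\<Union>a\<in>S. grp a) \<le> (\<Sum>a\<in>S. card (grp a))" using fin(2)[OF assms] by (intro card_UN_le) auto
  also have "\<dots> \<le> 3 * m" using fin(2)[OF assms] grp(2) by simp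
  finally show "card (\<Union>a\<in>S. grp a) \<le> 3 * m" .
qed

lemma clause_F: assumes "C \<in> F" shows "is_clause C \<and> card C \<le> 3 * m"
proof -
  obtain S b \<alpha> where "(S, b) \<in> Ax" "C = fclause (\<Union>a\<in>S. grp a) \<alpha>" using assms by (auto simp: F_def xlift_def)
  thus ?thesis using U is_clause_fclause card_fclause by metis
qed

lemma xlift_card: assumes "(S, b) \<in> Ax" shows "finite (xlift grp S b)" "card (xlift grp S b) \<le> 8 ^ m"
proof -
  let ?U = "\<Union>a\<in>S. grp a"
  let ?I = "(\<lambda>T. fclause ?U (\<lambda>v. v \<in> T)) ` Pow ?U"
  have fI: "finite ?I" using U(1)[OF assms] by simp
  show "finite (xlift grp S b)" by (rule finite_subset[OF xlift_image fI])
  have "card (xlift grp S b) \<le> card ?I" by (rule card_mono[OF fI xlift_image])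
  also have "\<dots> \<le> card (Pow ?U)" by (rule card_image_le) (use U(1)[OF assms] in simp)
  also have "\<dots> = 2 ^ card ?U" by (rule card_Pow) (rule U(1)[OF assms])
  also have "\<dots> \<le> 2 ^ (3 * m)" using U(3)[OF assms] by (intro power_increasing) auto
  also have "\<dots> = 8 ^ m" by (simp add: power_mult)
  finally show "card (xlift grp S b) \<le> 8 ^ m" .
qed

lemma F_card: "finite F" "card F \<le> card Ax * 8 ^ m"
proof -
  show "finite F" unfolding F_def using fin(1) xlift_card(1) by auto
  have "card F \<le> (\<Sum>p\<in>Ax. card (case p of (S, b) \<Rightarrow> xlift grp S b))" unfolding F_def by (rule card_UN_le[OF fin(1)])
  also have "\<dots> \<le> (\<Sum>p\<in>Ax. 8 ^ m)" by (rule sum_mono) (use xlift_card(2) in auto)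
  finally show "card F \<le> card Ax * 8 ^ m" by simp
qed

lemma F_CNF: "is_CNF (4 * m) F"
  unfolding is_CNF_def
proof (intro conjI ballI F_card(1))
  fix C assume "C \<in> F"
  from clause_F[OF this] show "is_clause C" "card C \<le> 4 * m" by auto
qed

lemma F_vars: "formula_vars F = (\<Union>a\<in>V. grp a)"
proof -
  have "formula_vars F = (\<Union>(S, b)\<in>Ax. \<Union>a\<in>S. grp a)"
  proof (intro equalityI subsetI)
    fix v assume "v \<in> formula_vars F"
    then obtain S b C where "(S, b) \<in> Ax" "C \<in> xlift grp S b" "v \<in> vars_clause C" by (auto simp: formula_vars_def F_def)
    thus "v \<in> (\<Union>(S, b)\<in>Ax. \<Union>a\<in>S. grp a)" by (fastforce simp: xlift_def)
  next
    fix v assume "v \<in> (\<Union>(S, b)\<in>Ax. \<Union>a\<in>S. grp a)"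
    then obtain S b where Sb: "(S, b) \<in> Ax" "v \<in> (\<Union>a\<in>S. grp a)" by auto
    obtain C where C: "C \<in> xlift grp S b" using xlift_nonempty U[OF Sb(1)] by metis
    hence "v \<in> vars_clause C" using Sb(2) by (auto simp: xlift_def)
    thus "v \<in> formula_vars F" using C Sb(1) by (auto simp: formula_vars_def F_def)
  qed
  thus ?thesis by (auto simp: V_def)
qed

lemma F_vars_card: "card (formula_vars F) = m * card V"
proof -
  have "finite V" unfolding V_def using fin by auto
  hence "card (\<Union>a\<in>V. grp a) = (\<Sum>a\<in>V. card (grp a))" using grp by (intro card_UN_disjoint) auto
  thus ?thesis using grp(2) F_vars by simp
qed

lemma F_size: "formula_size F \<le> card Ax * 8 ^ m * (3 * m)"
proof -
  have "formula_size F \<le> (\<Sum>C\<in>F. 3 * m)" unfolding formula_size_def by (rule sum_mono) (use clause_F in auto)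
  also have "\<dots> = card F * (3 * m)" by simp
  also have "\<dots> \<le> card Ax * 8 ^ m * (3 * m)" using F_card(2) by (intro mult_right_mono) auto
  finally show ?thesis .
qed

end

section \<open>Periods, moduli and parameters\<close>

lemma (in helix) row_uses_card: "card {j\<in>{0..<K}. row_uses i j} = nat e"
proof -
  have "{j\<in>{0..<K}. row_uses i j} = (\<lambda>l. (i + l) mod K) ` {0..<e}"
  proof (intro equalityI subsetI)
    fix j assume j: "j \<in> {j\<in>{0..<K}. row_uses i j}"
    hence "j = (i + (j - i) mod K) mod K" by (simp add: mod_simps)
    moreover have "(j - i) mod K \<in> {0..<e}" using j K by (simp add: row_uses_def)
    ultimately show "j \<in> (\<lambda>l. (i + l) mod K) ` {0..<e}" by blast
  next
    fix j assume "j \<in> (\<lambda>l. (i + l) mod K) ` {0..<e}"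
    then obtain l where l: "j = (i + l) mod K" "0 \<le> l" "l < e" by auto
    have "(j - i) mod K = l mod K" unfolding l(1) by (simp add: mod_simps)
    thus "j \<in> {j\<in>{0..<K}. row_uses i j}" using l e K by (simp add: row_uses_def)
  qed
  moreover have "inj_on (\<lambda>l. (i + l) mod K) {0..<e}"
  proof (rule inj_onI)
    fix l l' assume l: "l \<in> {0..<e}" "l' \<in> {0..<e}" "(i + l) mod K = (i + l') mod K"
    hence "K dvd (i + l) - (i + l')" by (simp only: mod_eq_dvd_iff)
    hence "K dvd l - l'" by simp
    moreover have "\<bar>l - l'\<bar> < K" using l e by auto
    ultimately have "l - l' = 0" by (rule small_dvd)
    thus "l = l'" by simp
  qed
  ultimately show ?thesis by (simp add: card_image)
qed

lemma (in helix) R_bounds: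
  assumes "\<And>j. int n \<le> q j" "\<And>j. q j \<le> int (2 * n)"
  shows "int (n ^ nat e) \<le> R i" "R i \<le> int ((2 * n) ^ nat e)"
proof -
  have "(\<Prod>j\<in>{j\<in>{0..<K}. row_uses i j}. int n) \<le> R i" unfolding R_def by (rule prod_mono) (use assms in auto)
  thus "int (n ^ nat e) \<le> R i" by (simp only: prod_constant row_uses_card of_nat_power)
  have "R i \<le> (\<Prod>j\<in>{j\<in>{0..<K}. row_uses i j}. int (2 * n))" unfolding R_def by (rule prod_mono) (use assms less_imp_le[OF q_pos] in auto)
  thus "R i \<le> int ((2 * n) ^ nat e)" by (simp only: prod_constant row_uses_card of_nat_power)
qed

text \<open>The cyclic window of \<open>e < K\<close> indices misses a factor, which is at least
  3.\<close>

lemma window_prod: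
  fixes q :: "int \<Rightarrow> int"
  assumes K: "e < K" "0 \<le> e" and q: "\<And>j. 3 \<le> q j"
  shows "(\<Prod>j\<in>{j\<in>{0..<K}. (j - i) mod K < e}. q j) \<le> (\<Prod>j\<in>{0..<K}. q j) div 2"
proof -
  let ?A = "{j\<in>{0..<K}. (j - i) mod K < e}" and ?u = "(i + e) mod K"
  have A: "finite ?A" by (rule finite_subset[of _ "{0..<K}"]) auto
  have "(?u - i) mod K = e mod K" by (simp add: mod_simps)
  hence u: "?u \<notin> ?A" "?u \<in> {0..<K}" using K by auto
  have p: "1 \<le> (\<Prod>j\<in>?A. q j)"
  proof -
    have "(\<Prod>j\<in>?A. (1::int)) \<le> (\<Prod>j\<in>?A. q j)" by (rule prod_mono) (use q order_trans[of 1 3] in force)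
    thus ?thesis by simp
  qed
  have "(\<Prod>j\<in>?A. q j) * 3 \<le> (\<Prod>j\<in>?A. q j) * q ?u" using p q by (intro mult_left_mono) auto
  also have "\<dots> = (\<Prod>j\<in>insert ?u ?A. q j)" using A u by simp
  also have "\<dots> \<le> (\<Prod>j\<in>{0..<K}. q j)"
  proof (rule prod_mono2)
    show "1 \<le> q b" for b using q[of b] by simp
    show "0 \<le> q a" for a using q[of a] by simp
  qed (use u in auto)
  finally show ?thesis using p by linarith
qed

text \<open>The formulas and their size bounds are needed for every \<open>n\<close>, coprime moduli
  only for the lower bound at large \<open>n\<close>. Elsewhere all moduli may equal
  \<open>n\<close>.\<close>

lemma moduli_exist:
  "\<exists>n1::nat. \<forall>n k. \<exists>q::int \<Rightarrow> int. (\<forall>j. int n \<le> q j \<and> q j \<le> int (2 * n)) \<and>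
     (n1 \<le> n \<longrightarrow> real k \<le> real n / (2 * ln (real n)) \<longrightarrow>
       (\<forall>i\<in>{0..<int k + 1}. \<forall>j\<in>{0..<int k + 1}. i \<noteq> j \<longrightarrow> coprime (q i) (q j)))"
proof -
  obtain n1 where n1: "\<And>n k. n \<ge> n1 \<Longrightarrow> real k \<le> real n / (2 * ln (real n)) \<Longrightarrow> k + 1 \<le> card {p. prime p \<and> n \<le> p \<and> p \<le> 2 * n}"
    using primes_in_interval by blast
  show ?thesis
  proof (intro exI[of _ n1] allI)
    fix n k
    show "\<exists>q::int \<Rightarrow> int. (\<forall>j. int n \<le> q j \<and> q j \<le> int (2 * n)) \<and>
     (n1 \<le> n \<longrightarrow> real k \<le> real n / (2 * ln (real n)) \<longrightarrow>
       (\<forall>i\<in>{0..<int k + 1}. \<forall>j\<in>{0..<int k + 1}. i \<noteq> j \<longrightarrow> coprime (q i) (q j)))"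
    proof (cases "n1 \<le> n \<and> real k \<le> real n / (2 * ln (real n))")
      case False
      thus ?thesis by (intro exI[of _ "\<lambda>_. int n"]) auto
    next
      case True
      let ?P = "{p. prime p \<and> n \<le> p \<and> p \<le> 2 * n}"
      have "k + 1 \<le> card ?P" using n1 True by blast
      then obtain B where B: "B \<subseteq> ?P" "card B = k + 1" "finite B" by (rule obtain_subset_with_card_n)
      obtain h where h: "bij_betw h {0..<k + 1} B" using ex_bij_betw_nat_finite[OF B(3)] B(2) by auto
      let ?q = "\<lambda>j::int. if 0 \<le> j \<and> j < int k + 1 then int (h (nat j)) else int n"
      have hB: "h (nat j) \<in> ?P" if "0 \<le> j" "j < int k + 1" for j
      proof -
        have "nat j \<in> {0..<k + 1}" using that by auto
        hence "h (nat j) \<in> B" using h bij_betwE by blast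
        thus ?thesis using B(1) by blast
      qed
      have "coprime (?q i) (?q j)" if ij: "i \<in> {0..<int k + 1}" "j \<in> {0..<int k + 1}" "i \<noteq> j" for i j
      proof -
        have "inj_on h {0..<k + 1}" using h by (simp add: bij_betw_def)
        moreover have "nat i \<in> {0..<k + 1}" "nat j \<in> {0..<k + 1}" "nat i \<noteq> nat j" using ij by auto
        ultimately have "h (nat i) \<noteq> h (nat j)" unfolding inj_on_def by blast
        hence "coprime (h (nat i)) (h (nat j))" using hB[of i] hB[of j] ij by (intro primes_coprime) auto
        thus ?thesis using ij by (simp add: coprime_int_iff)
      qed
      moreover have "int n \<le> ?q j \<and> ?q j \<le> int (2 * n)" for j
        using hB[of j] by auto
      ultimately show ?thesis by (intro exI[of _ ?q]) blast
    qed
  qed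
qed

text \<open>The last item turns the permitted width into less than \<open>m - 1\<close> times
  \<open>W + 1\<close> for \<open>W = k + e\<close>.\<close>

lemma parameter_facts:
  fixes n k :: nat and \<epsilon> :: real
  assumes "4 \<le> k" "real k \<le> real n / (2 * ln (real n))" "4 / real k < \<epsilon>" "\<epsilon> < 1 - 1 / real k"
  defines "e \<equiv> nat \<lfloor>\<epsilon> * real k\<rfloor>"
  shows "3 \<le> n" "4 \<le> e" "e + 2 \<le> k" "(1 + \<epsilon>) * real k < real (k + e + 1)"
proof -
  have "real n / (2 * ln (real n)) \<noteq> 0" using assms(1,2) by linarith
  hence "n \<noteq> 0" "n \<noteq> 1" by auto
  hence n2: "2 \<le> n" by auto
  have "ln 2 \<le> ln (real n)" using n2 by (subst ln_le_cancel_iff) auto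
  hence l: "2 / 3 \<le> ln (real n)" using ln2_ge_two_thirds by simp
  have "4 \<le> real n / (2 * ln (real n))" using assms(1,2) by simp
  hence "8 * ln (real n) \<le> real n" using l by (simp add: pos_le_divide_eq)
  thus "3 \<le> n" using l by linarith
  have k0: "0 < real k" using assms(1) by simp
  have "4 < \<epsilon> * real k" using assms(3) k0 by (simp add: pos_divide_less_eq)
  hence fl: "4 \<le> \<lfloor>\<epsilon> * real k\<rfloor>" by linarith
  thus "4 \<le> e" unfolding e_def by linarith
  have "\<epsilon> * real k < (1 - 1 / real k) * real k" using assms(4) k0 by (rule mult_strict_right_mono)
  hence "\<epsilon> * real k < real k - 1" using k0 by (simp add: algebra_simps)
  thus "e + 2 \<le> k" using fl unfolding e_def by linarith
  have "\<epsilon> * real k < real e + 1" using fl unfolding e_def by linarith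
  thus "(1 + \<epsilon>) * real k < real (k + e + 1)" by (simp add: algebra_simps)
qed

definition grp :: "nat \<Rightarrow> nat \<times> int \<Rightarrow> nat set" where "grp m a = (\<lambda>t. to_nat (a, t)) ` {..<m}"

lemma grp_props: "finite (grp m a)" "card (grp m a) = m" "a \<noteq> b \<Longrightarrow> grp m a \<inter> grp m b = {}"
proof -
  show "finite (grp m a)" by (simp add: grp_def)
  have "inj_on (\<lambda>t. to_nat (a, t)) {..<m}" by (auto simp: inj_on_def)
  thus "card (grp m a) = m" by (simp add: grp_def card_image)
  show "a \<noteq> b \<Longrightarrow> grp m a \<inter> grp m b = {}" by (auto simp: grp_def)
qed

definition hard_formula :: "nat \<Rightarrow> nat \<Rightarrow> nat \<Rightarrow> nat \<Rightarrow> real \<Rightarrow> nat formula \<Rightarrow> bool" where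
  "hard_formula n0 n m k \<epsilon> F \<longleftrightarrow> unsatisfiable F \<and> is_CNF (4 * m) F \<and>
       2 * k\<^sup>2 * n ^ nat \<lfloor>\<epsilon> * real k\<rfloor> * m \<le> card (formula_vars F) \<and>
       card (formula_vars F) \<le> 40 * k\<^sup>2 * (2 * n) ^ nat \<lfloor>\<epsilon> * real k\<rfloor> * m \<and>
       (\<exists>\<pi>. is_refutation F \<pi> \<and> width \<pi> \<le> m * (k + 3)) \<and>
       real (formula_size F) \<le> 9 * 16 ^ m * real (card (formula_vars F)) \<and>
       (n \<ge> n0 \<longrightarrow> (\<forall>\<pi>. is_refutation F \<pi> \<and> treelike \<pi> \<and>
          real (width \<pi>) \<le> (real m - 1) * (1 + \<epsilon>) * real k \<longrightarrow>
          real (size_of \<pi>) \<ge> 2 powr real n ^ k))"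

lemma formula_exists:
  "\<exists>n0. \<forall>n m k \<epsilon>. m \<ge> 3 \<and> 4 \<le> k \<and> real k \<le> real n / (2 * ln (real n)) \<and>
      4 / real k < \<epsilon> \<and> \<epsilon> < 1 - 1 / real k \<longrightarrow> (\<exists>F. hard_formula n0 n m k \<epsilon> F)"
proof -
  obtain n1 :: nat where n1: "\<And>n k. \<exists>q::int \<Rightarrow> int. (\<forall>j. int n \<le> q j \<and> q j \<le> int (2 * n)) \<and>
     (n1 \<le> n \<longrightarrow> real k \<le> real n / (2 * ln (real n)) \<longrightarrow>
       (\<forall>i\<in>{0..<int k + 1}. \<forall>j\<in>{0..<int k + 1}. i \<noteq> j \<longrightarrow> coprime (q i) (q j)))"
    using moduli_exist by blast
  show ?thesis
  \<comment> \<open>From \<open>n \<ge> 8\<close> the product of the moduli is at least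
    \<open>8 * n ^ k\<close>, so \<open>T\<close> is at least \<open>4 * n ^ k\<close> and exceeds
    \<open>2 * n ^ k + 1\<close>.\<close>
  proof (intro exI[of _ "max n1 8"] allI impI)
    fix n m k :: nat and \<epsilon> :: real
    assume as: "m \<ge> 3 \<and> 4 \<le> k \<and> real k \<le> real n / (2 * ln (real n)) \<and> 4 / real k < \<epsilon> \<and> \<epsilon> < 1 - 1 / real k"
    define e where "e = nat \<lfloor>\<epsilon> * real k\<rfloor>"
    have pf: "3 \<le> n" "4 \<le> e" "e + 2 \<le> k" "(1 + \<epsilon>) * real k < real (k + e + 1)"
      using parameter_facts[of k n \<epsilon>] as unfolding e_def by auto
    obtain q :: "int \<Rightarrow> int" where q': "\<forall>j. int n \<le> q j \<and> q j \<le> int (2 * n)"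
      and cop': "n1 \<le> n \<longrightarrow> real k \<le> real n / (2 * ln (real n)) \<longrightarrow>
        (\<forall>i\<in>{0..<int k + 1}. \<forall>j\<in>{0..<int k + 1}. i \<noteq> j \<longrightarrow> coprime (q i) (q j))"
      using n1[of n k] by (elim exE conjE)
    have q: "\<And>j. int n \<le> q j" "\<And>j. q j \<le> int (2 * n)" using q' by simp_all
    have cop: "coprime (q i) (q j)" if "n1 \<le> n" "i \<in> {0..<int k + 1}" "j \<in> {0..<int k + 1}" "i \<noteq> j" for i j
      using cop' as that by blast
    have q3: "3 \<le> q j" for j using q(1)[of j] pf(1) by simp
    define K where "K = int k + 1"
    define T where "T = (\<Prod>j\<in>{0..<K}. q j) div 2"
    have KP: "2 \<le> K" "1 \<le> int e" "int e < K" using as pf by (auto simp: K_def)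
    have Tw: "(\<Prod>j\<in>{j\<in>{0..<K}. (j - i) mod K < int e}. q j) \<le> T" for i
      unfolding T_def using KP q3 by (intro window_prod) auto
    \<comment> \<open>Here \<open>Q = D = 2 * k\<close> exceeds \<open>W + 1 = k + e + 1\<close>,
      because \<open>e + 2 \<le> k\<close>.\<close>
    interpret H: helix K "int e" "2 * int k" "2 * int k" T q
    proof
      have "1 \<le> (\<Prod>j\<in>{j\<in>{0..<K}. (j - 0) mod K < int e}. q j)"
      proof -
        have "(\<Prod>j\<in>{j\<in>{0..<K}. (j - 0) mod K < int e}. (1::int)) \<le> (\<Prod>j\<in>{j\<in>{0..<K}. (j - 0) mod K < int e}. q j)"
          by (rule prod_mono) (use q3 order_trans[of 1 3] in force)
        thus ?thesis by simp
      qed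
      thus "1 \<le> T" using Tw[of 0] by linarith
    qed (use as KP q3 Tw in auto)
    have finS: "(S, b) \<in> H.axioms_xor \<Longrightarrow> finite S \<and> S \<noteq> {} \<and> card S \<le> 3" for S b
      using H.finite_inc H.card_inc by (auto simp: H.axioms_xor_def H.inc_def Let_def)
    interpret L: lifted_system H.axioms_xor "grp m" m
    proof
      show "finite H.axioms_xor" using H.axioms_card by blast
      show "1 \<le> m" using as by simp
    qed (use finS in blast, rule grp_props grp_props(3), simp_all add: grp_props)
    have LV: "L.V = H.allvars"
    proof -
      have "L.V = \<Union>(fst ` H.axioms_xor)" by (simp add: L.V_def split_beta)
      also have "fst ` H.axioms_xor = H.inc ` {s. H.lo \<le> snd s \<and> snd s < H.hi}"
        unfolding H.axioms_xor_def setcompr_eq_image image_image by simp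
      finally show ?thesis by (simp add: H.allvars_def)
    qed
    let ?F = "L.F" and ?N = "card (formula_vars L.F)"
    have N: "?N = m * card H.allvars" using L.F_vars_card LV by simp
    have kk: "nat K = k + 1" by (simp add: K_def)
    have derivable: "derivable ?F (m * (k + 3)) {}"
    proof (rule H.sweep[OF grp_props L.F_def])
      have "nat K + 2 = k + 3" using kk by simp
      thus "(nat K + 2) * m \<le> m * (k + 3)" by (simp only: mult.commute)
    qed
    have Rb: "int (n ^ e) \<le> H.R i" "H.R i \<le> int ((2 * n) ^ e)" for i
      using H.R_bounds[OF q, of i] by simp_all
    have lower: "2 * k\<^sup>2 * n ^ e * m \<le> ?N"
    proof -
      have "2 * k\<^sup>2 * n ^ e \<le> (k + 1) * (2 * k) * n ^ e" by (intro mult_right_mono) (auto simp: power2_eq_square)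
      also have "\<dots> \<le> card H.allvars" using H.allvars_lower[OF Rb(1)] kk by (simp add: nat_mult_distrib)
      finally show ?thesis unfolding N by simp
    qed
    have upper: "?N \<le> 40 * k\<^sup>2 * (2 * n) ^ e * m"
    proof -
      define x where "x = (2 * n) ^ e"
      have x: "1 \<le> x" using pf by (simp add: x_def)
      have "card H.allvars \<le> 3 * (2 * (2 * k) * (k + 1) + (k + 1) * (2 * k) * x)"
        using H.allvars_upper[OF Rb(2)] kk by (simp add: x_def nat_mult_distrib)
      also have "\<dots> \<le> 3 * (2 * (2 * k) * (2 * k) * x + (2 * k) * (2 * k) * x)"
      proof -
        have a: "k + 1 \<le> 2 * k" using as by simp
        have "2 * (2 * k) * (k + 1) * 1 \<le> 2 * (2 * k) * (2 * k) * x" using a x by (intro mult_mono) auto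
        moreover have "(k + 1) * (2 * k) * x \<le> (2 * k) * (2 * k) * x" using a by (intro mult_right_mono) auto
        ultimately show ?thesis by (intro mult_left_mono add_mono) simp_all
      qed
      also have "\<dots> \<le> 40 * k\<^sup>2 * x" by (simp add: power2_eq_square algebra_simps)
      finally show ?thesis unfolding N x_def by simp
    qed
    have size: "real (formula_size ?F) \<le> 9 * 16 ^ m * real ?N"
    proof -
      have "formula_size ?F \<le> card H.axioms_xor * 8 ^ m * (3 * m)" by (rule L.F_size)
      \<comment> \<open>Three constraints per variable of the helix and width \<open>3 * m\<close>
        give the factor 9; \<open>m * card H.allvars\<close> is the number of bits.\<close>
      also have "\<dots> \<le> (3 * card H.allvars) * 16 ^ m * (3 * m)"
        using H.axioms_card by (intro mult_mono power_mono) auto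
      also have "\<dots> = 9 * 16 ^ m * ?N" unfolding N by simp
      finally have "real (formula_size ?F) \<le> real (9 * 16 ^ m * ?N)" by (simp only: of_nat_le_iff)
      thus ?thesis by simp
    qed
    have hard: "real (size_of \<pi>) \<ge> 2 powr real n ^ k"
      if n0: "n \<ge> max n1 8" and \<pi>: "is_refutation ?F \<pi>" "treelike \<pi>" "real (width \<pi>) \<le> (real m - 1) * (1 + \<epsilon>) * real k" for \<pi>
    proof -
      interpret B: helix_lb K "int e" "2 * int k" "2 * int k" T q "k + e"
      proof
        show "coprime (q i) (q j)" if "i \<in> {0..<K}" "j \<in> {0..<K}" "i \<noteq> j" for i j
          using cop[of i j] n0 that by (simp add: K_def)
        show "T = (\<Prod>j\<in>{0..<K}. q j) div 2" by (rule T_def)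
      qed (use pf in \<open>simp_all add: K_def\<close>)
      interpret P: parity_lifting "grp m" m
      proof
        show "2 \<le> m" using as by simp
      qed (rule grp_props, rule grp_props, erule grp_props)
      have big: "2 * int (n ^ k) + 1 < T"
      proof -
        have "int n ^ (k + 1) = (\<Prod>j\<in>{0..<K}. int n)" by (simp add: kk)
        also have "\<dots> \<le> (\<Prod>j\<in>{0..<K}. q j)" by (rule prod_mono) (use q in auto)
        finally have "int n * int n ^ k \<le> (\<Prod>j\<in>{0..<K}. q j)" by simp
        moreover have "8 * int n ^ k \<le> int n * int n ^ k" by (rule mult_right_mono) (use n0 in auto)
        moreover have "1 \<le> int n ^ k" using pf by simp
        ultimately have "8 * int n ^ k \<le> (\<Prod>j\<in>{0..<K}. q j)" "1 \<le> int n ^ k" by linarith+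
        thus ?thesis unfolding T_def by simp
      qed
      have w: "card (fst (\<pi> ! i)) < (m - 1) * (k + e + 1)" if i: "i < length \<pi>" for i
      proof -
        have "card (fst (\<pi> ! i)) \<le> width \<pi>"
          unfolding width_def using i by (intro Max_ge) auto
        hence "real (card (fst (\<pi> ! i))) \<le> (real m - 1) * ((1 + \<epsilon>) * real k)" using \<pi>(3) by (simp add: mult.assoc)
        also have "\<dots> < (real m - 1) * real (k + e + 1)" using pf(4) as by (intro mult_strict_left_mono) auto
        also have "\<dots> = real ((m - 1) * (k + e + 1))" 
        proof -
          have "real (m - 1) = real m - 1" using as by (simp add: of_nat_diff)
          thus ?thesis by (simp only: of_nat_mult)
        qed
        finally show ?thesis by (simp only: of_nat_less_iff)
      qed
      have "2 ^ (n ^ k) \<le> length \<pi>"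
      proof (rule P.treelike_size[where L = "B.Lfam (n ^ k)" and W = "k + e", OF L.F_def])
        show "finite S" if "(S, b) \<in> H.axioms_xor" for S b using finS[OF that] by simp
        show "H.axioms_xor \<subseteq> B.Lfam (n ^ k) (n ^ k)" by (rule B.Lfam_axioms)
        show "B.Lfam (n ^ k) (Suc d) \<subseteq> B.Lfam (n ^ k) d" for d by (rule B.Lfam_decreasing)
        show "b = 0" if "({}, b) \<in> B.Lfam (n ^ k) 0" for b using B.Lfam_empty[OF that] .
        show "((A - B) \<union> (B - A), a + b) \<in> B.Lfam (n ^ k) d"
          if "d < n ^ k" "(A, a) \<in> B.Lfam (n ^ k) (Suc d)" "(B, b) \<in> B.Lfam (n ^ k) (Suc d)" "card (A \<union> B) \<le> k + e" for d A a B b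
          using B.Lfam_closed[OF that(2,3,4,1) big] .
      qed (use \<pi> w in auto)
      hence "real (2 ^ (n ^ k)) \<le> real (size_of \<pi>)" unfolding size_of_def by (simp only: of_nat_le_iff)
      moreover have "2 powr real n ^ k = real (2 ^ (n ^ k))"
        by (simp add: powr_realpow[symmetric])
      ultimately show ?thesis by simp
    qed
    show "\<exists>F. hard_formula (max n1 8) n m k \<epsilon> F"
      using derivable_unsat[OF derivable] L.F_CNF lower upper derivable_refutation[OF derivable] size hard
      unfolding hard_formula_def e_def[symmetric] by (intro exI[of _ ?F] conjI allI impI) auto
  qed
qed

theorem mainTheorem9:
  "\<exists>(C::real) (c::real) (n0::nat). C > 0 \<and> c > 0 \<and>
     (\<forall>(m :: nat \<Rightarrow> nat) (k :: nat \<Rightarrow> nat) (\<epsilon> :: nat \<Rightarrow> real).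
        \<exists>(F :: nat \<Rightarrow> nat formula) (N :: nat \<Rightarrow> nat). \<forall>n.
          m n \<ge> 3 \<and>
          4 \<le> k n \<and> real (k n) \<le> real n / (2 * ln (real n)) \<and>
          4 / real (k n) < \<epsilon> n \<and> \<epsilon> n < 1 - 1 / real (k n) \<longrightarrow>
            unsatisfiable (F n) \<and>
            is_CNF (4 * m n) (F n) \<and>
            card (formula_vars (F n)) = N n \<and>
            2 * (k n)\<^sup>2 * n ^ nat \<lfloor>\<epsilon> n * real (k n)\<rfloor> * m n \<le> N n \<and>
            N n \<le> 40 * (k n)\<^sup>2 * (2 * n) ^ nat \<lfloor>\<epsilon> n * real (k n)\<rfloor> * m n \<and>
            (\<exists>\<pi>. is_refutation (F n) \<pi> \<and> width \<pi> \<le> m n * (k n + 3)) \<and>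
            (n \<ge> n0 \<longrightarrow> real (formula_size (F n)) \<le> C * 16 ^ m n * real (N n)) \<and>
            (n \<ge> n0 \<longrightarrow>
              (\<forall>\<pi>. is_refutation (F n) \<pi> \<and> treelike \<pi> \<and>
                 real (width \<pi>) \<le> (real (m n) - 1) * (1 + \<epsilon> n) * real (k n) \<longrightarrow>
                 real (size_of \<pi>) \<ge> 2 powr (c * real n ^ k n))))"
proof -
  obtain n0 where n0: "\<And>n m k \<epsilon>. m \<ge> 3 \<and> 4 \<le> k \<and> real k \<le> real n / (2 * ln (real n)) \<and>
      4 / real k < \<epsilon> \<and> \<epsilon> < 1 - 1 / real k \<Longrightarrow> \<exists>F. hard_formula n0 n m k \<epsilon> F"
    using formula_exists by blast
  show ?thesis
  proof (rule exI[of _ 9], rule exI[of _ 1], rule exI[of _ n0], intro conjI allI)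
    fix m k :: "nat \<Rightarrow> nat" and \<epsilon> :: "nat \<Rightarrow> real"
    define F :: "nat \<Rightarrow> nat formula" where "F n = (SOME F. hard_formula n0 n (m n) (k n) (\<epsilon> n) F)" for n
    have F: "hard_formula n0 n (m n) (k n) (\<epsilon> n) (F n)" if "m n \<ge> 3 \<and> 4 \<le> k n \<and> real (k n) \<le> real n / (2 * ln (real n)) \<and>
          4 / real (k n) < \<epsilon> n \<and> \<epsilon> n < 1 - 1 / real (k n)" for n
      unfolding F_def by (rule someI_ex) (rule n0[OF that])
    show "\<exists>(F :: nat \<Rightarrow> nat formula) (N :: nat \<Rightarrow> nat). \<forall>n.
          m n \<ge> 3 \<and>
          4 \<le> k n \<and> real (k n) \<le> real n / (2 * ln (real n)) \<and>
          4 / real (k n) < \<epsilon> n \<and> \<epsilon> n < 1 - 1 / real (k n) \<longrightarrow>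
            unsatisfiable (F n) \<and>
            is_CNF (4 * m n) (F n) \<and>
            card (formula_vars (F n)) = N n \<and>
            2 * (k n)\<^sup>2 * n ^ nat \<lfloor>\<epsilon> n * real (k n)\<rfloor> * m n \<le> N n \<and>
            N n \<le> 40 * (k n)\<^sup>2 * (2 * n) ^ nat \<lfloor>\<epsilon> n * real (k n)\<rfloor> * m n \<and>
            (\<exists>\<pi>. is_refutation (F n) \<pi> \<and> width \<pi> \<le> m n * (k n + 3)) \<and>
            (n \<ge> n0 \<longrightarrow> real (formula_size (F n)) \<le> 9 * 16 ^ m n * real (N n)) \<and>
            (n \<ge> n0 \<longrightarrow>
              (\<forall>\<pi>. is_refutation (F n) \<pi> \<and> treelike \<pi> \<and>
                 real (width \<pi>) \<le> (real (m n) - 1) * (1 + \<epsilon> n) * real (k n) \<longrightarrow>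
                 real (size_of \<pi>) \<ge> 2 powr (1 * real n ^ k n)))"
      using F unfolding hard_formula_def by (intro exI[of _ F] exI[of _ "\<lambda>n. card (formula_vars (F n))"] allI impI) simp
  qed simp_all
qed

end
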